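(* Let $S=\langle n_1,n_2,n_3,n_4\rangle$ be a $4$-generated pseudo symmetric numerical semigroup with defining integers $\alpha_1,\alpha_2,\alpha_3,\alpha_4,\alpha_{21}$, and let $K$ be a field. Then $K[S]$ has a strongly indispensable minimal $S$-graded free resolution if and only if $\alpha_4>2$ and $\alpha_1-\alpha_{21}>2$.
   Context: Setting. $n_1,\dots,n_4$ are positive integers with $\gcd(n_1,\dots,n_4)=1$, and $S=\langle n_1,\dots,n_4\rangle=\{u_1n_1+\cdots+u_4n_4 \mid u_i\in\mathbb N\}$ ($0\in\mathbb N$) is the numerical semigroup they generate; $S$ is $4$-generated, i.e. $n_1,\dots,n_4$ is its minimal generating set. The set of pseudo Frobenius numbers is $PF(S)=\{n\in\mathbb Z\setminus S \mid n+s\in S \text{ for all } s\in S\setminus\{0\}\}$, and $g(S)=\max PF(S)$ is the Frobenius number. $S$ is pseudo symmetric if $PF(S)=\{g(S)/2,g(S)\}$. By a theorem of Komeda, for $S$ pseudo symmetric the generators can be labelled so that there are integers $\alpha_i>1$ ($1\le i\le 4$) and $\alpha_{21}$ with $0<\alpha_{21}<\alpha_1$ such that $n_1=\alpha_2\alpha_3(\alpha_4-1)+1$, $n_2=\alpha_{21}\alpha_3\alpha_4+(\alpha_1-\alpha_{21}-1)(\alpha_3-1)+\alpha_3$, $n_3=\alpha_1\alpha_4+(\alpha_1-\alpha_{21}-1)(\alpha_2-1)(\alpha_4-1)-\alpha_4+1$, $n_4=\alpha_1\alpha_2(\alpha_3-1)+\alpha_{21}(\alpha_2-1)+\alpha_2$.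 Such a labelling and such integers (the defining integers of $S$) are fixed. Minimality of the generating set forces $\alpha_1-\alpha_{21}\ge 2$. Let $A=K[X_1,\dots,X_4]$, $S$-graded by $\deg_S(X_i)=n_i$, and let $K[S]=K[t^{n_1},\dots,t^{n_4}]\cong A/I_S$, where $I_S$ is the kernel of $A\to K[S]$, $X_i\mapsto t^{n_i}$. Minimal $S$-graded free resolutions of $K[S]$ over $A$ are considered as based complexes: each resolution starts with $F_0=A$ (with basis $\{1\}$ and augmentation the canonical map $A\to A/I_S$), and every free module in it comes with a chosen $S$-homogeneous basis. A minimal $S$-graded free resolution $(\mathbf F,\phi)$ is called strongly indispensable if for every minimal $S$-graded free resolution $(\mathbf G,\theta)$ of $K[S]$ (with any choice of homogeneous bases) there is an injective map of complexes $i:(\mathbf F,\phi)\to(\mathbf G,\theta)$ of based complexes, i.e. an injective degree-preserving $A$-linear chain map with $i_0=\mathrm{id}_A$ sending each basis element of $\mathbf F$ to a nonzero scalar (element of $K$) multiple of a basis element of $\mathbf G$. *)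

theory Defs
  imports
    "HOL-Library.Numeral_Type"
    "HOL-Library.Poly_Mapping"
    "HOL-Computational_Algebra.Polynomial"
    "Jordan_Normal_Form.Matrix"
begin

section \<open>Numerical semigroups with four generators\<close>

text \<open>
  Indices live in the four-element type \<^typ>\<open>4\<close> of integers modulo four. There the numeral 4
  equals 0, so 1, 2, 3, 4 are distinct and exhaust the type.
\<close>

definition gen_semigroup :: "(4 \<Rightarrow> nat) \<Rightarrow> 4 set \<Rightarrow> nat set" where
  "gen_semigroup n J = {s. \<exists>u :: 4 \<Rightarrow> nat. s = (\<Sum>i\<in>J. u i * n i)}"

definition minimally_generating :: "(4 \<Rightarrow> nat) \<Rightarrow> bool" where
  "minimally_generating n \<longleftrightarrow> (\<forall>J. J \<subset> UNIV \<longrightarrow> gen_semigroup n J \<noteq> gen_semigroup n UNIV)"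

definition pseudo_frobenius :: "nat set \<Rightarrow> int set" where
  "pseudo_frobenius S = {x. x \<notin> int ` S \<and> (\<forall>s\<in>S - {0}. x + int s \<in> int ` S)}"

definition frobenius :: "nat set \<Rightarrow> int" where
  "frobenius S = Max (pseudo_frobenius S)"

text \<open>Equality is stated in the rationals, so that it also says that the Frobenius number is even.\<close>

definition pseudo_symmetric :: "nat set \<Rightarrow> bool" where
  "pseudo_symmetric S \<longleftrightarrow>
     (of_int ` pseudo_frobenius S :: rat set) = {of_int (frobenius S) / 2, of_int (frobenius S)}"

text \<open>
  Komeda's parametrization of the generators of a pseudo symmetric semigroup, for the given labelling;
  stated over the integers, so no subtraction is truncated.
\<close>

definition defining_integers :: "(4 \<Rightarrow> nat) \<Rightarrow> (4 \<Rightarrow> int) \<Rightarrow> int \<Rightarrow> bool" where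
  "defining_integers n \<alpha> \<alpha>21 \<longleftrightarrow>
     (\<forall>i. 1 < \<alpha> i) \<and> 0 < \<alpha>21 \<and> \<alpha>21 < \<alpha> 1 \<and>
     int (n 1) = \<alpha> 2 * \<alpha> 3 * (\<alpha> 4 - 1) + 1 \<and>
     int (n 2) = \<alpha>21 * \<alpha> 3 * \<alpha> 4 + (\<alpha> 1 - \<alpha>21 - 1) * (\<alpha> 3 - 1) + \<alpha> 3 \<and>
     int (n 3) = \<alpha> 1 * \<alpha> 4 + (\<alpha> 1 - \<alpha>21 - 1) * (\<alpha> 2 - 1) * (\<alpha> 4 - 1) - \<alpha> 4 + 1 \<and>
     int (n 4) = \<alpha> 1 * \<alpha> 2 * (\<alpha> 3 - 1) + \<alpha>21 * (\<alpha> 2 - 1) + \<alpha> 2"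


section \<open>The graded polynomial ring and the toric ideal\<close>

type_synonym mon = "4 \<Rightarrow>\<^sub>0 nat"
type_synonym 'k pring = "mon \<Rightarrow>\<^sub>0 'k"

definition sdeg :: "(4 \<Rightarrow> nat) \<Rightarrow> mon \<Rightarrow> nat" where
  "sdeg n m = (\<Sum>i\<in>UNIV. Poly_Mapping.lookup m i * n i)"

text \<open>The substitution of \<open>t ^ n i\<close> for the \<open>i\<close>-th variable, with values in \<open>K[t]\<close>; its range is \<open>K[S]\<close>.\<close>

definition toric_map :: "(4 \<Rightarrow> nat) \<Rightarrow> 'k::field pring \<Rightarrow> 'k poly" where
  "toric_map n p =
     (\<Sum>m\<in>Poly_Mapping.keys p. Polynomial.smult (Poly_Mapping.lookup p m)
        (\<Prod>i\<in>UNIV. Polynomial.monom 1 (n i) ^ Poly_Mapping.lookup m i))"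

definition toric_ideal :: "(4 \<Rightarrow> nat) \<Rightarrow> 'k::field pring set" where
  "toric_ideal n = {p. toric_map n p = 0}"

text \<open>The ideal generated by the variables consists of the polynomials without constant term.\<close>

definition irrelevant_ideal :: "'k::field pring set" where
  "irrelevant_ideal = {p. Poly_Mapping.lookup p 0 = 0}"


section \<open>Based graded complexes and minimal free resolutions\<close>

text \<open>
  A based complex of finitely generated graded free modules is given in coordinates: the module in
  homological degree \<open>k\<close> is \<open>A\<close> to the power \<open>rk F k\<close>, its chosen basis is the standard one,
  the \<open>j\<close>-th basis element (\<open>j < rk F k\<close>) has degree \<open>bdeg F k j\<close>, and \<open>diff_mat F k\<close> is the
  matrix of the differential from homological degree \<open>k + 1\<close> to \<open>k\<close>. Changing homogeneous bases
  of a complex amounts to passing to another value of this type.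
\<close>

record (overloaded) 'k based_complex =
  rk :: "nat \<Rightarrow> nat"
  bdeg :: "nat \<Rightarrow> nat \<Rightarrow> nat"
  diff_mat :: "nat \<Rightarrow> 'k pring mat"

text \<open>
  The matrix \<open>M\<close> represents a map of degree zero from the free module whose basis has degrees \<open>c\<close>
  to the one whose basis has degrees \<open>r\<close>.
\<close>

definition degree_preserving ::
    "(4 \<Rightarrow> nat) \<Rightarrow> (nat \<Rightarrow> nat) \<Rightarrow> (nat \<Rightarrow> nat) \<Rightarrow> 'k::field pring mat \<Rightarrow> bool" where
  "degree_preserving n r c M \<longleftrightarrow>
     (\<forall>i<dim_row M. \<forall>j<dim_col M. \<forall>m\<in>Poly_Mapping.keys (M $$ (i, j)). sdeg n m + r i = c j)"

text \<open>
  Graded free resolutions of \<open>K[S]\<close>, starting with \<open>A\<close> (basis element 1 in degree 0) and augmented by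
  the canonical map to \<open>A\<close> modulo the toric ideal.
\<close>

definition graded_free_resolution :: "(4 \<Rightarrow> nat) \<Rightarrow> 'k::field based_complex \<Rightarrow> bool" where
  "graded_free_resolution n F \<longleftrightarrow>
     rk F 0 = 1 \<and> bdeg F 0 0 = 0 \<and>
     (\<forall>k. \<forall>j<rk F k. bdeg F k j \<in> gen_semigroup n UNIV) \<and>
     (\<forall>k. diff_mat F k \<in> carrier_mat (rk F k) (rk F (Suc k)) \<and>
          degree_preserving n (bdeg F k) (bdeg F (Suc k)) (diff_mat F k)) \<and>
     (\<lambda>v. diff_mat F 0 *\<^sub>v v) ` carrier_vec (rk F 1) =
       {w \<in> carrier_vec (rk F 0). w $ 0 \<in> toric_ideal n} \<and>
     (\<forall>k. (\<lambda>v. diff_mat F (Suc k) *\<^sub>v v) ` carrier_vec (rk F (Suc (Suc k))) =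
       {w \<in> carrier_vec (rk F (Suc k)). diff_mat F k *\<^sub>v w = 0\<^sub>v (rk F k)})"

definition minimal_graded_free_resolution :: "(4 \<Rightarrow> nat) \<Rightarrow> 'k::field based_complex \<Rightarrow> bool" where
  "minimal_graded_free_resolution n F \<longleftrightarrow>
     graded_free_resolution n F \<and>
     (\<forall>k. \<forall>i<rk F k. \<forall>j<rk F (Suc k). diff_mat F k $$ (i, j) \<in> irrelevant_ideal)"

text \<open>
  Injective maps of based complexes over the identity of \<open>A\<close>; \<open>Poly_Mapping.single 0 c\<close> is the
  constant polynomial \<open>c\<close>.
\<close>

definition based_embedding ::
    "(4 \<Rightarrow> nat) \<Rightarrow> 'k::field based_complex \<Rightarrow> 'k based_complex \<Rightarrow> (nat \<Rightarrow> 'k pring mat) \<Rightarrow> bool" where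
  "based_embedding n F G \<iota> \<longleftrightarrow>
     (\<forall>k. \<iota> k \<in> carrier_mat (rk G k) (rk F k) \<and>
          degree_preserving n (bdeg G k) (bdeg F k) (\<iota> k) \<and>
          inj_on (\<lambda>v. \<iota> k *\<^sub>v v) (carrier_vec (rk F k)) \<and>
          diff_mat G k * \<iota> (Suc k) = \<iota> k * diff_mat F k \<and>
          (\<forall>j<rk F k. \<exists>l<rk G k. \<exists>c. c \<noteq> 0 \<and>
             \<iota> k *\<^sub>v unit_vec (rk F k) j = Poly_Mapping.single 0 c \<cdot>\<^sub>v unit_vec (rk G k) l)) \<and>
     \<iota> 0 = 1\<^sub>m 1"

definition strongly_indispensable :: "(4 \<Rightarrow> nat) \<Rightarrow> 'k::field based_complex \<Rightarrow> bool" where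
  "strongly_indispensable n F \<longleftrightarrow>
     minimal_graded_free_resolution n F \<and>
     (\<forall>G. minimal_graded_free_resolution n G \<longrightarrow> (\<exists>\<iota>. based_embedding n F G \<iota>))"

end

theory Submission
  imports Defs
begin

text \<open>
  Whether a strongly indispensable resolution exists is decided by the degrees of the basis elements of a
  minimal resolution. If in every homological degree no two of these degrees differ by an element of the
  semigroup, then two minimal resolutions can only differ by reordering and rescaling their bases:
  homogeneous minimal generators of one module have no room for another choice
  (\<open>incomparable_generators_unique\<close>), and this propagates along the resolution
  (\<open>incomparable_degrees_strongly_indispensable\<close>). If, conversely, a difference lies in the semigroup, then a
  multiple of one basis element may be added to another, and in the two cases that occur no minimal
  resolution embeds, as a based complex, both into the old and into the new one.

  So the task is to know a minimal resolution and its degrees. By Komeda's relations the toric ideal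
  contains the binomials
  \<open>f1 = x\<^sup>b\<^sup>+\<^sup>c\<^sup>+\<^sup>1 - z w\<^sup>R\<close>, \<open>f2 = y\<^sup>P\<^sup>+\<^sup>1 - x\<^sup>b w\<close>, \<open>f3 = z\<^sup>Q\<^sup>+\<^sup>1 - x\<^sup>c y\<close>,
  \<open>f4 = w\<^sup>R\<^sup>+\<^sup>1 - x y\<^sup>P z\<^sup>Q\<close> and \<open>f5 = x\<^sup>b\<^sup>+\<^sup>1 z\<^sup>Q - y w\<^sup>R\<close>. Rewriting with them brings every
  monomial into the form \<open>x\<^sup>k y\<^sup>i z\<^sup>j w\<^sup>l\<close> with one of \<open>n1\<close> triples \<open>(i, j, l)\<close>, whose degrees are distinct modulo
  \<open>n1\<close> (\<open>normal_form\<close>, \<open>standard_unique\<close>). Hence the normal form of a monomial depends on its degree only. This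
  shows that the binomials generate the toric ideal, and it gives a test for membership of an
  integer in the semigroup: write it as \<open>k n1\<close> plus the degree of a standard monomial and look at the sign
  of \<open>k\<close> (\<open>not_in_semigroup\<close>).

  The resolution has ranks 1, 5, 6, 2. Its exactness is checked modulo \<open>x\<close>, where the binomials become
  monomials and syzygies can be read off by divisibility; since \<open>x\<close> is not a zero divisor, exactness modulo \<open>x\<close>
  lifts by descent on the degree (\<open>exact_by_descent\<close>).

  Comparing the degrees leaves two exceptional cases. The generator \<open>f4\<close> has the degree of
  \<open>x\<^sup>1\<^sup>-\<^sup>c y\<^sup>P\<^sup>-\<^sup>1 z\<^sup>Q f3\<close>, which is a multiple of \<open>f3\<close> precisely for \<open>c = 1\<close>, that is, for
  \<open>\<alpha>\<^sub>1 - \<alpha>\<^sub>2\<^sub>1 = 2\<close>. The Koszul syzygy of \<open>f2\<close> and \<open>f3\<close> has a degree above that of the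
  syzygy \<open>z\<^sup>Q f1 + w\<^sup>R f3 - x\<^sup>c f5 = 0\<close> precisely for \<open>R = 1\<close>, that is, for \<open>\<alpha>\<^sub>4 = 2\<close>, and then the
  degrees differ by that of \<open>x\<^sup>b\<close>.
\<close>

section \<open>Polynomials in four variables\<close>

abbreviation coef :: "('a \<Rightarrow>\<^sub>0 'b::zero) \<Rightarrow> 'a \<Rightarrow> 'b" where
  "coef \<equiv> Poly_Mapping.lookup"

abbreviation supp :: "('a \<Rightarrow>\<^sub>0 'b::zero) \<Rightarrow> 'a set" where
  "supp \<equiv> Poly_Mapping.keys"

abbreviation const :: "'k::field \<Rightarrow> 'k pring" where
  "const c \<equiv> Poly_Mapping.single 0 c"

lemma UNIV_4: "(UNIV :: 4 set) = {1, 2, 3, 4}"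
  by (rule sym, rule card_subset_eq) auto

definition expo :: "nat \<Rightarrow> nat \<Rightarrow> nat \<Rightarrow> nat \<Rightarrow> mon" where
  "expo i j k l = Poly_Mapping.single 1 i + Poly_Mapping.single 2 j
     + Poly_Mapping.single 3 k + Poly_Mapping.single 4 l"

definition monomial :: "nat \<Rightarrow> nat \<Rightarrow> nat \<Rightarrow> nat \<Rightarrow> 'k::field pring" where
  "monomial i j k l = Poly_Mapping.single (expo i j k l) 1"

lemma coef_expo [simp]:
  "coef (expo i j k l) 1 = i" "coef (expo i j k l) 2 = j"
  "coef (expo i j k l) 3 = k" "coef (expo i j k l) 4 = l"
  by (simp_all add: expo_def lookup_add lookup_single)

lemma mon_eqI:
  fixes m m' :: mon
  assumes "coef m 1 = coef m' 1" "coef m 2 = coef m' 2" "coef m 3 = coef m' 3" "coef m 4 = coef m' 4"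
  shows "m = m'"
proof (rule poly_mapping_eqI)
  fix i :: 4
  have "i \<in> {1, 2, 3, 4}" using UNIV_4 by blast
  then show "coef m i = coef m' i" using assms by auto
qed

lemma expo_coef: "expo (coef m 1) (coef m 2) (coef m 3) (coef m 4) = m"
  by (rule mon_eqI) simp_all

lemma expo_eq_iff [simp]:
  "expo i j k l = expo i' j' k' l' \<longleftrightarrow> i = i' \<and> j = j' \<and> k = k' \<and> l = l'"
  by (metis coef_expo)

lemma expo_zero [simp]: "expo 0 0 0 0 = 0"
  by (simp add: expo_def)

lemma expo_eq_zero_iff [simp]: "expo i j k l = 0 \<longleftrightarrow> i = 0 \<and> j = 0 \<and> k = 0 \<and> l = 0"
  using expo_eq_iff[of i j k l 0 0 0 0] by simp

lemma expo_add: "expo i j k l + expo i' j' k' l' = expo (i + i') (j + j') (k + k') (l + l')"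
  by (rule mon_eqI) (simp_all add: lookup_add)

lemma monomial_mult: "monomial i j k l * monomial i' j' k' l' = monomial (i + i') (j + j') (k + k') (l + l')"
  by (simp add: monomial_def mult_single expo_add)

lemma monomial_mult_left:
  "monomial i j k l * (monomial i' j' k' l' * p) = monomial (i + i') (j + j') (k + k') (l + l') * p"
  by (simp add: monomial_mult flip: mult.assoc)

lemma monomial_zero [simp]: "monomial 0 0 0 0 = 1"
  by (simp add: monomial_def)

lemma monomial_nonzero [simp]: "monomial i j k l \<noteq> 0"
proof
  assume "monomial i j k l = (0 :: 'k::field pring)"
  from arg_cong[OF this, of supp] show False by (simp add: monomial_def)
qed

lemma coef_monomial [simp]:
  "coef (monomial i j k l) (expo i' j' k' l') = (1 when i = i' \<and> j = j' \<and> k = k' \<and> l = l')"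
  by (auto simp: monomial_def lookup_single when_def)

lemma coef_monomial_zero [simp]:
  "coef (monomial i j k l) 0 = (1 when i = 0 \<and> j = 0 \<and> k = 0 \<and> l = 0)"
  using coef_monomial[of i j k l 0 0 0 0] by simp

lemma supp_monomial [simp]: "supp (monomial i j k l) = {expo i j k l}"
  by (simp add: monomial_def)

lemma sum_terms: "(\<Sum>m\<in>supp p. Poly_Mapping.single m (coef p m)) = p"
proof (rule poly_mapping_eqI)
  fix m
  show "coef (\<Sum>m\<in>supp p. Poly_Mapping.single m (coef p m)) m = coef p m"
    by (cases "m \<in> supp p")
      (auto simp: lookup_sum lookup_single when_def in_keys_iff sum.delta')
qed

lemma coef_monom_mult:
  fixes p :: "'k::field pring"
  shows "coef (Poly_Mapping.single m c * p) (m + m') = c * coef p m'"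
proof -
  have "Poly_Mapping.single m c * p
      = (\<Sum>u\<in>supp p. Poly_Mapping.single (m + u) (c * coef p u))"
    by (subst (1) sum_terms[of p, symmetric]) (simp add: sum_distrib_left mult_single)
  then show ?thesis
    by (auto simp: lookup_sum lookup_single when_def in_keys_iff sum.delta')
qed

lemma coef_const_mult [simp]: "coef (const c * p) m = c * coef p m"
  using coef_monom_mult[of 0 c p m] by simp

lemma const_inverse: "c \<noteq> 0 \<Longrightarrow> const (inverse c) * const c = 1" "c \<noteq> 0 \<Longrightarrow> const c * const (inverse c) = 1"
  by (simp_all add: mult_single)

lemma irrelevant_ideal_mult_left: "p \<in> irrelevant_ideal \<Longrightarrow> q * p \<in> irrelevant_ideal"
proof -
  assume p: "p \<in> irrelevant_ideal"
  have "0 \<notin> supp (q * p)"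
  proof
    assume "0 \<in> supp (q * p)"
    then obtain u v where uv: "u \<in> supp q" "v \<in> supp p" "0 = u + v"
      using keys_mult[of q p] by blast
    have "v = 0"
    proof (rule poly_mapping_eqI)
      fix i show "coef v i = coef 0 i"
        using arg_cong[OF uv(3), of "\<lambda>m. coef m i"] by (simp add: lookup_add)
    qed
    with uv p show False by (simp add: irrelevant_ideal_def in_keys_iff)
  qed
  then show ?thesis by (simp add: irrelevant_ideal_def in_keys_iff)
qed

lemma irrelevant_ideal_mult_right: "p \<in> irrelevant_ideal \<Longrightarrow> p * q \<in> irrelevant_ideal"
  using irrelevant_ideal_mult_left[of p q] by (simp add: mult.commute)

lemma irrelevant_ideal_sum:
  "(\<And>i. i \<in> I \<Longrightarrow> f i \<in> irrelevant_ideal) \<Longrightarrow> sum f I \<in> irrelevant_ideal"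
  by (simp add: irrelevant_ideal_def lookup_sum)


section \<open>Selecting terms\<close>

definition part :: "('a \<Rightarrow> bool) \<Rightarrow> ('a \<Rightarrow>\<^sub>0 'b::comm_monoid_add) \<Rightarrow> ('a \<Rightarrow>\<^sub>0 'b)" where
  "part P p = (\<Sum>m | m \<in> supp p \<and> P m. Poly_Mapping.single m (coef p m))"

lemma coef_part [simp]: "coef (part P p) m = (if P m then coef p m else 0)"
proof -
  have "coef (part P p) m = (\<Sum>u | u \<in> supp p \<and> P u. if u = m then coef p m else 0)"
    unfolding part_def lookup_sum lookup_single when_def by (rule sum.cong) auto
  then show ?thesis by (auto simp: in_keys_iff sum.delta)
qed

lemma part_add: "part P (p + q) = part P p + part P q"
  by (rule poly_mapping_eqI) (simp add: lookup_add)

lemma part_minus: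
  fixes p q :: "'a \<Rightarrow>\<^sub>0 'b::ab_group_add"
  shows "part P (p - q) = part P p - part P q"
  by (rule poly_mapping_eqI) (simp add: lookup_minus)

lemma part_uminus:
  fixes p :: "'a \<Rightarrow>\<^sub>0 'b::ab_group_add"
  shows "part P (- p) = - part P p"
  by (rule poly_mapping_eqI) simp

lemma part_zero [simp]: "part P 0 = 0"
  by (rule poly_mapping_eqI) simp

lemma part_sum: "part P (sum f I) = (\<Sum>i\<in>I. part P (f i))"
  by (induction I rule: infinite_finite_induct) (simp_all add: part_add)

lemma part_id: "(\<And>m. m \<in> supp p \<Longrightarrow> P m) \<Longrightarrow> part P p = p"
  by (rule poly_mapping_eqI) (auto simp: in_keys_iff)

lemma part_none: "(\<And>m. m \<in> supp p \<Longrightarrow> \<not> P m) \<Longrightarrow> part P p = 0"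
  by (rule poly_mapping_eqI) (auto simp: in_keys_iff)

lemma supp_part: "supp (part P p) = {m \<in> supp p. P m}"
  by (auto simp: in_keys_iff split: if_splits)

lemma part_split:
  fixes p :: "'a \<Rightarrow>\<^sub>0 'b::ab_group_add"
  shows "p = part P p + part (\<lambda>m. \<not> P m) p"
  by (rule poly_mapping_eqI) (simp add: lookup_add)

text \<open>
  If multiplication by any term of \<open>q\<close> turns the selection \<open>P'\<close> into the selection \<open>P\<close>, then it
  splits the selected and the rejected terms of \<open>p\<close> apart, so selecting commutes with multiplying.
\<close>

lemma part_mult:
  fixes p q :: "'k::field pring"
  assumes "\<And>u m. u \<in> supp q \<Longrightarrow> P (u + m) \<longleftrightarrow> P' m"
  shows "part P (q * p) = q * part P' p"
proof -
  have 1: "part P (q * part P' p) = q * part P' p"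
    using assms keys_mult[of q "part P' p"] by (intro part_id) (auto simp: supp_part)
  have 2: "part P (q * part (\<lambda>m. \<not> P' m) p) = 0"
    using assms keys_mult[of q "part (\<lambda>m. \<not> P' m) p"] by (intro part_none) (auto simp: supp_part)
  have "part P (q * p) = part P (q * part P' p) + part P (q * part (\<lambda>m. \<not> P' m) p)"
    by (subst (1) part_split[of p P']) (simp add: part_add distrib_left)
  with 1 2 show ?thesis by simp
qed


section \<open>Divisibility by monomials\<close>

lemma monom_dvdI:
  fixes p :: "'k::field pring"
  assumes "\<And>m. m \<in> supp p \<Longrightarrow> \<exists>m'. m = u + m'"
  shows "\<exists>t. p = Poly_Mapping.single u 1 * t"
proof
  have "p = (\<Sum>m\<in>supp p. Poly_Mapping.single m (coef p m))"
    by (simp add: sum_terms)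
  also have "\<dots> = (\<Sum>m\<in>supp p. Poly_Mapping.single u 1 * Poly_Mapping.single (m - u) (coef p m))"
  proof (rule sum.cong)
    fix m assume "m \<in> supp p"
    then obtain m' where "m = u + m'" using assms by blast
    then show "Poly_Mapping.single m (coef p m) = Poly_Mapping.single u 1 * Poly_Mapping.single (m - u) (coef p m)"
      by (simp add: mult_single)
  qed simp
  finally show "p = Poly_Mapping.single u 1 * (\<Sum>m\<in>supp p. Poly_Mapping.single (m - u) (coef p m))"
    by (simp add: sum_distrib_left)
qed

lemma supp_monom_mult:
  fixes p :: "'k::field pring"
  assumes "m \<in> supp (Poly_Mapping.single u c * p)"
  shows "\<exists>m'\<in>supp p. m = u + m'"
  using assms keys_mult[of "Poly_Mapping.single u c" p] by (auto split: if_splits)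

text \<open>Monomials without a common variable form a regular sequence, whose only syzygy is Koszul's.\<close>

lemma coprime_monom_syzygy:
  fixes p q :: "'k::field pring"
  assumes cop: "\<And>i. coef u i = 0 \<or> coef v i = 0"
    and eq: "Poly_Mapping.single u 1 * p = Poly_Mapping.single v 1 * q"
  shows "\<exists>t. p = Poly_Mapping.single v 1 * t \<and> q = Poly_Mapping.single u 1 * t"
proof -
  have "\<exists>t. q = Poly_Mapping.single u 1 * t"
  proof (rule monom_dvdI)
    fix m assume m: "m \<in> supp q"
    have "coef (Poly_Mapping.single v 1 * q) (v + m) = coef q m"
      by (simp add: coef_monom_mult)
    with m have "v + m \<in> supp (Poly_Mapping.single u 1 * p)"
      by (simp add: eq in_keys_iff)
    then obtain m' where m': "v + m = u + m'" using supp_monom_mult by blast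
    have "m = u + (m - u)"
    proof (rule poly_mapping_eqI)
      fix i
      have "coef v i + coef m i = coef u i + coef m' i"
        using arg_cong[OF m', of "\<lambda>m. coef m i"] by (simp add: lookup_add)
      then show "coef m i = coef (u + (m - u)) i"
        using cop[of i] by (auto simp: lookup_add lookup_minus)
    qed
    then show "\<exists>m'. m = u + m'" by blast
  qed
  then obtain t where t: "q = Poly_Mapping.single u 1 * t" by blast
  with eq have "Poly_Mapping.single u 1 * p = Poly_Mapping.single u 1 * (Poly_Mapping.single v 1 * t)"
    by (simp add: mult.left_commute)
  moreover have "Poly_Mapping.single u (1::'k) \<noteq> 0"
    by (metis keys_single keys_zero insert_not_empty zero_neq_one)
  ultimately have "p = Poly_Mapping.single v 1 * t"
    by simp
  with t show ?thesis by blast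
qed

section \<open>Graded maps between free modules\<close>

lemma sdeg_add: "sdeg n (m + m') = sdeg n m + sdeg n m'"
  by (simp add: sdeg_def lookup_add distrib_right sum.distrib)

lemma sdeg_zero [simp]: "sdeg n 0 = 0"
  by (simp add: sdeg_def)

lemma sum_UNIV_4: "(\<Sum>i\<in>(UNIV :: 4 set). f i) = f 1 + f 2 + f 3 + f 4" for f :: "4 \<Rightarrow> 'a::comm_monoid_add"
proof -
  have "(1::4) \<notin> {2, 3, 4}" "(2::4) \<notin> {3, 4}" "(3::4) \<notin> {4}" by simp_all
  then show ?thesis unfolding UNIV_4 by (simp only: empty_iff sum.insert finite_insert finite.emptyI sum.insert add.assoc sum.empty add_0_right not_False_eq_True)
qed
lemma sdeg_expo: "sdeg n (expo i j k l) = i * n 1 + j * n 2 + k * n 3 + l * n 4"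
  by (simp only: sdeg_def sum_UNIV_4 coef_expo)

lemma sdeg_eq_zero:
  assumes "\<forall>i. 0 < n i" and "sdeg n m = 0"
  shows "m = 0"
proof (rule poly_mapping_eqI)
  fix i
  have "coef m i * n i \<le> sdeg n m"
    unfolding sdeg_def by (rule member_le_sum) auto
  then show "coef m i = coef 0 i"
    using assms(1)[rule_format, of i] assms(2) by simp
qed

lemma sdeg_in_gen_semigroup: "sdeg n m \<in> gen_semigroup n UNIV"
  by (auto simp: sdeg_def gen_semigroup_def)

lemma mat_vec_index:
  assumes "M \<in> carrier_mat m s" "v \<in> carrier_vec s" "i < m"
  shows "(M *\<^sub>v v) $ i = (\<Sum>j<s. M $$ (i, j) * v $ j)"
proof -
  have "(M *\<^sub>v v) $ i = (\<Sum>j\<in>{0..<s}. row M i $ j * v $ j)"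
    using assms by (simp add: scalar_prod_def)
  also have "\<dots> = (\<Sum>j<s. M $$ (i, j) * v $ j)"
    using assms by (simp add: atLeast0LessThan)
  finally show ?thesis .
qed

lemma mat_vec_unit_index:
  fixes M :: "'a::semiring_1 mat"
  assumes "M \<in> carrier_mat m s" "j < s" "i < m"
  shows "(M *\<^sub>v unit_vec s j) $ i = M $$ (i, j)"
  using assms by (simp add: scalar_prod_right_unit)

lemma mat_vec_smult:
  fixes M :: "'a::comm_semiring_0 mat"
  assumes M: "M \<in> carrier_mat m s" and v: "v \<in> carrier_vec s"
  shows "M *\<^sub>v (k \<cdot>\<^sub>v v) = k \<cdot>\<^sub>v (M *\<^sub>v v)"
proof (rule eq_vecI)
  fix i assume "i < dim_vec (k \<cdot>\<^sub>v (M *\<^sub>v v))"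
  with M have i: "i < m" by simp
  have "(M *\<^sub>v (k \<cdot>\<^sub>v v)) $ i = (\<Sum>j<s. M $$ (i, j) * (k \<cdot>\<^sub>v v) $ j)"
    using v i by (intro mat_vec_index[OF M]) auto
  also have "\<dots> = k * (\<Sum>j<s. M $$ (i, j) * v $ j)"
    using v by (simp add: sum_distrib_left mult.left_commute)
  finally show "(M *\<^sub>v (k \<cdot>\<^sub>v v)) $ i = (k \<cdot>\<^sub>v (M *\<^sub>v v)) $ i"
    using M i by (simp add: mat_vec_index[OF M v i] del: index_mult_mat_vec)
qed simp

lemma mat_vec_zero:
  fixes M :: "'a::semiring_0 mat"
  assumes M: "M \<in> carrier_mat m s"
  shows "M *\<^sub>v 0\<^sub>v s = 0\<^sub>v m"
proof (rule eq_vecI)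
  fix i assume "i < dim_vec (0\<^sub>v m :: 'a vec)"
  then show "(M *\<^sub>v 0\<^sub>v s) $ i = (0\<^sub>v m :: 'a vec) $ i"
    by (subst mat_vec_index[OF M]) auto
qed (use M in simp)

lemma mat_eq_unitI:
  fixes M N :: "'a::semiring_1 mat"
  assumes M: "M \<in> carrier_mat m s" and N: "N \<in> carrier_mat m s"
    and eq: "\<And>j. j < s \<Longrightarrow> M *\<^sub>v unit_vec s j = N *\<^sub>v unit_vec s j"
  shows "M = N"
proof (rule eq_matI)
  fix i j assume "i < dim_row N" "j < dim_col N"
  with N have ij: "i < m" "j < s" by auto
  show "M $$ (i, j) = N $$ (i, j)"
    using mat_vec_unit_index[OF M ij(2,1)] mat_vec_unit_index[OF N ij(2,1)] eq[OF ij(2)] by simp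
qed (use M N in auto)

text \<open>
  Degree-preserving matrices commute with this selection of terms, so a preimage of a homogeneous vector may be
  replaced by its part in the right degree. The number \<open>d j\<close> is the degree of the \<open>j\<close>-th basis element.
\<close>

definition vpart :: "(4 \<Rightarrow> nat) \<Rightarrow> (nat \<Rightarrow> bool) \<Rightarrow> (nat \<Rightarrow> nat) \<Rightarrow> 'k::field pring vec \<Rightarrow> 'k pring vec" where
  "vpart n Q d v = vec (dim_vec v) (\<lambda>j. part (\<lambda>m. Q (sdeg n m + d j)) (v $ j))"

lemma vpart_carrier [simp]: "vpart n Q d v \<in> carrier_vec s \<longleftrightarrow> v \<in> carrier_vec s"
  unfolding carrier_vec_def mem_Collect_eq vpart_def dim_vec ..

lemma vpart_index: "j < dim_vec v \<Longrightarrow> vpart n Q d v $ j = part (\<lambda>m. Q (sdeg n m + d j)) (v $ j)"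
  by (simp add: vpart_def)

lemma vpart_mult:
  assumes M: "M \<in> carrier_mat m s" and v: "v \<in> carrier_vec s"
    and dp: "degree_preserving n r c M"
  shows "vpart n Q r (M *\<^sub>v v) = M *\<^sub>v vpart n Q c v"
proof (rule eq_vecI)
  fix i assume "i < dim_vec (M *\<^sub>v vpart n Q c v)"
  with M have i: "i < m" by simp
  have "vpart n Q r (M *\<^sub>v v) $ i = part (\<lambda>u. Q (sdeg n u + r i)) (\<Sum>j<s. M $$ (i, j) * v $ j)"
    using M by (subst vpart_index) (simp_all add: mat_vec_index[OF M v i] i del: index_mult_mat_vec)
  also have "\<dots> = (\<Sum>j<s. M $$ (i, j) * part (\<lambda>u. Q (sdeg n u + c j)) (v $ j))"
    unfolding part_sum
  proof (intro sum.cong part_mult)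
    fix j u u' assume "j \<in> {..<s}" and u: "u \<in> supp (M $$ (i, j))"
    with dp M i have "sdeg n u + r i = c j"
      by (simp add: degree_preserving_def)
    then have "sdeg n (u + u') + r i = sdeg n u' + c j"
      by (simp add: sdeg_add)
    then show "Q (sdeg n (u + u') + r i) \<longleftrightarrow> Q (sdeg n u' + c j)"
      by simp
  qed simp
  also have "\<dots> = (M *\<^sub>v vpart n Q c v) $ i"
    by (subst mat_vec_index[OF M _ i]) (use v in \<open>auto simp: vpart_index intro!: sum.cong\<close>)
  finally show "vpart n Q r (M *\<^sub>v v) $ i = (M *\<^sub>v vpart n Q c v) $ i" .
qed (simp add: vpart_def)

lemma degree_preserving_mult:
  assumes M: "M \<in> carrier_mat m s" and N: "N \<in> carrier_mat s t"
    and "degree_preserving n r c M" and "degree_preserving n c d N"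
  shows "degree_preserving n r d (M * N)"
  unfolding degree_preserving_def
proof (intro allI impI ballI)
  fix i j u assume ij: "i < dim_row (M * N)" "j < dim_col (M * N)" and u: "u \<in> supp ((M * N) $$ (i, j))"
  have "(M * N) $$ (i, j) = (\<Sum>k<s. M $$ (i, k) * N $$ (k, j))"
    using ij M N by (simp add: scalar_prod_def atLeast0LessThan)
  with u obtain k where k: "k < s" "u \<in> supp (M $$ (i, k) * N $$ (k, j))"
    using keys_sum[of "\<lambda>k. M $$ (i, k) * N $$ (k, j)" "{..<s}"] by auto
  then obtain a b where "u = a + b" "a \<in> supp (M $$ (i, k))" "b \<in> supp (N $$ (k, j))"
    using keys_mult[of "M $$ (i, k)" "N $$ (k, j)"] by blast
  moreover have "sdeg n a + r i = c k" if "a \<in> supp (M $$ (i, k))" for a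
    using assms(3) M ij k that by (simp add: degree_preserving_def)
  moreover have "sdeg n b + c k = d j" if "b \<in> supp (N $$ (k, j))" for b
    using assms(4) N ij k that by (simp add: degree_preserving_def)
  ultimately have "u = a + b" "sdeg n a + r i = c k" "sdeg n b + c k = d j"
    by blast+
  then show "sdeg n u + r i = d j"
    by (simp add: sdeg_add)
qed


section \<open>Rigidity of minimal generators with incomparable degrees\<close>

lemma ex_in_supp: "p \<noteq> 0 \<Longrightarrow> \<exists>u. u \<in> supp p"
  using keys_eq_empty[of p] by blast

lemma only_constant_term:
  fixes p :: "'k::field pring"
  assumes "\<And>u. u \<in> supp p \<Longrightarrow> u = 0"
  shows "p = const (coef p 0)"
proof (rule poly_mapping_eqI)
  fix m show "coef p m = coef (const (coef p 0)) m"
    using assms[of m] by (auto simp: lookup_single when_def in_keys_iff)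
qed

text \<open>
  The map that sends the \<open>j\<close>-th basis element to \<open>c j\<close> times the \<open>\<sigma> j\<close>-th one. Maps of based complexes have this
  form.
\<close>

definition scaled_perm :: "nat \<Rightarrow> nat \<Rightarrow> (nat \<Rightarrow> nat) \<Rightarrow> (nat \<Rightarrow> 'k::field) \<Rightarrow> 'k pring mat" where
  "scaled_perm t s \<sigma> c = mat t s (\<lambda>(l, j). if l = \<sigma> j then const (c j) else 0)"

lemma scaled_perm_carrier [simp]: "scaled_perm t s \<sigma> c \<in> carrier_mat t s"
  by (simp add: scaled_perm_def)

lemma scaled_perm_unit:
  assumes "j < s" "\<sigma> j < t"
  shows "scaled_perm t s \<sigma> c *\<^sub>v unit_vec s j = const (c j) \<cdot>\<^sub>v unit_vec t (\<sigma> j)"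
proof (rule eq_vecI)
  fix i assume "i < dim_vec (const (c j) \<cdot>\<^sub>v unit_vec t (\<sigma> j))"
  then have i: "i < t" by simp
  then show "(scaled_perm t s \<sigma> c *\<^sub>v unit_vec s j) $ i = (const (c j) \<cdot>\<^sub>v unit_vec t (\<sigma> j)) $ i"
    using assms by (subst mat_vec_unit_index[of _ t]) (auto simp: scaled_perm_def)
qed (simp add: scaled_perm_def)

lemma degree_preserving_scaled_perm:
  assumes "\<And>j. j < s \<Longrightarrow> e (\<sigma> j) = d j"
  shows "degree_preserving n e d (scaled_perm t s \<sigma> c)"
  using assms by (auto simp: degree_preserving_def scaled_perm_def split: if_splits)

lemma mult_scaled_perm:
  fixes M N :: "'k::field pring mat"
  assumes M: "M \<in> carrier_mat m s" and N: "N \<in> carrier_mat m t"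
    and "\<And>j. j < s \<Longrightarrow> \<sigma> j < t"
    and "\<And>j. j < s \<Longrightarrow> M *\<^sub>v unit_vec s j = const (c j) \<cdot>\<^sub>v (N *\<^sub>v unit_vec t (\<sigma> j))"
  shows "N * scaled_perm t s \<sigma> c = M"
proof (rule mat_eq_unitI[of _ m s])
  fix j assume j: "j < s"
  have "N * scaled_perm t s \<sigma> c *\<^sub>v unit_vec s j = N *\<^sub>v (scaled_perm t s \<sigma> c *\<^sub>v unit_vec s j)"
    by (rule assoc_mult_mat_vec[OF N scaled_perm_carrier unit_vec_carrier])
  also have "\<dots> = const (c j) \<cdot>\<^sub>v (N *\<^sub>v unit_vec t (\<sigma> j))"
    using j assms(3) by (simp add: scaled_perm_unit mat_vec_smult[OF N])
  finally show "N * scaled_perm t s \<sigma> c *\<^sub>v unit_vec s j = M *\<^sub>v unit_vec s j"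
    using assms(4) j by simp
qed (use M N in \<open>auto intro!: mult_carrier_mat[where n = t]\<close>)

lemma scaled_perm_inverse:
  fixes c :: "nat \<Rightarrow> 'k::field"
  assumes "bij_betw \<sigma> {..<s} {..<t}" and "\<And>j. j < s \<Longrightarrow> c j \<noteq> 0"
  shows "\<exists>B \<in> carrier_mat s t. scaled_perm t s \<sigma> c * B = 1\<^sub>m t \<and> B * scaled_perm t s \<sigma> c = 1\<^sub>m s"
proof
  let ?\<tau> = "the_inv_into {..<s} \<sigma>"
  have \<sigma>: "\<sigma> j < t" "?\<tau> (\<sigma> j) = j" if "j < s" for j
    using assms(1) that by (auto simp: bij_betw_def the_inv_into_f_f)
  have \<tau>: "?\<tau> l < s" "\<sigma> (?\<tau> l) = l" if "l < t" for l
    using bij_betwE[OF bij_betw_the_inv_into[OF assms(1)]] f_the_inv_into_f_bij_betw[OF assms(1)] that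
    by auto
  let ?A = "scaled_perm t s \<sigma> c" and ?B = "scaled_perm s t ?\<tau> (\<lambda>l. inverse (c (?\<tau> l)))"
  have "?A * ?B = 1\<^sub>m t"
    by (rule mult_scaled_perm)
      (use assms(2) \<tau> in \<open>auto simp: scaled_perm_unit smult_smult_assoc const_inverse\<close>)
  moreover have "?B * ?A = 1\<^sub>m s"
    by (rule mult_scaled_perm)
      (use assms(2) \<sigma> in \<open>auto simp: scaled_perm_unit smult_smult_assoc const_inverse\<close>)
  ultimately show "?A * ?B = 1\<^sub>m t \<and> ?B * ?A = 1\<^sub>m s" by blast
qed simp

text \<open>
  The columns have no syzygy with an invertible coefficient. For homogeneous columns this says that they
  generate their span minimally.
\<close>

definition minimal_columns :: "nat \<Rightarrow> nat \<Rightarrow> 'k::field pring mat \<Rightarrow> bool" where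
  "minimal_columns m s M \<longleftrightarrow> M \<in> carrier_mat m s \<and>
     (\<forall>v\<in>carrier_vec s. M *\<^sub>v v = 0\<^sub>v m \<longrightarrow> (\<forall>j<s. v $ j \<in> irrelevant_ideal))"

lemma minimal_columns_eqD:
  assumes N: "minimal_columns m t N" and uv: "u \<in> carrier_vec t" "v \<in> carrier_vec t"
    and eq: "N *\<^sub>v u = N *\<^sub>v v" and l: "l < t"
  shows "u $ l - v $ l \<in> irrelevant_ideal"
proof -
  have "N *\<^sub>v (u - v) = N *\<^sub>v u - N *\<^sub>v v"
    using N uv by (intro mult_minus_distrib_mat_vec) (auto simp: minimal_columns_def)
  also have "\<dots> = 0\<^sub>v m"
    using N uv unfolding eq minimal_columns_def by (auto intro!: minus_cancel_vec mult_mat_vec_carrier)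
  finally have "(u - v) $ l \<in> irrelevant_ideal"
    using N uv l unfolding minimal_columns_def by (meson minus_carrier_vec)
  then show ?thesis using uv l by simp
qed

lemma minimal_columns_nonzero:
  fixes M :: "'a::field pring mat"
  assumes "minimal_columns m s M" "j < s"
  shows "M *\<^sub>v unit_vec s j \<noteq> 0\<^sub>v m"
proof
  assume "M *\<^sub>v unit_vec s j = 0\<^sub>v m"
  with assms have "(unit_vec s j :: 'a pring vec) $ j \<in> irrelevant_ideal"
    unfolding minimal_columns_def using unit_vec_carrier by blast
  with assms(2) show False by (simp add: irrelevant_ideal_def)
qed

text \<open>
  Expand a generator of the first system in the second, and expand back in the first a generator of the
  second system that occurs. Any generator of the first system that turns up has a degree below that of the one
  started from, so by incomparability it is the same generator, and the coefficients have degree zero. A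
  generator of the second system not reached in this way would be superfluous.
\<close>

lemma incomparable_generators_unique:
  fixes M N :: "'k::field pring mat"
  assumes pos: "\<forall>i. 0 < n i"
    and M: "minimal_columns m s M" "degree_preserving n r d M"
    and N: "minimal_columns m t N" "degree_preserving n r e N"
    and img: "(\<lambda>v. M *\<^sub>v v) ` carrier_vec s = (\<lambda>v. N *\<^sub>v v) ` carrier_vec t"
    and inc: "\<And>i j u. i < s \<Longrightarrow> j < s \<Longrightarrow> i \<noteq> j \<Longrightarrow> sdeg n u + d i \<noteq> d j"
  shows "\<exists>\<sigma> c. bij_betw \<sigma> {..<s} {..<t} \<and>
    (\<forall>j<s. c j \<noteq> 0 \<and> e (\<sigma> j) = d j \<and>
       M *\<^sub>v unit_vec s j = const (c j) \<cdot>\<^sub>v (N *\<^sub>v unit_vec t (\<sigma> j)))"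
proof -
  have Mc: "M \<in> carrier_mat m s" and Nc: "N \<in> carrier_mat m t"
    using M N by (auto simp: minimal_columns_def)
  \<comment> \<open>The columns are homogeneous.\<close>
  have hom: "vpart n (\<lambda>k. k = d' j) r (A *\<^sub>v unit_vec s' j) = A *\<^sub>v unit_vec s' j"
    if A: "A \<in> carrier_mat m s'" and dp: "degree_preserving n r d' A" and j: "j < s'" for A s' d' j
  proof (rule eq_vecI)
    fix i assume "i < dim_vec (A *\<^sub>v unit_vec s' j)"
    with A have i: "i < m" by simp
    show "vpart n (\<lambda>k. k = d' j) r (A *\<^sub>v unit_vec s' j) $ i = (A *\<^sub>v unit_vec s' j) $ i"
      using A i j dp
      by (subst vpart_index) (auto simp: mat_vec_unit_index degree_preserving_def simp del: index_mult_mat_vec intro!: part_id)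
  qed (simp add: vpart_def)
  \<comment> \<open>Expansions may be taken with homogeneous coefficients of the right degrees.\<close>
  have lift: "\<exists>p\<in>carrier_vec t'. B *\<^sub>v p = A *\<^sub>v unit_vec s' j \<and>
      (\<forall>l<t'. \<forall>u\<in>supp (p $ l). sdeg n u + e' l = d' j)"
    if A: "A \<in> carrier_mat m s'" "degree_preserving n r d' A" and j: "j < s'"
      and B: "B \<in> carrier_mat m t'" "degree_preserving n r e' B"
      and im: "(\<lambda>v. A *\<^sub>v v) ` carrier_vec s' = (\<lambda>v. B *\<^sub>v v) ` carrier_vec t'"
    for A B s' t' d' e' j
  proof -
    have "A *\<^sub>v unit_vec s' j \<in> (\<lambda>v. B *\<^sub>v v) ` carrier_vec t'"
      unfolding im[symmetric] by simp
    then obtain p where p: "p \<in> carrier_vec t'" "A *\<^sub>v unit_vec s' j = B *\<^sub>v p" by blast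
    let ?p = "vpart n (\<lambda>k. k = d' j) e' p"
    have "B *\<^sub>v ?p = A *\<^sub>v unit_vec s' j"
      using vpart_mult[OF B(1) p(1) B(2), of "\<lambda>k. k = d' j"] hom[OF A j] p(2) by simp
    moreover have "\<forall>l<t'. \<forall>u\<in>supp (?p $ l). sdeg n u + e' l = d' j"
      using p(1) by (simp add: vpart_index supp_part)
    ultimately show ?thesis using p(1) by (intro bexI[of _ ?p]) simp_all
  qed
  have key: "\<exists>l c. l < t \<and> c \<noteq> 0 \<and> e l = d j \<and>
      M *\<^sub>v unit_vec s j = const c \<cdot>\<^sub>v (N *\<^sub>v unit_vec t l)" if j: "j < s" for j
  proof -
    obtain p where p: "p \<in> carrier_vec t" "N *\<^sub>v p = M *\<^sub>v unit_vec s j"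
      and pd: "\<And>l u. l < t \<Longrightarrow> u \<in> supp (p $ l) \<Longrightarrow> sdeg n u + e l = d j"
      using lift[OF Mc M(2) j Nc N(2) img] by blast
    have "p \<noteq> 0\<^sub>v t"
      using minimal_columns_nonzero[OF M(1) j] p(2) mat_vec_zero[OF Nc] by auto
    then obtain l where l: "l < t" "p $ l \<noteq> 0"
      using p(1) by (metis carrier_vecD eq_vecI index_zero_vec)
    then obtain u where u: "u \<in> supp (p $ l)" using ex_in_supp by blast
    obtain q where q: "q \<in> carrier_vec s" "M *\<^sub>v q = N *\<^sub>v unit_vec t l"
      and qd: "\<And>i w. i < s \<Longrightarrow> w \<in> supp (q $ i) \<Longrightarrow> sdeg n w + d i = e l"
      using lift[OF Nc N(2) l(1) Mc M(2) img[symmetric]] by blast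
    \<comment> \<open>Composing the two expansions compares the degrees of two generators of the first system.\<close>
    have only: "i = j \<and> w = 0 \<and> sdeg n u = 0" if i: "i < s" and w: "w \<in> supp (q $ i)" for i w
    proof -
      have *: "sdeg n (u + w) + d i = d j"
        using pd[OF l(1) u] qd[OF i w] by (simp add: sdeg_add)
      with inc[OF i j] have ij: "i = j" by blast
      with * have "sdeg n u = 0" "sdeg n w = 0" by (simp_all add: sdeg_add)
      with ij sdeg_eq_zero[OF pos] show ?thesis by blast
    qed
    define c where "c = coef (q $ j) 0"
    have qj: "q $ j = const c"
      unfolding c_def using only[OF j] by (intro only_constant_term) blast
    have "q = const c \<cdot>\<^sub>v unit_vec s j"
    proof (rule eq_vecI)
      fix i assume "i < dim_vec (const c \<cdot>\<^sub>v unit_vec s j)"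
      then have i: "i < s" by simp
      show "q $ i = (const c \<cdot>\<^sub>v unit_vec s j) $ i"
      proof (cases "i = j")
        case False
        then have "supp (q $ i) = {}" using only[OF i] by blast
        then show ?thesis using False i j by simp
      qed (use i qj in simp)
    qed (use q in simp)
    then have Nl: "N *\<^sub>v unit_vec t l = const c \<cdot>\<^sub>v (M *\<^sub>v unit_vec s j)"
      using q(2) Mc by (simp add: mat_vec_smult[OF Mc])
    have "c \<noteq> 0"
    proof
      assume "c = 0"
      with Nl Mc have "N *\<^sub>v unit_vec t l = 0\<^sub>v m" by auto
      with minimal_columns_nonzero[OF N(1) l(1)] show False by blast
    qed
    then have "q $ j \<noteq> 0" unfolding c_def by auto
    then obtain w where "w \<in> supp (q $ j)" using ex_in_supp by blast
    with only[OF j, of w] qd[OF j, of w] have "e l = d j" by simp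
    moreover have "M *\<^sub>v unit_vec s j = const (inverse c) \<cdot>\<^sub>v (N *\<^sub>v unit_vec t l)"
      using \<open>c \<noteq> 0\<close> Nl by (simp add: smult_smult_assoc const_inverse)
    ultimately show ?thesis using \<open>c \<noteq> 0\<close> l(1) by (intro exI[of _ l] exI[of _ "inverse c"]) simp
  qed
  then obtain \<sigma> c where \<sigma>: "\<And>j. j < s \<Longrightarrow> \<sigma> j < t \<and> c j \<noteq> 0 \<and> e (\<sigma> j) = d j \<and>
      M *\<^sub>v unit_vec s j = const (c j) \<cdot>\<^sub>v (N *\<^sub>v unit_vec t (\<sigma> j))"
    by metis
  have inj: "inj_on \<sigma> {..<s}"
  proof (rule inj_onI)
    fix i j assume "i \<in> {..<s}" "j \<in> {..<s}" "\<sigma> i = \<sigma> j"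
    then show "i = j" using inc[of i j 0] \<sigma>[of i] \<sigma>[of j] by auto
  qed
  have "{..<t} \<subseteq> \<sigma> ` {..<s}"
  proof (rule ccontr)
    assume "\<not> {..<t} \<subseteq> \<sigma> ` {..<s}"
    then obtain l where l: "l < t" "\<And>j. j < s \<Longrightarrow> l \<noteq> \<sigma> j" by auto
    have "N *\<^sub>v unit_vec t l \<in> (\<lambda>v. M *\<^sub>v v) ` carrier_vec s"
      unfolding img by simp
    then obtain q where q: "q \<in> carrier_vec s" "N *\<^sub>v unit_vec t l = M *\<^sub>v q" by blast
    let ?P = "scaled_perm t s \<sigma> c"
    have "N * ?P = M" using \<sigma> Mc Nc by (intro mult_scaled_perm) auto
    then have "N *\<^sub>v (?P *\<^sub>v q) = N *\<^sub>v unit_vec t l"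
      using q Nc by (simp flip: assoc_mult_mat_vec[of N m t ?P s q])
    then have irr: "unit_vec t l $ l - (?P *\<^sub>v q) $ l \<in> irrelevant_ideal"
      by (intro minimal_columns_eqD[OF N(1)])
        (use q l(1) in \<open>auto intro!: mult_mat_vec_carrier[of _ _ s]\<close>)
    have "(?P *\<^sub>v q) $ l = (\<Sum>j<s. ?P $$ (l, j) * q $ j)"
      using q l(1) by (intro mat_vec_index[of _ t]) auto
    also have "\<dots> = 0"
      using l by (auto simp: scaled_perm_def intro!: sum.neutral)
    finally show False
      using irr l(1) by (simp add: irrelevant_ideal_def del: index_mult_mat_vec)
  qed
  with inj \<sigma> have "bij_betw \<sigma> {..<s} {..<t}" unfolding bij_betw_def by blast
  with \<sigma> show ?thesis by (intro exI[of _ \<sigma>] exI[of _ c]) simp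
qed

section \<open>Comparing minimal resolutions\<close>

lemma diff_mat_carrier:
  "graded_free_resolution n F \<Longrightarrow> diff_mat F k \<in> carrier_mat (rk F k) (rk F (Suc k))"
  by (simp add: graded_free_resolution_def)

lemma diff_mat_degree_preserving:
  "graded_free_resolution n F \<Longrightarrow> degree_preserving n (bdeg F k) (bdeg F (Suc k)) (diff_mat F k)"
  by (simp add: graded_free_resolution_def)

lemma diff_mat_exact:
  "graded_free_resolution n F \<Longrightarrow>
    (\<lambda>v. diff_mat F (Suc k) *\<^sub>v v) ` carrier_vec (rk F (Suc (Suc k))) =
      {w \<in> carrier_vec (rk F (Suc k)). diff_mat F k *\<^sub>v w = 0\<^sub>v (rk F k)}"
  by (simp add: graded_free_resolution_def)

lemma diff_mat_minimal_columns:
  assumes "minimal_graded_free_resolution n F"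
  shows "minimal_columns (rk F k) (rk F (Suc k)) (diff_mat F k)"
  unfolding minimal_columns_def
proof (intro conjI ballI impI allI)
  have F: "graded_free_resolution n F"
    and irr: "\<And>i j. i < rk F (Suc k) \<Longrightarrow> j < rk F (Suc (Suc k)) \<Longrightarrow> diff_mat F (Suc k) $$ (i, j) \<in> irrelevant_ideal"
    using assms by (auto simp: minimal_graded_free_resolution_def)
  show "diff_mat F k \<in> carrier_mat (rk F k) (rk F (Suc k))"
    using F by (rule diff_mat_carrier)
  fix v j assume v: "v \<in> carrier_vec (rk F (Suc k))" "diff_mat F k *\<^sub>v v = 0\<^sub>v (rk F k)" and j: "j < rk F (Suc k)"
  then have "v \<in> (\<lambda>v. diff_mat F (Suc k) *\<^sub>v v) ` carrier_vec (rk F (Suc (Suc k)))"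
    unfolding diff_mat_exact[OF F] by simp
  then obtain u where u: "u \<in> carrier_vec (rk F (Suc (Suc k)))" "v = diff_mat F (Suc k) *\<^sub>v u" by blast
  have "v $ j = (\<Sum>l<rk F (Suc (Suc k)). diff_mat F (Suc k) $$ (j, l) * u $ l)"
    unfolding u(2) by (rule mat_vec_index[OF diff_mat_carrier[OF F] u(1) j])
  then show "v $ j \<in> irrelevant_ideal"
    using irr j by (auto intro!: irrelevant_ideal_sum irrelevant_ideal_mult_right)
qed

lemma image_zero:
  assumes "graded_free_resolution n F" "graded_free_resolution n G"
  shows "(\<lambda>v. 1\<^sub>m 1 *\<^sub>v (diff_mat F 0 *\<^sub>v v)) ` carrier_vec (rk F 1)
    = (\<lambda>v. diff_mat G 0 *\<^sub>v v) ` carrier_vec (rk G 1)"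
proof -
  have "(\<lambda>v. 1\<^sub>m 1 *\<^sub>v (diff_mat F 0 *\<^sub>v v)) ` carrier_vec (rk F 1)
      = (\<lambda>v. diff_mat F 0 *\<^sub>v v) ` carrier_vec (rk F 1)"
  proof (rule image_cong)
    fix v :: "'a pring vec" assume "v \<in> carrier_vec (rk F 1)"
    moreover have "diff_mat F 0 \<in> carrier_mat 1 (rk F 1)"
      using diff_mat_carrier[OF assms(1), of 0] assms(1) by (simp add: graded_free_resolution_def)
    ultimately show "1\<^sub>m 1 *\<^sub>v (diff_mat F 0 *\<^sub>v v) = diff_mat F 0 *\<^sub>v v"
      by (intro one_mult_mat_vec mult_mat_vec_carrier)
  qed simp
  then show ?thesis using assms by (simp add: graded_free_resolution_def)
qed

text \<open>
  An injective chain map that is onto in one degree identifies the kernels there, hence, by exactness,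
  the images of the next differentials.
\<close>

lemma image_step:
  fixes F G :: "'k::field based_complex"
  assumes F: "graded_free_resolution n F" and G: "graded_free_resolution n G"
    and A: "A \<in> carrier_mat (rk G k) (rk F k)" and B: "B \<in> carrier_mat (rk G (Suc k)) (rk F (Suc k))"
    and comm: "diff_mat G k * B = A * diff_mat F k"
    and inj: "inj_on (\<lambda>v. A *\<^sub>v v) (carrier_vec (rk F k))"
    and surj: "\<And>w. w \<in> carrier_vec (rk G (Suc k)) \<Longrightarrow> \<exists>v\<in>carrier_vec (rk F (Suc k)). B *\<^sub>v v = w"
  shows "(\<lambda>v. B *\<^sub>v (diff_mat F (Suc k) *\<^sub>v v)) ` carrier_vec (rk F (Suc (Suc k)))
    = (\<lambda>v. diff_mat G (Suc k) *\<^sub>v v) ` carrier_vec (rk G (Suc (Suc k)))"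
proof -
  note Fc = diff_mat_carrier[OF F] and Gc = diff_mat_carrier[OF G]
  have ker: "diff_mat G k *\<^sub>v (B *\<^sub>v v) = 0\<^sub>v (rk G k) \<longleftrightarrow> diff_mat F k *\<^sub>v v = 0\<^sub>v (rk F k)"
    if v: "v \<in> carrier_vec (rk F (Suc k))" for v
  proof -
    have c: "diff_mat F k *\<^sub>v v \<in> carrier_vec (rk F k)"
      using Fc v by (rule mult_mat_vec_carrier)
    have "diff_mat G k *\<^sub>v (B *\<^sub>v v) = diff_mat G k * B *\<^sub>v v"
      using assoc_mult_mat_vec[OF Gc B v] by simp
    also have "\<dots> = A *\<^sub>v (diff_mat F k *\<^sub>v v)"
      unfolding comm by (rule assoc_mult_mat_vec[OF A Fc v])
    finally have *: "diff_mat G k *\<^sub>v (B *\<^sub>v v) = A *\<^sub>v (diff_mat F k *\<^sub>v v)" .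
    show ?thesis
    proof
      assume "diff_mat G k *\<^sub>v (B *\<^sub>v v) = 0\<^sub>v (rk G k)"
      with * have "A *\<^sub>v (diff_mat F k *\<^sub>v v) = A *\<^sub>v 0\<^sub>v (rk F k)"
        by (simp only: mat_vec_zero[OF A])
      then show "diff_mat F k *\<^sub>v v = 0\<^sub>v (rk F k)"
        by (rule inj_onD[OF inj]) (rule c zero_carrier_vec)+
    qed (simp only: * mat_vec_zero[OF A])
  qed
  have "(\<lambda>v. B *\<^sub>v (diff_mat F (Suc k) *\<^sub>v v)) ` carrier_vec (rk F (Suc (Suc k)))
      = (\<lambda>v. B *\<^sub>v v) ` ((\<lambda>v. diff_mat F (Suc k) *\<^sub>v v) ` carrier_vec (rk F (Suc (Suc k))))"
    by (simp add: image_image)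
  also have "\<dots> = {w \<in> carrier_vec (rk G (Suc k)). diff_mat G k *\<^sub>v w = 0\<^sub>v (rk G k)}"
    unfolding diff_mat_exact[OF F]
  proof (intro equalityI subsetI)
    fix w assume "w \<in> (\<lambda>v. B *\<^sub>v v) ` {v \<in> carrier_vec (rk F (Suc k)). diff_mat F k *\<^sub>v v = 0\<^sub>v (rk F k)}"
    then obtain v where v: "v \<in> carrier_vec (rk F (Suc k))" "diff_mat F k *\<^sub>v v = 0\<^sub>v (rk F k)" "w = B *\<^sub>v v"
      by blast
    with ker[OF v(1)] mult_mat_vec_carrier[OF B v(1)]
    show "w \<in> {w \<in> carrier_vec (rk G (Suc k)). diff_mat G k *\<^sub>v w = 0\<^sub>v (rk G k)}" by simp
  next
    fix w assume "w \<in> {w \<in> carrier_vec (rk G (Suc k)). diff_mat G k *\<^sub>v w = 0\<^sub>v (rk G k)}"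
    then have w: "w \<in> carrier_vec (rk G (Suc k))" "diff_mat G k *\<^sub>v w = 0\<^sub>v (rk G k)" by auto
    obtain v where v: "v \<in> carrier_vec (rk F (Suc k))" "B *\<^sub>v v = w"
      using surj[OF w(1)] by blast
    with w(2) ker[OF v(1)] show "w \<in> (\<lambda>v. B *\<^sub>v v) ` {v \<in> carrier_vec (rk F (Suc k)). diff_mat F k *\<^sub>v v = 0\<^sub>v (rk F k)}"
      by blast
  qed
  finally show ?thesis unfolding diff_mat_exact[OF G] .
qed

lemma left_invertible_inj:
  fixes A B :: "'a::comm_ring_1 mat"
  assumes A: "A \<in> carrier_mat t s" and B: "B \<in> carrier_mat s t" and "B * A = 1\<^sub>m s"
  shows "inj_on (\<lambda>v. A *\<^sub>v v) (carrier_vec s)"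
proof (rule inj_on_inverseI)
  fix v :: "'a vec" assume v: "v \<in> carrier_vec s"
  show "B *\<^sub>v (A *\<^sub>v v) = v"
    using assoc_mult_mat_vec[OF B A v] assms(3) one_mult_mat_vec[OF v] by simp
qed

lemma right_invertible_surj:
  fixes A B :: "'a::comm_ring_1 mat"
  assumes A: "A \<in> carrier_mat t s" and B: "B \<in> carrier_mat s t" and "A * B = 1\<^sub>m t"
    and w: "w \<in> carrier_vec t"
  shows "\<exists>v\<in>carrier_vec s. A *\<^sub>v v = w"
proof
  show "A *\<^sub>v (B *\<^sub>v w) = w"
    using assoc_mult_mat_vec[OF A B w] assms(3) one_mult_mat_vec[OF w] by simp
  show "B *\<^sub>v w \<in> carrier_vec s"
    using B w by (rule mult_mat_vec_carrier)
qed

text \<open>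
  If in each homological degree no two basis degrees are comparable, then the embedding into any other
  minimal resolution is built degree by degree: once the resolutions are identified up to degree \<open>k\<close>,
  the next two differentials give minimal generators of the same module, which agree up to order and
  scalars.
\<close>

theorem incomparable_degrees_strongly_indispensable:
  fixes F :: "'k::field based_complex"
  assumes pos: "\<forall>i. 0 < n i" and F: "minimal_graded_free_resolution n F"
    and inc: "\<And>k i j u. i < rk F (Suc k) \<Longrightarrow> j < rk F (Suc k) \<Longrightarrow> i \<noteq> j \<Longrightarrow>
      sdeg n u + bdeg F (Suc k) i \<noteq> bdeg F (Suc k) j"
  shows "strongly_indispensable n F"
  unfolding strongly_indispensable_def
proof (intro conjI allI impI)
  fix G :: "'k based_complex" assume G: "minimal_graded_free_resolution n G"
  have Fr: "graded_free_resolution n F" and Gr: "graded_free_resolution n G"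
    using F G by (auto simp: minimal_graded_free_resolution_def)
  note Fc = diff_mat_carrier[OF Fr] and Gc = diff_mat_carrier[OF Gr]
  define scaled_bij where "scaled_bij k A \<longleftrightarrow> (\<exists>\<sigma> c. bij_betw \<sigma> {..<rk F k} {..<rk G k} \<and>
      (\<forall>j<rk F k. c j \<noteq> 0 \<and> bdeg G k (\<sigma> j) = bdeg F k j) \<and>
      A = scaled_perm (rk G k) (rk F k) \<sigma> c)" for k and A :: "'k pring mat"
  define P where "P k A \<longleftrightarrow> scaled_bij k A \<and> (k = 0 \<longrightarrow> A = 1\<^sub>m 1) \<and>
      (\<lambda>v. A *\<^sub>v (diff_mat F k *\<^sub>v v)) ` carrier_vec (rk F (Suc k))
        = (\<lambda>v. diff_mat G k *\<^sub>v v) ` carrier_vec (rk G (Suc k))" for k and A :: "'k pring mat"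
  have carr: "A \<in> carrier_mat (rk G k) (rk F k)" if "scaled_bij k A" for k A
    using that by (auto simp: scaled_bij_def)
  have inv: "\<exists>B\<in>carrier_mat (rk F k) (rk G k). A * B = 1\<^sub>m (rk G k) \<and> B * A = 1\<^sub>m (rk F k)"
    if A: "scaled_bij k A" for k A
  proof -
    from A obtain \<sigma> c where "bij_betw \<sigma> {..<rk F k} {..<rk G k}" "\<And>j. j < rk F k \<Longrightarrow> c j \<noteq> 0"
      "A = scaled_perm (rk G k) (rk F k) \<sigma> c"
      unfolding scaled_bij_def by blast
    then show ?thesis using scaled_perm_inverse by blast
  qed
  have inj: "inj_on (\<lambda>v. A *\<^sub>v v) (carrier_vec (rk F k))" if A: "scaled_bij k A" for k A
    using left_invertible_inj[OF carr[OF A]] inv[OF A] by blast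
  have dp: "degree_preserving n (bdeg G k) (bdeg F k) A" if A: "scaled_bij k A" for k A
    using A degree_preserving_scaled_perm unfolding scaled_bij_def by blast
  have start: "P 0 (1\<^sub>m 1)"
  proof -
    have "scaled_bij 0 (1\<^sub>m 1)"
      unfolding scaled_bij_def
    proof (intro exI conjI)
      show "bij_betw (\<lambda>j. j) {..<rk F 0} {..<rk G 0}"
        using Fr Gr by (simp add: graded_free_resolution_def bij_betw_def)
      show "\<forall>j<rk F 0. (1::'k) \<noteq> 0 \<and> bdeg G 0 j = bdeg F 0 j"
        using Fr Gr by (simp add: graded_free_resolution_def)
      show "1\<^sub>m 1 = scaled_perm (rk G 0) (rk F 0) (\<lambda>j. j) (\<lambda>j. 1::'k)"
        using Fr Gr by (auto simp: scaled_perm_def graded_free_resolution_def intro!: eq_matI)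
    qed
    with image_zero[OF Fr Gr] show ?thesis by (simp add: P_def)
  qed
  have step: "\<exists>B. P (Suc k) B \<and> diff_mat G k * B = A * diff_mat F k" if PA: "P k A" for k A
  proof -
    from PA have A: "scaled_bij k A" by (simp add: P_def)
    note Ac = carr[OF A]
    have prod: "A * diff_mat F k *\<^sub>v v = A *\<^sub>v (diff_mat F k *\<^sub>v v)" if "v \<in> carrier_vec (rk F (Suc k))" for v
      using Ac Fc that by (rule assoc_mult_mat_vec)
    have min: "minimal_columns (rk G k) (rk F (Suc k)) (A * diff_mat F k)"
      unfolding minimal_columns_def
    proof (intro conjI ballI impI)
      show "A * diff_mat F k \<in> carrier_mat (rk G k) (rk F (Suc k))"
        using Ac Fc by (rule mult_carrier_mat)
      fix v assume v: "v \<in> carrier_vec (rk F (Suc k))" "A * diff_mat F k *\<^sub>v v = 0\<^sub>v (rk G k)"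
      have "diff_mat F k *\<^sub>v v = 0\<^sub>v (rk F k)"
      proof (rule inj_onD[OF inj[OF A]])
        show "A *\<^sub>v (diff_mat F k *\<^sub>v v) = A *\<^sub>v 0\<^sub>v (rk F k)"
          using prod[OF v(1)] v(2) mat_vec_zero[OF Ac] by simp
        show "diff_mat F k *\<^sub>v v \<in> carrier_vec (rk F k)"
          using Fc v(1) by (rule mult_mat_vec_carrier)
      qed simp
      with diff_mat_minimal_columns[OF F, of k] v(1)
      show "\<forall>j<rk F (Suc k). v $ j \<in> irrelevant_ideal" by (simp add: minimal_columns_def)
    qed
    have img: "(\<lambda>v. A * diff_mat F k *\<^sub>v v) ` carrier_vec (rk F (Suc k))
        = (\<lambda>v. diff_mat G k *\<^sub>v v) ` carrier_vec (rk G (Suc k))"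
      using PA prod by (simp add: P_def cong: image_cong)
    obtain \<sigma> c where \<sigma>: "bij_betw \<sigma> {..<rk F (Suc k)} {..<rk G (Suc k)}"
      and c: "\<And>j. j < rk F (Suc k) \<Longrightarrow> c j \<noteq> 0"
      and deg: "\<And>j. j < rk F (Suc k) \<Longrightarrow> bdeg G (Suc k) (\<sigma> j) = bdeg F (Suc k) j"
      and col: "\<And>j. j < rk F (Suc k) \<Longrightarrow> A * diff_mat F k *\<^sub>v unit_vec (rk F (Suc k)) j
        = const (c j) \<cdot>\<^sub>v (diff_mat G k *\<^sub>v unit_vec (rk G (Suc k)) (\<sigma> j))"
      using incomparable_generators_unique[OF pos min
          degree_preserving_mult[OF Ac Fc dp[OF A] diff_mat_degree_preserving[OF Fr]]
          diff_mat_minimal_columns[OF G] diff_mat_degree_preserving[OF Gr] img inc]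
      by blast
    let ?B = "scaled_perm (rk G (Suc k)) (rk F (Suc k)) \<sigma> c"
    have B: "scaled_bij (Suc k) ?B"
      unfolding scaled_bij_def using \<sigma> c deg by blast
    have comm: "diff_mat G k * ?B = A * diff_mat F k"
    proof (rule mult_scaled_perm[OF _ Gc])
      show "A * diff_mat F k \<in> carrier_mat (rk G k) (rk F (Suc k))"
        using Ac Fc by (rule mult_carrier_mat)
      show "\<sigma> j < rk G (Suc k)" if "j < rk F (Suc k)" for j
        using bij_betwE[OF \<sigma>] that by auto
    qed (rule col)
    have "\<exists>v\<in>carrier_vec (rk F (Suc k)). ?B *\<^sub>v v = w" if "w \<in> carrier_vec (rk G (Suc k))" for w
      using inv[OF B] right_invertible_surj[OF carr[OF B] _ _ that] by blast
    from image_step[OF Fr Gr Ac carr[OF B] comm inj[OF A] this] B comm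
    show ?thesis by (intro exI[of _ ?B]) (simp add: P_def)
  qed
  have "\<exists>\<iota>. (\<forall>k. P k (\<iota> k) \<and> diff_mat G k * \<iota> (Suc k) = \<iota> k * diff_mat F k)"
    using dependent_nat_choice[of P "\<lambda>k A B. diff_mat G k * B = A * diff_mat F k"] start step
    by blast
  then obtain \<iota> where \<iota>: "\<And>k. P k (\<iota> k)" "\<And>k. diff_mat G k * \<iota> (Suc k) = \<iota> k * diff_mat F k"
    by blast
  have mon: "scaled_bij k (\<iota> k)" for k using \<iota>(1)[of k] by (simp add: P_def)
  have "based_embedding n F G \<iota>"
    unfolding based_embedding_def
  proof (intro conjI allI impI)
    show "\<iota> 0 = 1\<^sub>m 1" using \<iota>(1)[of 0] by (simp add: P_def)
    fix k
    show "\<iota> k \<in> carrier_mat (rk G k) (rk F k)" by (rule carr[OF mon])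
    show "degree_preserving n (bdeg G k) (bdeg F k) (\<iota> k)" by (rule dp[OF mon])
    show "inj_on ((*\<^sub>v) (\<iota> k)) (carrier_vec (rk F k))" by (rule inj[OF mon])
    show "diff_mat G k * \<iota> (Suc k) = \<iota> k * diff_mat F k" by (rule \<iota>(2))
    fix j assume j: "j < rk F k"
    from mon[of k] obtain \<sigma> c where \<sigma>: "bij_betw \<sigma> {..<rk F k} {..<rk G k}"
      and c: "\<forall>j<rk F k. c j \<noteq> 0 \<and> bdeg G k (\<sigma> j) = bdeg F k j"
      and eq: "\<iota> k = scaled_perm (rk G k) (rk F k) \<sigma> c"
      unfolding scaled_bij_def by blast
    have "\<sigma> j < rk G k" using bij_betwE[OF \<sigma>] j by auto
    moreover from this have "\<iota> k *\<^sub>v unit_vec (rk F k) j = const (c j) \<cdot>\<^sub>v unit_vec (rk G k) (\<sigma> j)"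
      unfolding eq by (rule scaled_perm_unit[OF j])
    ultimately show "\<exists>l<rk G k. \<exists>c. c \<noteq> 0 \<and>
        \<iota> k *\<^sub>v unit_vec (rk F k) j = const c \<cdot>\<^sub>v unit_vec (rk G k) l"
      using c j by blast
  qed
  then show "\<exists>\<iota>. based_embedding n F G \<iota>" by blast
qed (rule F)

text \<open>
  A basis element outside the image of the embedding would be expressible by the others modulo the
  syzygies, and so yield a syzygy with a coefficient outside the irrelevant ideal.
\<close>

lemma based_embedding_onto:
  fixes F G :: "'k::field based_complex"
  assumes F: "minimal_graded_free_resolution n F" and G: "minimal_graded_free_resolution n G"
    and \<iota>: "based_embedding n F G \<iota>"
  shows "l < rk G k \<Longrightarrow> \<exists>j<rk F k. \<exists>c. c \<noteq> 0 \<and>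
    \<iota> k *\<^sub>v unit_vec (rk F k) j = const c \<cdot>\<^sub>v unit_vec (rk G k) l"
proof (induction k arbitrary: l)
  case 0
  have Fr: "rk F 0 = 1" "rk G 0 = 1" "\<iota> 0 = 1\<^sub>m 1"
    using F G \<iota> by (auto simp: minimal_graded_free_resolution_def graded_free_resolution_def based_embedding_def)
  then show ?case using 0 by (intro exI[of _ 0] conjI exI[of _ 1]) simp_all
next
  case (Suc k)
  have Fr: "graded_free_resolution n F" and Gr: "graded_free_resolution n G"
    using F G by (auto simp: minimal_graded_free_resolution_def)
  have \<iota>c: "\<iota> k \<in> carrier_mat (rk G k) (rk F k)"
    and comm: "diff_mat G k * \<iota> (Suc k) = \<iota> k * diff_mat F k"
    and unit: "\<And>j. j < rk F k \<Longrightarrow> \<exists>l<rk G k. \<exists>c. c \<noteq> 0 \<and>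
      \<iota> k *\<^sub>v unit_vec (rk F k) j = const c \<cdot>\<^sub>v unit_vec (rk G k) l"
    and inj: "inj_on (\<lambda>v. \<iota> k *\<^sub>v v) (carrier_vec (rk F k))"
    for k
    using \<iota> unfolding based_embedding_def by blast+
  have img: "(\<lambda>v. \<iota> k *\<^sub>v (diff_mat F k *\<^sub>v v)) ` carrier_vec (rk F (Suc k))
      = (\<lambda>v. diff_mat G k *\<^sub>v v) ` carrier_vec (rk G (Suc k))"
  proof (cases k)
    case 0
    with image_zero[OF Fr Gr] \<iota> show ?thesis by (simp add: based_embedding_def)
  next
    case (Suc k')
    from Suc.IH obtain g c where g: "\<And>l. l < rk G k \<Longrightarrow> g l < rk F k"
      and c: "\<And>l. l < rk G k \<Longrightarrow> c l \<noteq> 0"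
      and gc: "\<And>l. l < rk G k \<Longrightarrow> \<iota> k *\<^sub>v unit_vec (rk F k) (g l) = const (c l) \<cdot>\<^sub>v unit_vec (rk G k) l"
      by metis
    have "\<iota> k * scaled_perm (rk F k) (rk G k) g (\<lambda>l. inverse (c l)) = 1\<^sub>m (rk G k)"
    proof (rule mult_scaled_perm[OF _ \<iota>c])
      fix l assume l: "l < rk G k"
      show "1\<^sub>m (rk G k) *\<^sub>v unit_vec (rk G k) l
          = const (inverse (c l)) \<cdot>\<^sub>v (\<iota> k *\<^sub>v unit_vec (rk F k) (g l))"
        using c[OF l] by (simp add: gc[OF l] smult_smult_assoc const_inverse)
    qed (use g in auto)
    then have "\<exists>v\<in>carrier_vec (rk F k). \<iota> k *\<^sub>v v = w" if "w \<in> carrier_vec (rk G k)" for w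
      using right_invertible_surj[OF \<iota>c scaled_perm_carrier _ that] by blast
    then show ?thesis
      using image_step[OF Fr Gr \<iota>c[of k'] \<iota>c[of "Suc k'"] comm inj] Suc by simp
  qed
  have "diff_mat G k *\<^sub>v unit_vec (rk G (Suc k)) l
      \<in> (\<lambda>v. \<iota> k *\<^sub>v (diff_mat F k *\<^sub>v v)) ` carrier_vec (rk F (Suc k))"
    unfolding img by simp
  then obtain u where u: "u \<in> carrier_vec (rk F (Suc k))"
    and eq: "diff_mat G k *\<^sub>v unit_vec (rk G (Suc k)) l = \<iota> k *\<^sub>v (diff_mat F k *\<^sub>v u)"
    by blast
  have "\<iota> k *\<^sub>v (diff_mat F k *\<^sub>v u) = diff_mat G k *\<^sub>v (\<iota> (Suc k) *\<^sub>v u)"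
    using assoc_mult_mat_vec[OF \<iota>c diff_mat_carrier[OF Fr] u]
      assoc_mult_mat_vec[OF diff_mat_carrier[OF Gr] \<iota>c u] comm by simp
  with eq have "unit_vec (rk G (Suc k)) l $ l - (\<iota> (Suc k) *\<^sub>v u) $ l \<in> irrelevant_ideal"
    using mult_mat_vec_carrier[OF \<iota>c u] Suc.prems
    by (intro minimal_columns_eqD[OF diff_mat_minimal_columns[OF G]]) auto
  then have "(\<iota> (Suc k) *\<^sub>v u) $ l \<noteq> 0"
    using Suc.prems by (auto simp: irrelevant_ideal_def simp del: index_mult_mat_vec)
  then have "(\<Sum>j<rk F (Suc k). \<iota> (Suc k) $$ (l, j) * u $ j) \<noteq> 0"
    unfolding mat_vec_index[OF \<iota>c u Suc.prems] .
  then obtain j where j: "j < rk F (Suc k)" "\<iota> (Suc k) $$ (l, j) \<noteq> 0"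
    by (metis (no_types, lifting) lessThan_iff mult_zero_left sum.neutral)
  obtain l' c where l': "l' < rk G (Suc k)" "c \<noteq> 0"
    "\<iota> (Suc k) *\<^sub>v unit_vec (rk F (Suc k)) j = const c \<cdot>\<^sub>v unit_vec (rk G (Suc k)) l'"
    using unit[OF j(1)] by blast
  have "\<iota> (Suc k) $$ (l, j) = (const c \<cdot>\<^sub>v unit_vec (rk G (Suc k)) l') $ l"
    using mat_vec_unit_index[OF \<iota>c j(1) Suc.prems] l'(3) by simp
  with j(2) Suc.prems l'(1) have "l = l'" by (auto split: if_splits)
  with j(1) l' show ?case by blast
qed

section \<open>Changing one basis element\<close>

text \<open>The base change that adds \<open>p\<close> times the \<open>i\<close>-th to the \<open>j\<close>-th basis element.\<close>

definition elementary :: "nat \<Rightarrow> nat \<Rightarrow> nat \<Rightarrow> 'a::comm_ring_1 \<Rightarrow> 'a mat" where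
  "elementary s i j p = mat s s (\<lambda>(a, b). if a = b then 1 else if a = i \<and> b = j then p else 0)"

lemma elementary_carrier [simp]: "elementary s i j p \<in> carrier_mat s s"
  by (simp add: elementary_def)

lemma mult_elementary_index:
  fixes M :: "'a::comm_ring_1 mat"
  assumes M: "M \<in> carrier_mat m s" and "i < s" "i \<noteq> j" "a < m" "b < s"
  shows "(M * elementary s i j p) $$ (a, b) = M $$ (a, b) + (if b = j then M $$ (a, i) * p else 0)"
proof -
  have "(M * elementary s i j p) $$ (a, b) = (\<Sum>c<s. M $$ (a, c) * elementary s i j p $$ (c, b))"
    using assms by (simp add: scalar_prod_def atLeast0LessThan elementary_def)
  also have "\<dots> = (\<Sum>c<s. (if c = b then M $$ (a, b) else 0)
      + (if c = i then if b = j then M $$ (a, i) * p else 0 else 0))"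
    using assms by (intro sum.cong) (auto simp: elementary_def)
  also have "\<dots> = M $$ (a, b) + (if b = j then M $$ (a, i) * p else 0)"
    using assms by (simp add: sum.distrib)
  finally show ?thesis .
qed

lemma elementary_inverse:
  fixes p :: "'a::comm_ring_1"
  assumes "i < s" "i \<noteq> j"
  shows "elementary s i j p * elementary s i j (- p) = 1\<^sub>m s"
proof (rule eq_matI)
  fix a b assume "a < dim_row (1\<^sub>m s :: 'a mat)" "b < dim_col (1\<^sub>m s :: 'a mat)"
  then have "a < s" "b < s" by auto
  then show "(elementary s i j p * elementary s i j (- p)) $$ (a, b) = 1\<^sub>m s $$ (a, b)"
    using assms by (subst mult_elementary_index[OF elementary_carrier]) (auto simp: elementary_def)
qed (simp_all add: elementary_def)

lemma degree_preserving_elementary: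
  assumes "\<And>u. u \<in> supp p \<Longrightarrow> sdeg n u + d i = d j"
  shows "degree_preserving n d d (elementary s i j p)"
  using assms by (auto simp: degree_preserving_def elementary_def split: if_splits)

text \<open>
  Here \<open>E'\<close> is meant to be the inverse of \<open>E\<close>. Only the two differentials into and out of the module whose basis
  changes are affected.
\<close>

definition base_change :: "'k::field based_complex \<Rightarrow> nat \<Rightarrow> 'k pring mat \<Rightarrow> 'k pring mat \<Rightarrow> 'k based_complex" where
  "base_change F k E E' = F\<lparr>diff_mat :=
     (diff_mat F)(k := diff_mat F k * E, Suc k := E' * diff_mat F (Suc k))\<rparr>"

lemma base_change_simps [simp]:
  "rk (base_change F k E E') = rk F"
  "bdeg (base_change F k E E') = bdeg F"
  "diff_mat (base_change F k E E') k = diff_mat F k * E"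
  "diff_mat (base_change F k E E') (Suc k) = E' * diff_mat F (Suc k)"
  "l \<noteq> k \<Longrightarrow> l \<noteq> Suc k \<Longrightarrow> diff_mat (base_change F k E E') l = diff_mat F l"
  by (simp_all add: base_change_def)

lemma base_change_minimal:
  fixes F :: "'k::field based_complex"
  assumes F: "minimal_graded_free_resolution n F"
    and E: "E \<in> carrier_mat (rk F (Suc k)) (rk F (Suc k))"
    and E': "E' \<in> carrier_mat (rk F (Suc k)) (rk F (Suc k))"
    and inv: "E * E' = 1\<^sub>m (rk F (Suc k))" "E' * E = 1\<^sub>m (rk F (Suc k))"
    and dp: "degree_preserving n (bdeg F (Suc k)) (bdeg F (Suc k)) E"
      "degree_preserving n (bdeg F (Suc k)) (bdeg F (Suc k)) E'"
  shows "minimal_graded_free_resolution n (base_change F k E E')"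
proof -
  let ?G = "base_change F k E E'" and ?s = "rk F (Suc k)"
  have Fr: "graded_free_resolution n F"
    and irr: "\<And>l i j. i < rk F l \<Longrightarrow> j < rk F (Suc l) \<Longrightarrow> diff_mat F l $$ (i, j) \<in> irrelevant_ideal"
    using F by (auto simp: minimal_graded_free_resolution_def)
  note Fc = diff_mat_carrier[OF Fr]
  have EE': "E *\<^sub>v (E' *\<^sub>v v) = v" "E' *\<^sub>v (E *\<^sub>v v) = v" if v: "v \<in> carrier_vec ?s" for v
    using assoc_mult_mat_vec[OF E E' v] assoc_mult_mat_vec[OF E' E v] inv one_mult_mat_vec[OF v] by simp_all
  have Ev: "E *\<^sub>v v \<in> carrier_vec ?s" "E' *\<^sub>v v \<in> carrier_vec ?s" if "v \<in> carrier_vec ?s" for v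
    using mult_mat_vec_carrier[OF E that] mult_mat_vec_carrier[OF E' that] by simp_all
  have im: "(\<lambda>v. diff_mat ?G k *\<^sub>v v) ` carrier_vec ?s = (\<lambda>v. diff_mat F k *\<^sub>v v) ` carrier_vec ?s"
  proof (intro equalityI subsetI)
    fix w assume "w \<in> (\<lambda>v. diff_mat ?G k *\<^sub>v v) ` carrier_vec ?s"
    then obtain v where v: "v \<in> carrier_vec ?s" "w = diff_mat F k * E *\<^sub>v v" by auto
    then have "w = diff_mat F k *\<^sub>v (E *\<^sub>v v)" using assoc_mult_mat_vec[OF Fc E v(1)] by simp
    with Ev(1)[OF v(1)] show "w \<in> (\<lambda>v. diff_mat F k *\<^sub>v v) ` carrier_vec ?s" by blast
  next
    fix w assume "w \<in> (\<lambda>v. diff_mat F k *\<^sub>v v) ` carrier_vec ?s"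
    then obtain v where v: "v \<in> carrier_vec ?s" "w = diff_mat F k *\<^sub>v v" by auto
    then have "w = diff_mat ?G k *\<^sub>v (E' *\<^sub>v v)"
      using assoc_mult_mat_vec[OF Fc E Ev(2)[OF v(1)]] EE'(1) by simp
    with Ev(2)[OF v(1)] show "w \<in> (\<lambda>v. diff_mat ?G k *\<^sub>v v) ` carrier_vec ?s" by blast
  qed
  have ker: "diff_mat ?G (Suc k) *\<^sub>v v = 0\<^sub>v ?s \<longleftrightarrow> diff_mat F (Suc k) *\<^sub>v v = 0\<^sub>v ?s"
    if v: "v \<in> carrier_vec (rk F (Suc (Suc k)))" for v
  proof -
    have c: "diff_mat F (Suc k) *\<^sub>v v \<in> carrier_vec ?s" using Fc v by (rule mult_mat_vec_carrier)
    have eq: "diff_mat ?G (Suc k) *\<^sub>v v = E' *\<^sub>v (diff_mat F (Suc k) *\<^sub>v v)"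
      using assoc_mult_mat_vec[OF E' Fc v] by simp
    show ?thesis
      unfolding eq using EE'(1)[OF c] mat_vec_zero[OF E] mat_vec_zero[OF E'] by metis
  qed
  have mid: "(\<lambda>v. diff_mat ?G (Suc k) *\<^sub>v v) ` carrier_vec (rk F (Suc (Suc k)))
      = {w \<in> carrier_vec ?s. diff_mat ?G k *\<^sub>v w = 0\<^sub>v (rk F k)}"
  proof (intro equalityI subsetI)
    fix w assume "w \<in> (\<lambda>v. diff_mat ?G (Suc k) *\<^sub>v v) ` carrier_vec (rk F (Suc (Suc k)))"
    then obtain v where v: "v \<in> carrier_vec (rk F (Suc (Suc k)))" "w = E' * diff_mat F (Suc k) *\<^sub>v v" by auto
    have c: "diff_mat F (Suc k) *\<^sub>v v \<in> carrier_vec ?s" using Fc v(1) by (rule mult_mat_vec_carrier)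
    have w: "w = E' *\<^sub>v (diff_mat F (Suc k) *\<^sub>v v)"
      using v(2) assoc_mult_mat_vec[OF E' Fc v(1)] by simp
    have wc: "w \<in> carrier_vec ?s" using Ev(2)[OF c] w by simp
    have "diff_mat ?G k *\<^sub>v w = diff_mat F k *\<^sub>v (diff_mat F (Suc k) *\<^sub>v v)"
      using assoc_mult_mat_vec[OF Fc E wc] EE'(1)[OF c] w by simp
    also have "\<dots> = 0\<^sub>v (rk F k)" using diff_mat_exact[OF Fr, of k] v(1) by blast
    finally show "w \<in> {w \<in> carrier_vec ?s. diff_mat ?G k *\<^sub>v w = 0\<^sub>v (rk F k)}" using wc by blast
  next
    fix w assume "w \<in> {w \<in> carrier_vec ?s. diff_mat ?G k *\<^sub>v w = 0\<^sub>v (rk F k)}"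
    then have wc: "w \<in> carrier_vec ?s" and "diff_mat ?G k *\<^sub>v w = 0\<^sub>v (rk F k)" by auto
    then have "diff_mat F k *\<^sub>v (E *\<^sub>v w) = 0\<^sub>v (rk F k)"
      using assoc_mult_mat_vec[OF Fc E wc] by simp
    with Ev(1)[OF wc] diff_mat_exact[OF Fr, of k] obtain v
      where v: "v \<in> carrier_vec (rk F (Suc (Suc k)))" "E *\<^sub>v w = diff_mat F (Suc k) *\<^sub>v v" by blast
    have "w = diff_mat ?G (Suc k) *\<^sub>v v"
      using EE'(2)[OF wc] v(2) assoc_mult_mat_vec[OF E' Fc v(1)] by simp
    with v(1) show "w \<in> (\<lambda>v. diff_mat ?G (Suc k) *\<^sub>v v) ` carrier_vec (rk F (Suc (Suc k)))" by blast
  qed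
  have carr: "diff_mat ?G l \<in> carrier_mat (rk F l) (rk F (Suc l))" for l
  proof (cases "l = k \<or> l = Suc k")
    case True
    then show ?thesis
      using mult_carrier_mat[OF Fc E] mult_carrier_mat[OF E' Fc] by auto
  qed (use Fc in simp)
  have dps: "degree_preserving n (bdeg F l) (bdeg F (Suc l)) (diff_mat ?G l)" for l
  proof (cases "l = k \<or> l = Suc k")
    case True
    then show ?thesis
      using degree_preserving_mult[OF Fc E diff_mat_degree_preserving[OF Fr] dp(1)]
        degree_preserving_mult[OF E' Fc dp(2) diff_mat_degree_preserving[OF Fr]] by auto
  qed (use diff_mat_degree_preserving[OF Fr] in simp)
  have ex: "(\<lambda>v. diff_mat ?G (Suc l) *\<^sub>v v) ` carrier_vec (rk F (Suc (Suc l)))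
      = {w \<in> carrier_vec (rk F (Suc l)). diff_mat ?G l *\<^sub>v w = 0\<^sub>v (rk F l)}" for l
  proof -
    consider "l = k" | "Suc l = k" | "l = Suc k" | "l \<noteq> k" "Suc l \<noteq> k" "l \<noteq> Suc k" by blast
    then show ?thesis
    proof cases
      case 1 with mid show ?thesis by simp
    next
      case 2
      then have "diff_mat ?G l = diff_mat F l" by (subst base_change_simps(5)) auto
      with 2 im diff_mat_exact[OF Fr, of l] show ?thesis by simp
    next
      case 3
      then have "diff_mat ?G (Suc l) = diff_mat F (Suc l)" by (subst base_change_simps(5)) auto
      with diff_mat_exact[OF Fr, of l] have "(\<lambda>v. diff_mat ?G (Suc l) *\<^sub>v v) ` carrier_vec (rk F (Suc (Suc l)))
          = {w \<in> carrier_vec (rk F (Suc l)). diff_mat F l *\<^sub>v w = 0\<^sub>v (rk F l)}" by simp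
      with 3 ker show ?thesis by blast
    next
      case 4
      with diff_mat_exact[OF Fr, of l] show ?thesis by simp
    qed
  qed
  have ex0: "(\<lambda>v. diff_mat ?G 0 *\<^sub>v v) ` carrier_vec (rk F 1) = {w \<in> carrier_vec (rk F 0). w $ 0 \<in> toric_ideal n}"
  proof (cases "k = 0")
    case True
    with im Fr show ?thesis by (simp add: graded_free_resolution_def)
  next
    case False
    with Fr show ?thesis by (simp add: graded_free_resolution_def)
  qed
  have "graded_free_resolution n ?G"
    unfolding graded_free_resolution_def base_change_simps(1,2)
  proof (intro conjI)
    show "rk F 0 = 1" "bdeg F 0 0 = 0" "\<forall>k. \<forall>j<rk F k. bdeg F k j \<in> gen_semigroup n UNIV"
      using Fr by (simp_all add: graded_free_resolution_def)
  qed (intro allI conjI carr dps ex ex0)+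
  moreover have "diff_mat ?G l $$ (i, j) \<in> irrelevant_ideal" if ij: "i < rk F l" "j < rk F (Suc l)" for l i j
  proof -
    consider "l = k" | "l = Suc k" | "l \<noteq> k" "l \<noteq> Suc k" by blast
    then show ?thesis
    proof cases
      case 1
      have "(diff_mat F k * E) $$ (i, j) = (\<Sum>c<?s. diff_mat F k $$ (i, c) * E $$ (c, j))"
        using ij 1 Fc[of k] E by (simp add: scalar_prod_def atLeast0LessThan)
      then show ?thesis
        using 1 ij irr by (auto intro!: irrelevant_ideal_sum irrelevant_ideal_mult_right)
    next
      case 2
      have "(E' * diff_mat F (Suc k)) $$ (i, j) = (\<Sum>c<?s. E' $$ (i, c) * diff_mat F (Suc k) $$ (c, j))"
        using ij 2 Fc[of "Suc k"] E' by (simp add: scalar_prod_def atLeast0LessThan)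
      then show ?thesis
        using 2 ij irr by (auto intro!: irrelevant_ideal_sum irrelevant_ideal_mult_left)
    next
      case 3
      with ij irr show ?thesis by simp
    qed
  qed
  ultimately show ?thesis
    unfolding minimal_graded_free_resolution_def base_change_simps(1) by blast
qed


section \<open>Exactness modulo a variable\<close>

lemma vpart_add:
  assumes "u \<in> carrier_vec s" "v \<in> carrier_vec s"
  shows "vpart n Q d (u + v) = vpart n Q d u + vpart n Q d v"
  using assms by (intro eq_vecI) (auto simp: vpart_def part_add)

lemma vpart_smult_x:
  assumes "v \<in> carrier_vec s"
  shows "vpart n Q d (monomial 1 0 0 0 \<cdot>\<^sub>v v) = monomial 1 0 0 0 \<cdot>\<^sub>v vpart n (\<lambda>t. Q (t + n 1)) d v"
proof (rule eq_vecI)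
  fix j assume "j < dim_vec (monomial 1 0 0 0 \<cdot>\<^sub>v vpart n (\<lambda>t. Q (t + n 1)) d v)"
  then have j: "j < dim_vec v" by (simp add: vpart_def)
  have "part (\<lambda>m. Q (sdeg n m + d j)) (monomial 1 0 0 0 * v $ j)
      = monomial 1 0 0 0 * part (\<lambda>m. Q (sdeg n m + d j + n 1)) (v $ j)"
    by (rule part_mult) (simp add: sdeg_add sdeg_expo ac_simps)
  then show "vpart n Q d (monomial 1 0 0 0 \<cdot>\<^sub>v v) $ j
      = (monomial 1 0 0 0 \<cdot>\<^sub>v vpart n (\<lambda>t. Q (t + n 1)) d v) $ j"
    using j by (simp add: vpart_def)
qed (simp add: vpart_def)

text \<open>
  A graded version of Nakayama's lemma: if every cycle is a boundary up to a multiple of the first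
  variable, then that multiple is again a cycle, of smaller degree, because the variable is not a zero
  divisor. Truncation of degrees makes the descent terminate.
\<close>

lemma exact_by_descent:
  fixes M N :: "'k::field pring mat"
  assumes pos: "0 < n 1"
    and M: "M \<in> carrier_mat m s" and N: "N \<in> carrier_mat s t"
    and dp: "degree_preserving n d e N"
    and comp: "\<And>u. u \<in> carrier_vec t \<Longrightarrow> M *\<^sub>v (N *\<^sub>v u) = 0\<^sub>v m"
    and mod: "\<And>v. v \<in> carrier_vec s \<Longrightarrow> M *\<^sub>v v = 0\<^sub>v m \<Longrightarrow>
      \<exists>u\<in>carrier_vec t. \<exists>w\<in>carrier_vec s. v = N *\<^sub>v u + monomial 1 0 0 0 \<cdot>\<^sub>v w"
    and v: "v \<in> carrier_vec s" "M *\<^sub>v v = 0\<^sub>v m"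
  shows "\<exists>u\<in>carrier_vec t. v = N *\<^sub>v u"
proof -
  let ?x = "monomial 1 0 0 0 :: 'k pring"
  have bounded: "\<exists>u\<in>carrier_vec t. v = N *\<^sub>v u"
    if "v \<in> carrier_vec s" "M *\<^sub>v v = 0\<^sub>v m" "vpart n (\<lambda>k. k \<le> B) d v = v" for B v
    using that
  proof (induction B arbitrary: v rule: less_induct)
    case (less B)
    obtain u w where u: "u \<in> carrier_vec t" and w: "w \<in> carrier_vec s" and eq: "v = N *\<^sub>v u + ?x \<cdot>\<^sub>v w"
      using mod[OF less.prems(1,2)] by blast
    define u' where "u' = vpart n (\<lambda>k. k \<le> B) e u"
    define w' where "w' = vpart n (\<lambda>k. k + n 1 \<le> B) d w"
    have u': "u' \<in> carrier_vec t" and w': "w' \<in> carrier_vec s"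
      using u w by (auto simp: u'_def w'_def)
    have Nu: "N *\<^sub>v u \<in> carrier_vec s" "N *\<^sub>v u' \<in> carrier_vec s"
      using mult_mat_vec_carrier[OF N u] mult_mat_vec_carrier[OF N u'] by auto
    have eq': "v = N *\<^sub>v u' + ?x \<cdot>\<^sub>v w'"
    proof -
      have "v = vpart n (\<lambda>k. k \<le> B) d (N *\<^sub>v u + ?x \<cdot>\<^sub>v w)"
        using less.prems(3) eq by simp
      also have "\<dots> = vpart n (\<lambda>k. k \<le> B) d (N *\<^sub>v u) + vpart n (\<lambda>k. k \<le> B) d (?x \<cdot>\<^sub>v w)"
        using Nu(1) w by (intro vpart_add[of _ s]) auto
      finally show ?thesis
        using vpart_mult[OF N u dp] vpart_smult_x[OF w] by (simp add: u'_def w'_def)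
    qed
    show ?case
    proof (cases "n 1 \<le> B")
      case True
      have "M *\<^sub>v v = M *\<^sub>v (N *\<^sub>v u') + ?x \<cdot>\<^sub>v (M *\<^sub>v w')"
        unfolding eq' using mult_add_distrib_mat_vec[OF M Nu(2), of "?x \<cdot>\<^sub>v w'"] mat_vec_smult[OF M w'] w' by simp
      then have "?x \<cdot>\<^sub>v (M *\<^sub>v w') = 0\<^sub>v m"
        using less.prems(2) comp[OF u'] mult_mat_vec_carrier[OF M w'] by auto
      then have "?x * (M *\<^sub>v w') $ i = 0" if "i < m" for i
        using that M by (metis carrier_matD(1) dim_mult_mat_vec index_smult_vec(1) index_zero_vec(1))
      then have "M *\<^sub>v w' = 0\<^sub>v m"
        using M by (intro eq_vecI) (auto simp del: index_mult_mat_vec)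
      moreover have "vpart n (\<lambda>k. k \<le> B - n 1) d w' = w'"
        using True unfolding w'_def vpart_def
        by (intro eq_vecI) (auto simp: supp_part intro!: part_id)
      moreover have "B - n 1 < B" using pos True by simp
      ultimately obtain u'' where u'': "u'' \<in> carrier_vec t" "w' = N *\<^sub>v u''"
        using less.IH w' by blast
      have "v = N *\<^sub>v (u' + ?x \<cdot>\<^sub>v u'')"
        unfolding eq' u''(2) using mult_add_distrib_mat_vec[OF N u', of "?x \<cdot>\<^sub>v u''"] mat_vec_smult[OF N u''(1)] u''(1)
        by simp
      moreover have "u' + ?x \<cdot>\<^sub>v u'' \<in> carrier_vec t" using u' u''(1) by simp
      ultimately show ?thesis by blast
    next
      case False
      then have "w' = 0\<^sub>v s"
        using w unfolding w'_def vpart_def by (intro eq_vecI) (auto intro!: part_none)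
      then have "?x \<cdot>\<^sub>v w' = 0\<^sub>v s" by (intro eq_vecI) auto
      with eq' Nu(2) have "v = N *\<^sub>v u'" by (simp only: right_zero_vec)
      with u' show ?thesis by blast
    qed
  qed
  define B where "B = (\<Sum>j<s. \<Sum>u\<in>supp (v $ j). sdeg n u + d j)"
  have "sdeg n u + d j \<le> B" if "j < s" "u \<in> supp (v $ j)" for u j
  proof -
    have "sdeg n u + d j \<le> (\<Sum>u\<in>supp (v $ j). sdeg n u + d j)"
      using that(2) by (intro member_le_sum) auto
    also have "\<dots> \<le> B"
      unfolding B_def using that(1)
      by (intro member_le_sum[of j "{..<s}" "\<lambda>j. \<Sum>u\<in>supp (v $ j). sdeg n u + d j"]) auto
    finally show ?thesis .
  qed
  then have "vpart n (\<lambda>k. k \<le> B) d v = v"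
    using v(1) unfolding vpart_def by (intro eq_vecI) (auto intro!: part_id)
  with bounded v show ?thesis by blast
qed

section \<open>The substitution homomorphism\<close>

text \<open>
  In this form the coefficient at \<open>t\<^sup>d\<close> of the image is visibly the sum of the coefficients of the monomials
  of degree \<open>d\<close>.
\<close>

lemma toric_map_eq_sum:
  "toric_map n p = (\<Sum>m\<in>supp p. Polynomial.monom (coef p m) (sdeg n m))"
proof -
  have "(\<Prod>i\<in>I. Polynomial.monom (1::'a::field) (n i) ^ coef m i) = Polynomial.monom 1 (\<Sum>i\<in>I. coef m i * n i)"
    for m :: mon and I
    by (induction I rule: infinite_finite_induct)
      (simp_all add: monom_power mult_monom mult.commute)
  then show ?thesis
    by (simp add: toric_map_def sdeg_def smult_monom)
qed

lemma toric_map_eq_sum_superset: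
  assumes "finite A" "supp p \<subseteq> A"
  shows "toric_map n p = (\<Sum>m\<in>A. Polynomial.monom (coef p m) (sdeg n m))"
  unfolding toric_map_eq_sum using assms
  by (intro sum.mono_neutral_left) (auto simp: in_keys_iff)

lemma toric_map_add: "toric_map n (p + q) = toric_map n p + toric_map n q"
proof -
  let ?A = "supp p \<union> supp q"
  have "toric_map n (p + q) = (\<Sum>m\<in>?A. Polynomial.monom (coef (p + q) m) (sdeg n m))"
    using keys_add[of p q] by (intro toric_map_eq_sum_superset) auto
  also have "\<dots> = (\<Sum>m\<in>?A. Polynomial.monom (coef p m) (sdeg n m))
      + (\<Sum>m\<in>?A. Polynomial.monom (coef q m) (sdeg n m))"
    by (simp add: lookup_add add_monom[symmetric] sum.distrib)
  also have "\<dots> = toric_map n p + toric_map n q"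
    by (subst (1 2) toric_map_eq_sum_superset[of ?A]) auto
  finally show ?thesis .
qed

lemma toric_map_zero [simp]: "toric_map n 0 = 0"
  by (simp add: toric_map_def)

lemma toric_map_sum: "toric_map n (sum f I) = (\<Sum>i\<in>I. toric_map n (f i))"
  by (induction I rule: infinite_finite_induct) (simp_all add: toric_map_add)

lemma toric_map_single [simp]: "toric_map n (Poly_Mapping.single m c) = Polynomial.monom c (sdeg n m)"
  by (cases "c = 0") (simp_all add: toric_map_eq_sum)

lemma toric_map_mult: "toric_map n (p * q) = toric_map n p * toric_map n q"
proof -
  have "toric_map n (p * q) = toric_map n ((\<Sum>a\<in>supp p. Poly_Mapping.single a (coef p a))
      * (\<Sum>b\<in>supp q. Poly_Mapping.single b (coef q b)))"
    by (simp add: sum_terms)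
  also have "\<dots> = (\<Sum>a\<in>supp p. \<Sum>b\<in>supp q.
      Polynomial.monom (coef p a) (sdeg n a) * Polynomial.monom (coef q b) (sdeg n b))"
    by (simp add: sum_product toric_map_sum mult_single mult_monom sdeg_add)
  also have "\<dots> = toric_map n p * toric_map n q"
    by (simp add: toric_map_eq_sum sum_product)
  finally show ?thesis .
qed

lemma toric_map_monomial:
  "toric_map n (monomial i j k l) = Polynomial.monom 1 (i * n 1 + j * n 2 + k * n 3 + l * n 4)"
  by (simp only: monomial_def toric_map_single sdeg_expo)

lemma toric_ideal_diff:
  assumes "i * n 1 + j * n 2 + k * n 3 + l * n 4 = i' * n 1 + j' * n 2 + k' * n 3 + l' * n 4"
  shows "monomial i j k l - monomial i' j' k' l' \<in> toric_ideal n"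
proof -
  have "toric_map n (monomial i' j' k' l') = toric_map n (monomial i' j' k' l' + (monomial i j k l - monomial i' j' k' l'))"
    by (simp add: toric_map_monomial assms)
  then show ?thesis unfolding toric_map_add by (simp add: toric_ideal_def)
qed


section \<open>Komeda's relations and normal forms\<close>

text \<open>
  The parameters are \<open>P = \<alpha>\<^sub>2 - 1\<close>, \<open>Q = \<alpha>\<^sub>3 - 1\<close>, \<open>R = \<alpha>\<^sub>4 - 1\<close>, \<open>b = \<alpha>\<^sub>2\<^sub>1\<close> and
  \<open>c = \<alpha>\<^sub>1 - \<alpha>\<^sub>2\<^sub>1 - 1\<close>; lowering the exponents by one avoids subtraction. The four relations
  say that the binomials below lie in the toric ideal; with the value of \<open>n1\<close> they carry everything
  that the argument takes from Komeda's formulas. The variables are called \<open>x, y, z, w\<close> in comments.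
\<close>

locale komeda =
  fixes n :: "4 \<Rightarrow> nat" and n1 n2 n3 n4 b c P Q R :: nat
  assumes n_eq: "n 1 = n1" "n 2 = n2" "n 3 = n3" "n 4 = n4"
    and n_pos: "0 < n1" "0 < n2" "0 < n3" "0 < n4"
    and Gcd_eq: "Gcd (range n) = 1"
    and params_pos: "0 < b" "0 < c" "0 < P" "0 < Q" "0 < R"
    and rel1: "(b + c + 1) * n1 = n3 + R * n4"
    and rel2: "(P + 1) * n2 = b * n1 + n4"
    and rel3: "(Q + 1) * n3 = c * n1 + n2"
    and rel4: "(R + 1) * n4 = n1 + P * n2 + Q * n3"
    and n1_eq: "n1 = (P + 1) * (Q + 1) * R + 1"
begin

lemma pos: "\<forall>i. 0 < n i"
proof
  fix i :: 4
  have "i \<in> {1, 2, 3, 4}" using UNIV_4 by blast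
  then show "0 < n i" using n_eq n_pos by auto
qed

lemma sdeg_expo_eq: "sdeg n (expo i j k l) = i * n1 + j * n2 + k * n3 + l * n4"
  unfolding sdeg_expo n_eq ..

lemma sdeg_eq: "sdeg n m = coef m 1 * n1 + coef m 2 * n2 + coef m 3 * n3 + coef m 4 * n4"
  using sdeg_expo_eq[of "coef m 1" "coef m 2" "coef m 3" "coef m 4"] unfolding expo_coef .

lemma rel5: "(b + 1) * n1 + Q * n3 = n2 + R * n4"
proof -
  have "(b + 1) * n1 + Q * n3 + n3 = n2 + R * n4 + n3"
    using rel1 rel3 by (simp add: algebra_simps)
  then show ?thesis by simp
qed

definition f1 :: "'k::field pring" where "f1 = monomial (b + c + 1) 0 0 0 - monomial 0 0 1 R"
definition f2 :: "'k::field pring" where "f2 = monomial 0 (P + 1) 0 0 - monomial b 0 0 1"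
definition f3 :: "'k::field pring" where "f3 = monomial 0 0 (Q + 1) 0 - monomial c 1 0 0"
definition f4 :: "'k::field pring" where "f4 = monomial 0 0 0 (R + 1) - monomial 1 P Q 0"
definition f5 :: "'k::field pring" where "f5 = monomial (b + 1) 0 Q 0 - monomial 0 1 0 R"

lemmas f_defs = f1_def f2_def f3_def f4_def f5_def

lemma f_toric: "f1 \<in> toric_ideal n" "f2 \<in> toric_ideal n" "f3 \<in> toric_ideal n"
  "f4 \<in> toric_ideal n" "f5 \<in> toric_ideal n"
  unfolding f_defs
  by (rule toric_ideal_diff, unfold n_eq, use rel1 rel2 rel3 rel4 rel5 in simp)+

definition komeda_ideal :: "'k::field pring set" where
  "komeda_ideal = {p. \<exists>u1 u2 u3 u4 u5. p = f1 * u1 + f2 * u2 + f3 * u3 + f4 * u4 + f5 * u5}"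

lemma komeda_idealI: "f1 * u1 + f2 * u2 + f3 * u3 + f4 * u4 + f5 * u5 \<in> komeda_ideal"
  unfolding komeda_ideal_def by blast

lemma f_in_komeda_ideal:
  "f1 \<in> komeda_ideal" "f2 \<in> komeda_ideal" "f3 \<in> komeda_ideal" "f4 \<in> komeda_ideal" "f5 \<in> komeda_ideal"
  using komeda_idealI[of 1 0 0 0 0] komeda_idealI[of 0 1 0 0 0] komeda_idealI[of 0 0 1 0 0]
    komeda_idealI[of 0 0 0 1 0] komeda_idealI[of 0 0 0 0 1] by simp_all

lemma komeda_ideal_add:
  assumes "p \<in> komeda_ideal" "q \<in> komeda_ideal"
  shows "p + q \<in> komeda_ideal"
proof -
  obtain u1 u2 u3 u4 u5 v1 v2 v3 v4 v5 where
    "p = f1 * u1 + f2 * u2 + f3 * u3 + f4 * u4 + f5 * u5"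
    "q = f1 * v1 + f2 * v2 + f3 * v3 + f4 * v4 + f5 * v5"
    using assms unfolding komeda_ideal_def by blast
  then have "p + q = f1 * (u1 + v1) + f2 * (u2 + v2) + f3 * (u3 + v3) + f4 * (u4 + v4) + f5 * (u5 + v5)"
    by (simp add: algebra_simps)
  then show ?thesis by (simp only: komeda_idealI)
qed

lemma komeda_ideal_mult:
  assumes "p \<in> komeda_ideal"
  shows "q * p \<in> komeda_ideal"
proof -
  obtain u1 u2 u3 u4 u5 where
    "p = f1 * u1 + f2 * u2 + f3 * u3 + f4 * u4 + f5 * u5"
    using assms unfolding komeda_ideal_def by blast
  then have "q * p = f1 * (q * u1) + f2 * (q * u2) + f3 * (q * u3) + f4 * (q * u4) + f5 * (q * u5)"
    by (simp add: algebra_simps)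
  then show ?thesis by (simp only: komeda_idealI)
qed

lemma komeda_ideal_uminus: "p \<in> komeda_ideal \<Longrightarrow> - p \<in> komeda_ideal"
  using komeda_ideal_mult[of p "- 1"] by simp

lemma komeda_ideal_zero: "0 \<in> komeda_ideal"
  using komeda_idealI[of 0 0 0 0 0] by simp

lemma komeda_ideal_sum: "(\<And>i. i \<in> I \<Longrightarrow> g i \<in> komeda_ideal) \<Longrightarrow> sum g I \<in> komeda_ideal"
  by (induction I rule: infinite_finite_induct) (auto simp: komeda_ideal_zero komeda_ideal_add)

lemma komeda_ideal_toric: "komeda_ideal \<subseteq> toric_ideal n"
  unfolding komeda_ideal_def
  by (auto simp: toric_ideal_def toric_map_add toric_map_mult
      f_toric[unfolded toric_ideal_def mem_Collect_eq])

text \<open>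
  Modulo \<open>x\<close> the five binomials become the monomials \<open>z w\<^sup>R\<close>, \<open>y\<^sup>P\<^sup>+\<^sup>1\<close>, \<open>z\<^sup>Q\<^sup>+\<^sup>1\<close>, \<open>w\<^sup>R\<^sup>+\<^sup>1\<close> and
  \<open>y w\<^sup>R\<close>. The exponents of the monomials in \<open>y, z, w\<close> outside the ideal they generate:
\<close>

definition standard :: "nat \<Rightarrow> nat \<Rightarrow> nat \<Rightarrow> bool" where
  "standard i j l \<longleftrightarrow> i \<le> P \<and> j \<le> Q \<and> (l < R \<or> (l = R \<and> i = 0 \<and> j = 0))"

lemma coprime_n1_n3: "coprime (int n1) (int n3)"
proof -
  have "coprime n1 n3"
  proof (rule coprimeI)
    fix d assume d: "d dvd n1" "d dvd n3"
    have "d dvd c * n1 + n2" using d(2) unfolding rel3[symmetric] by simp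
    then have d2: "d dvd n2" using d(1) by (simp add: dvd_add_right_iff)
    have "d dvd b * n1 + n4" using d2 unfolding rel2[symmetric] by simp
    then have d4: "d dvd n4" using d(1) by (simp add: dvd_add_right_iff)
    have "d dvd n i" for i
    proof -
      have "i \<in> {1, 2, 3, 4}" using UNIV_4 by blast
      then show ?thesis using d d2 d4 n_eq by auto
    qed
    then have "d dvd Gcd (range n)" by (intro Gcd_greatest) auto
    then show "is_unit d" using Gcd_eq by simp
  qed
  then show ?thesis by simp
qed

text \<open>
  Modulo \<open>n1\<close> the relations give \<open>n2 \<equiv> (Q + 1) n3\<close> and \<open>n4 \<equiv> (P + 1) n2\<close>, so the degree of a standard
  monomial is \<open>n3\<close> times the number with mixed radix digits \<open>j, i, l\<close>. These numbers are below
  \<open>n1 = (P + 1) (Q + 1) R + 1\<close> and \<open>n3\<close> is a unit modulo \<open>n1\<close>.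
\<close>

lemma standard_unique:
  fixes k k' :: int
  assumes s: "standard i j l" and s': "standard i' j' l'"
    and eq: "k * int n1 + int i * int n2 + int j * int n3 + int l * int n4
      = k' * int n1 + int i' * int n2 + int j' * int n3 + int l' * int n4"
  shows "k = k' \<and> i = i' \<and> j = j' \<and> l = l'"
proof -
  define N where "N i j l = j + (Q + 1) * (i + (P + 1) * l)" for i j l :: nat
  have N_less: "N i j l < n1" if "standard i j l" for i j l
  proof (cases "l < R")
    case True
    then obtain R' where R': "R = Suc R'" "l \<le> R'" by (cases R) auto
    have ij: "i \<le> P" "j \<le> Q" using that by (auto simp: standard_def)
    have "i + (P + 1) * l \<le> P + (P + 1) * R'"
      using ij(1) R'(2) by (intro add_mono mult_left_mono) auto
    then have "N i j l \<le> Q + (Q + 1) * (P + (P + 1) * R')"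
      unfolding N_def by (rule add_mono[OF ij(2) mult_left_mono]) simp
    also have "\<dots> < n1" by (simp add: n1_eq R'(1) algebra_simps)
    finally show ?thesis .
  next
    case False
    with that show ?thesis by (simp add: standard_def N_def n1_eq algebra_simps)
  qed
  have deg: "int i * int n2 + int j * int n3 + int l * int n4
      = int n3 * int (N i j l) - int n1 * (int c * int i + int l * ((int P + 1) * int c + int b))" for i j l
  proof -
    have 2: "int n2 = (int Q + 1) * int n3 - int c * int n1"
      using arg_cong[OF rel3, of int] by (simp add: algebra_simps)
    have 4: "int n4 = (int P + 1) * int n2 - int b * int n1"
      using arg_cong[OF rel2, of int] by (simp add: algebra_simps)
    show ?thesis unfolding 4 2 N_def by (simp add: algebra_simps)
  qed
  have "int n3 * (int (N i j l) - int (N i' j' l')) = int n1 * (k' - k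
      + (int c * int i + int l * ((int P + 1) * int c + int b))
      - (int c * int i' + int l' * ((int P + 1) * int c + int b)))"
    using eq deg[of i j l] deg[of i' j' l'] unfolding right_diff_distrib distrib_left
    by (simp add: mult.commute[of "int n1"])
  then have "int n1 dvd int n3 * (int (N i j l) - int (N i' j' l'))" by simp
  then have "int n1 dvd int (N i j l) - int (N i' j' l')"
    using coprime_n1_n3 by (simp only: coprime_dvd_mult_right_iff)
  then have "int (N i j l) mod int n1 = int (N i' j' l') mod int n1"
    by (simp only: mod_eq_dvd_iff)
  then have "N i j l = N i' j' l'"
    using N_less[OF s] N_less[OF s'] by simp
  then have N: "j + (Q + 1) * (i + (P + 1) * l) = j' + (Q + 1) * (i' + (P + 1) * l')"
    by (simp add: N_def)
  have digit: "a = a' \<and> A = A'" if "a + (D + 1) * A = a' + (D + 1) * A'" "a \<le> D" "a' \<le> D" for a a' A A' D :: nat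
  proof -
    have "a = (a + (D + 1) * A) mod (D + 1)" "a' = (a' + (D + 1) * A') mod (D + 1)"
      unfolding mod_mult_self2 using that(2,3) by simp_all
    with that(1) have "a = a'" by simp
    with that(1) have "(D + 1) * A = (D + 1) * A'" by linarith
    then have "A = A'" by (simp only: mult_cancel1) simp
    with \<open>a = a'\<close> show ?thesis by blast
  qed
  have j: "j = j'" and N': "i + (P + 1) * l = i' + (P + 1) * l'"
    using digit[OF N] s s' by (auto simp: standard_def)
  have i: "i = i'" and l: "l = l'"
    using digit[OF N'] s s' by (auto simp: standard_def)
  have "(k - k') * int n1 = 0" using eq i j l by (simp add: algebra_simps)
  with i j l n_pos show ?thesis by simp
qed

lemma reduce_step:
  assumes "monomial t i j l - (monomial t' i' j' l' :: 'k::field pring) \<in> komeda_ideal"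
  shows "monomial (s + t) (s2 + i) (s3 + j) (s4 + l)
    - (monomial (s + t') (s2 + i') (s3 + j') (s4 + l') :: 'k pring) \<in> komeda_ideal"
  using komeda_ideal_mult[OF assms, of "monomial s s2 s3 s4"] by (simp add: right_diff_distrib monomial_mult)

text \<open>
  Each binomial rewrites its monomial without \<open>x\<close> into a monomial divisible by \<open>x\<close> of the same degree.
  This lowers the degree of the part in \<open>y, z, w\<close>, so the rewriting ends in a standard monomial times
  a power of \<open>x\<close>.
\<close>

lemma normal_form:
  "\<exists>t' i' j' l'. standard i' j' l' \<and> monomial t i j l - (monomial t' i' j' l' :: 'k::field pring) \<in> komeda_ideal \<and>
     t * n1 + i * n2 + j * n3 + l * n4 = t' * n1 + i' * n2 + j' * n3 + l' * n4"
proof (induction "i * n2 + j * n3 + l * n4" arbitrary: t i j l rule: less_induct)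
  case less
  have goon: ?case
    if mem: "monomial 0 i1 j1 l1 - (monomial t0 i0 j0 l0 :: 'k pring) \<in> komeda_ideal" and t0: "0 < t0"
      and le: "i1 \<le> i" "j1 \<le> j" "l1 \<le> l"
      and deg: "i1 * n2 + j1 * n3 + l1 * n4 = t0 * n1 + i0 * n2 + j0 * n3 + l0 * n4"
    for i1 j1 l1 t0 i0 j0 l0
  proof -
    obtain i2 j2 l2 where e: "i = i2 + i1" "j = j2 + j1" "l = l2 + l1"
      using le by (metis le_iff_add add.commute)
    let ?i = "i2 + i0" and ?j = "j2 + j0" and ?l = "l2 + l0"
    have d: "i * n2 + j * n3 + l * n4 = t0 * n1 + (?i * n2 + ?j * n3 + ?l * n4)"
      using deg unfolding e by (simp add: algebra_simps)
    moreover have "0 < t0 * n1" using t0 n_pos by simp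
    ultimately have "?i * n2 + ?j * n3 + ?l * n4 < i * n2 + j * n3 + l * n4" by linarith
    from less[OF this, of "t + t0"] obtain t' i' j' l' where s: "standard i' j' l'"
      and m: "monomial (t + t0) ?i ?j ?l - (monomial t' i' j' l' :: 'k pring) \<in> komeda_ideal"
      and dd: "(t + t0) * n1 + ?i * n2 + ?j * n3 + ?l * n4 = t' * n1 + i' * n2 + j' * n3 + l' * n4"
      by blast
    have "monomial t i j l - (monomial (t + t0) ?i ?j ?l :: 'k pring) \<in> komeda_ideal"
      using reduce_step[OF mem, of t i2 j2 l2] by (simp add: e)
    from komeda_ideal_add[OF this m]
    have "monomial t i j l - (monomial t' i' j' l' :: 'k pring) \<in> komeda_ideal" by simp
    moreover have "t * n1 + i * n2 + j * n3 + l * n4 = t' * n1 + i' * n2 + j' * n3 + l' * n4"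
      using d dd by (simp add: algebra_simps)
    ultimately show ?thesis using s by blast
  qed
  have neg: "p - q \<in> komeda_ideal" if "q - p \<in> komeda_ideal" for p q :: "'k pring"
    using komeda_ideal_uminus[OF that] by simp
  consider "standard i j l" | "P + 1 \<le> i" | "Q + 1 \<le> j" | "R + 1 \<le> l" | "1 \<le> i" "R \<le> l" | "1 \<le> j" "R \<le> l"
    unfolding standard_def by linarith
  then show ?case
  proof cases
    case 1
    then show ?thesis using komeda_ideal_zero by (intro exI[of _ t] exI[of _ i] exI[of _ j] exI[of _ l]) simp
  next
    case 2
    show ?thesis
      by (rule goon[OF f_in_komeda_ideal(2)[unfolded f2_def]]) (use 2 params_pos rel2 in auto)
  next
    case 3
    show ?thesis
      by (rule goon[OF f_in_komeda_ideal(3)[unfolded f3_def]]) (use 3 params_pos rel3 in auto)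
  next
    case 4
    show ?thesis
      by (rule goon[OF f_in_komeda_ideal(4)[unfolded f4_def]]) (use 4 params_pos rel4 in auto)
  next
    case 5
    show ?thesis
      by (rule goon[OF neg[OF f_in_komeda_ideal(5)[unfolded f5_def]]]) (use 5 params_pos rel5 in auto)
  next
    case 6
    show ?thesis
      by (rule goon[OF neg[OF f_in_komeda_ideal(1)[unfolded f1_def]]]) (use 6 params_pos rel1 in auto)
  qed
qed

text \<open>
  An element of the semigroup is the degree of a monomial, whose normal form involves a nonnegative power of \<open>x\<close>;
  by uniqueness no representation with a negative one exists.
\<close>

lemma not_in_semigroup:
  fixes k :: int
  assumes "standard i j l" "k < 0"
  shows "int (sdeg n u) \<noteq> k * int n1 + int i * int n2 + int j * int n3 + int l * int n4"
proof
  assume eq: "int (sdeg n u) = k * int n1 + int i * int n2 + int j * int n3 + int l * int n4"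
  obtain t' i' j' l' where s': "standard i' j' l'"
    and "sdeg n u = t' * n1 + i' * n2 + j' * n3 + l' * n4"
    using normal_form[of "coef u 1" "coef u 2" "coef u 3" "coef u 4"] unfolding sdeg_eq by metis
  then have "int (sdeg n u) = int t' * int n1 + int i' * int n2 + int j' * int n3 + int l' * int n4"
    by simp
  with eq have "k = int t'" using standard_unique[OF assms(1) s', of k "int t'"] by simp
  with assms(2) show False by simp
qed

text \<open>
  Modulo the binomials each monomial may be replaced by its normal form, which depends on the degree only.
  For an element of the toric ideal the coefficients in each degree add up to zero, so nothing is left.
\<close>

lemma toric_ideal_subset: "toric_ideal n \<subseteq> komeda_ideal"
proof
  fix v :: "'a pring" assume v: "v \<in> toric_ideal n"
  have "\<forall>m. \<exists>m'. standard (coef m' 2) (coef m' 3) (coef m' 4) \<and> sdeg n m = sdeg n m' \<and>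
      Poly_Mapping.single m (1::'a) - Poly_Mapping.single m' 1 \<in> komeda_ideal"
  proof
    fix m :: mon
    obtain t i j l where s: "standard i j l"
      and mem: "monomial (coef m 1) (coef m 2) (coef m 3) (coef m 4) - (monomial t i j l :: 'a pring) \<in> komeda_ideal"
      and d: "sdeg n m = t * n1 + i * n2 + j * n3 + l * n4"
      using normal_form[of "coef m 1" "coef m 2" "coef m 3" "coef m 4"] unfolding sdeg_eq by metis
    show "\<exists>m'. standard (coef m' 2) (coef m' 3) (coef m' 4) \<and> sdeg n m = sdeg n m' \<and>
      Poly_Mapping.single m (1::'a) - Poly_Mapping.single m' 1 \<in> komeda_ideal"
      using s mem d by (intro exI[of _ "expo t i j l"]) (simp only: coef_expo sdeg_expo_eq monomial_def expo_coef simp_thms)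
  qed
  then obtain h where h: "\<And>m. standard (coef (h m) 2) (coef (h m) 3) (coef (h m) 4)" "\<And>m. sdeg n m = sdeg n (h m)"
    "\<And>m. Poly_Mapping.single m (1::'a) - Poly_Mapping.single (h m) 1 \<in> komeda_ideal"
    by metis
  have h_eq: "h m = h m' \<longleftrightarrow> sdeg n m = sdeg n m'" for m m'
  proof
    assume "sdeg n m = sdeg n m'"
    then have "int (sdeg n (h m)) = int (sdeg n (h m'))" using h(2) by simp
    then have "int (coef (h m) 1) = int (coef (h m') 1) \<and> coef (h m) 2 = coef (h m') 2 \<and>
        coef (h m) 3 = coef (h m') 3 \<and> coef (h m) 4 = coef (h m') 4"
      unfolding sdeg_eq by (intro standard_unique[OF h(1) h(1)]) simp
    then show "h m = h m'" by (intro mon_eqI) auto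
  qed (metis h(2))
  have "(\<Sum>m\<in>supp v. Poly_Mapping.single (h m) (coef v m)) = 0"
  proof (rule poly_mapping_eqI)
    fix u
    have "coef (\<Sum>m\<in>supp v. Poly_Mapping.single (h m) (coef v m)) u
        = (\<Sum>m\<in>supp v. if h m = u then coef v m else 0)"
      by (simp add: lookup_sum lookup_single when_def)
    also have "\<dots> = 0"
    proof (cases "\<exists>m0\<in>supp v. h m0 = u")
      case True
      then obtain m0 where "h m0 = u" by blast
      then have "(\<Sum>m\<in>supp v. if h m = u then coef v m else 0)
          = (\<Sum>m\<in>supp v. if sdeg n m = sdeg n m0 then coef v m else 0)"
        using h_eq by (intro sum.cong) auto
      also have "\<dots> = poly.coeff (toric_map n v) (sdeg n m0)"
        by (simp add: toric_map_eq_sum coeff_sum)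
      also have "\<dots> = 0" using v by (simp add: toric_ideal_def)
      finally show ?thesis .
    qed (auto intro!: sum.neutral)
    finally show "coef (\<Sum>m\<in>supp v. Poly_Mapping.single (h m) (coef v m)) u = coef 0 u" by simp
  qed
  then have "v = (\<Sum>m\<in>supp v. Poly_Mapping.single m (coef v m)) - (\<Sum>m\<in>supp v. Poly_Mapping.single (h m) (coef v m))"
    by (simp add: sum_terms)
  also have "\<dots> = (\<Sum>m\<in>supp v. const (coef v m) * (Poly_Mapping.single m 1 - Poly_Mapping.single (h m) 1))"
    by (simp add: right_diff_distrib mult_single sum_subtractf)
  also have "\<dots> \<in> komeda_ideal"
    by (intro komeda_ideal_sum komeda_ideal_mult h(3))
  finally show "v \<in> komeda_ideal" .
qed

lemma toric_ideal_eq: "toric_ideal n = komeda_ideal"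
  using komeda_ideal_toric toric_ideal_subset by (rule equalityI[rotated])

end

section \<open>Setting the first variable to zero\<close>

definition xfree :: "'k::field pring \<Rightarrow> 'k pring" where
  "xfree = part (\<lambda>m. coef m 1 = 0)"

lemma xfree_add [simp]: "xfree (p + q) = xfree p + xfree q"
  and xfree_minus [simp]: "xfree (p - q) = xfree p - xfree q"
  and xfree_uminus [simp]: "xfree (- p) = - xfree p"
  and xfree_zero [simp]: "xfree 0 = 0"
  by (simp_all add: xfree_def part_add part_minus part_uminus)

lemma xfree_monomial [simp]: "xfree (monomial i j k l) = (if i = 0 then monomial i j k l else 0)"
  unfolding xfree_def by (auto intro!: part_id part_none)

lemma xfree_mult [simp]: "xfree (p * q) = xfree p * xfree q"
proof -
  have 1: "xfree (part (\<lambda>m. coef m 1 = 0) p * q) = xfree p * xfree q"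
    unfolding xfree_def by (intro part_mult) (auto simp: supp_part lookup_add)
  have "xfree (part (\<lambda>m. coef m 1 \<noteq> 0) p * q) = part (\<lambda>m. coef m 1 \<noteq> 0) p * part (\<lambda>m. False) q"
    unfolding xfree_def by (intro part_mult) (auto simp: supp_part lookup_add)
  also have "part (\<lambda>m. False) q = 0" by (rule part_none) simp
  finally have 2: "xfree (part (\<lambda>m. coef m 1 \<noteq> 0) p * q) = 0" by simp
  have "xfree (p * q) = xfree (part (\<lambda>m. coef m 1 = 0) p * q) + xfree (part (\<lambda>m. coef m 1 \<noteq> 0) p * q)"
    by (subst (1) part_split[of p "\<lambda>m. coef m 1 = 0"]) (simp add: distrib_right)
  with 1 2 show ?thesis by simp
qed

lemma xfree_idem [simp]: "xfree (xfree p) = xfree p"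
  unfolding xfree_def by (rule part_id) (simp add: supp_part)

lemma xfree_eqD: "xfree p = q \<Longrightarrow> xfree p = xfree q"
  by (erule subst) simp

lemma xfree_eq_zero:
  assumes "xfree p = 0"
  shows "\<exists>t. p = monomial 1 0 0 0 * t"
  unfolding monomial_def
proof (rule monom_dvdI)
  fix m assume m: "m \<in> supp p"
  have "coef (xfree p) m = 0" using assms by simp
  with m have "coef m 1 \<noteq> 0" by (auto simp: xfree_def in_keys_iff split: if_splits)
  then have "m = expo 1 0 0 0 + expo (coef m 1 - 1) (coef m 2) (coef m 3) (coef m 4)"
    by (intro mon_eqI) (simp_all add: lookup_add)
  then show "\<exists>m'. m = expo 1 0 0 0 + m'" by blast
qed

lemma multiple_of_x:
  assumes "v \<in> carrier_vec s" "u \<in> carrier_vec s" "\<And>i. i < s \<Longrightarrow> xfree (v $ i) = xfree (u $ i)"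
  shows "\<exists>w\<in>carrier_vec s. v = u + monomial 1 0 0 0 \<cdot>\<^sub>v w"
proof -
  have "\<exists>t. v $ i - u $ i = monomial 1 0 0 0 * t" if "i < s" for i
    by (rule xfree_eq_zero) (simp add: assms(3)[OF that])
  then obtain g where g: "\<And>i. i < s \<Longrightarrow> v $ i - u $ i = monomial 1 0 0 0 * g i" by metis
  have "v $ i = u $ i + monomial 1 0 0 0 * g i" if "i < s" for i
    using g[OF that] by (simp add: diff_eq_eq add.commute)
  then have "v = u + monomial 1 0 0 0 \<cdot>\<^sub>v vec s g"
    using assms(1,2) by (intro eq_vecI) auto
  then show ?thesis by (metis vec_carrier)
qed

lemma monomial_coprime_syzygy:
  fixes p q :: "'k::field pring"
  assumes "monomial i j k l * p = monomial i' j' k' l' * q"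
    and "i = 0 \<or> i' = 0" "j = 0 \<or> j' = 0" "k = 0 \<or> k' = 0" "l = 0 \<or> l' = 0"
  shows "\<exists>t. p = monomial i' j' k' l' * t \<and> q = monomial i j k l * t"
  unfolding monomial_def
proof (rule coprime_monom_syzygy)
  fix a :: 4
  have "a \<in> {1, 2, 3, 4}" using UNIV_4 by blast
  then show "coef (expo i j k l) a = 0 \<or> coef (expo i' j' k' l') a = 0"
    using assms(2-5) by auto
  show "Poly_Mapping.single (expo i j k l) 1 * p = Poly_Mapping.single (expo i' j' k' l') 1 * q"
    using assms(1) by (simp add: monomial_def)
qed

text \<open>
  Keep those terms of the coefficients in which the variable has an exponent below \<open>d\<close>. Their combination
  cannot have terms divisible by the power of the variable, so it vanishes, and coprimality makes these terms
  a Koszul syzygy.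
\<close>

lemma monom_power_dvd_combination:
  fixes p q r :: "'k::field pring"
  assumes uv: "\<And>a. coef u a = 0 \<or> coef v a = 0" "coef u a = 0" "coef v a = 0"
    and eq: "Poly_Mapping.single u 1 * p + Poly_Mapping.single v 1 * q
      = Poly_Mapping.single (Poly_Mapping.single a d) 1 * r"
  shows "\<exists>t p' q'. p = Poly_Mapping.single (Poly_Mapping.single a d) 1 * p' + Poly_Mapping.single v 1 * t
    \<and> q = Poly_Mapping.single (Poly_Mapping.single a d) 1 * q' - Poly_Mapping.single u 1 * t"
proof -
  let ?m = "Poly_Mapping.single a d :: mon"
  let ?low = "\<lambda>m :: mon. coef m a < d"
  have low: "part ?low (Poly_Mapping.single u 1 * p) = Poly_Mapping.single u 1 * part ?low p"
      "part ?low (Poly_Mapping.single v 1 * q) = Poly_Mapping.single v 1 * part ?low q"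
    using uv(2,3) by (auto intro!: part_mult simp: lookup_add)
  have "part ?low (Poly_Mapping.single ?m 1 * r) = 0"
  proof (rule part_none)
    fix m assume "m \<in> supp (Poly_Mapping.single ?m 1 * r)"
    then obtain m' where "m = ?m + m'" using supp_monom_mult by blast
    then show "\<not> coef m a < d" by (simp add: lookup_add lookup_single)
  qed
  then have "Poly_Mapping.single u 1 * part ?low p = Poly_Mapping.single v 1 * - part ?low q"
    using arg_cong[OF eq, of "part ?low"] low by (simp add: part_add add_eq_0_iff2)
  from coprime_monom_syzygy[OF uv(1) this]
  obtain t where t: "part ?low p = Poly_Mapping.single v 1 * t" "- part ?low q = Poly_Mapping.single u 1 * t"
    by blast
  have high: "\<exists>h. part (\<lambda>m. \<not> ?low m) g = Poly_Mapping.single ?m 1 * h" for g :: "'k pring"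
  proof (rule monom_dvdI)
    fix m assume "m \<in> supp (part (\<lambda>m. \<not> ?low m) g)"
    then have "d \<le> coef m a" by (simp add: supp_part)
    then have "m = ?m + (m - ?m)"
      by (intro poly_mapping_eqI) (auto simp: lookup_add lookup_minus lookup_single when_def)
    then show "\<exists>m'. m = ?m + m'" by blast
  qed
  obtain p' q' where "part (\<lambda>m. \<not> ?low m) p = Poly_Mapping.single ?m 1 * p'"
    "part (\<lambda>m. \<not> ?low m) q = Poly_Mapping.single ?m 1 * q'"
    using high by blast
  moreover have "part ?low q = - (Poly_Mapping.single u 1 * t)"
    using arg_cong[OF t(2), of uminus] by simp
  ultimately have "p = Poly_Mapping.single v 1 * t + Poly_Mapping.single ?m 1 * p'"
    "q = - (Poly_Mapping.single u 1 * t) + Poly_Mapping.single ?m 1 * q'"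
    using part_split[of p ?low] part_split[of q ?low] t(1) by simp_all
  then show ?thesis by (metis add.commute add_uminus_conv_diff)
qed


lemma w_power_dvd_combination:
  assumes "monomial 0 j 0 0 * p + monomial 0 0 k 0 * q = monomial 0 0 0 l * r"
  shows "\<exists>t p' q'. p = monomial 0 0 0 l * p' + monomial 0 0 k 0 * t \<and> q = monomial 0 0 0 l * q' - monomial 0 j 0 0 * t"
proof -
  have e: "expo 0 0 0 l = Poly_Mapping.single 4 l" by (simp add: expo_def)
  have "coef (expo 0 j 0 0) a = 0 \<or> coef (expo 0 0 k 0) a = 0" for a
  proof -
    have "a \<in> {1, 2, 3, 4}" using UNIV_4 by blast
    then show ?thesis by auto
  qed
  from monom_power_dvd_combination[OF this _ _ assms[unfolded monomial_def e]]
  show ?thesis unfolding monomial_def e by simp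
qed

lemma z_power_dvd_combination:
  assumes "monomial 0 0 0 l * p + monomial 0 j 0 0 * q = monomial 0 0 k 0 * r"
  shows "\<exists>t p' q'. p = monomial 0 0 k 0 * p' + monomial 0 j 0 0 * t \<and> q = monomial 0 0 k 0 * q' - monomial 0 0 0 l * t"
proof -
  have e: "expo 0 0 k 0 = Poly_Mapping.single 3 k" by (simp add: expo_def)
  have "coef (expo 0 0 0 l) a = 0 \<or> coef (expo 0 j 0 0) a = 0" for a
  proof -
    have "a \<in> {1, 2, 3, 4}" using UNIV_4 by blast
    then show ?thesis by auto
  qed
  from monom_power_dvd_combination[OF this _ _ assms[unfolded monomial_def e]]
  show ?thesis unfolding monomial_def e by simp
qed


section \<open>The resolution\<close>

lemma all_less_numerals:
  "(\<forall>i<2. A i) \<longleftrightarrow> A 0 \<and> A (1::nat)"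
  "(\<forall>i<5. A i) \<longleftrightarrow> A 0 \<and> A 1 \<and> A 2 \<and> A 3 \<and> A (4::nat)"
  "(\<forall>i<6. A i) \<longleftrightarrow> A 0 \<and> A 1 \<and> A 2 \<and> A 3 \<and> A 4 \<and> A (5::nat)"
  by (simp_all add: numeral_eq_Suc All_less_Suc conj_ac)

lemma sum_less_numerals:
  "(\<Sum>i<2. g i) = g 0 + g (1::nat)"
  "(\<Sum>i<5. g i) = g 0 + g 1 + g 2 + g 3 + g (4::nat)"
  "(\<Sum>i<6. g i) = g 0 + g 1 + g 2 + g 3 + g 4 + g (5::nat)"
  by (simp_all add: numeral_eq_Suc)

lemma mat_of_rows_list_carrierI: "length rs = m \<Longrightarrow> mat_of_rows_list s rs \<in> carrier_mat m s"
  by (auto simp: mat_of_rows_list_def)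

lemma mat_of_rows_list_mult_index:
  assumes "v \<in> carrier_vec s" "i < length rs"
  shows "(mat_of_rows_list s rs *\<^sub>v v) $ i = (\<Sum>j<s. rs ! i ! j * v $ j)"
  using assms by (subst mat_vec_index[of _ "length rs" s]) (auto simp: mat_of_rows_list_def)

context komeda
begin

text \<open>
  The last column of \<open>\<phi>2\<close> is the Koszul syzygy of \<open>f2\<close> and \<open>f3\<close>. Modulo \<open>x\<close> the matrices
  become a resolution of a monomial ideal.
\<close>

definition \<phi>1 :: "'k::field pring mat" where
  "\<phi>1 = mat_of_rows_list 5 [[f1, f2, f3, f4, f5]]"

definition \<phi>2 :: "'k::field pring mat" where
  "\<phi>2 = mat_of_rows_list 6
    [[monomial 0 1 0 0, monomial 0 0 0 1, monomial 0 0 Q 0, 0, 0, 0],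
     [0, monomial (c + 1) 0 0 0, 0, monomial 1 0 Q 0, monomial 0 0 0 R, f3],
     [monomial (b + 1) 0 0 0, monomial 1 P 0 0, monomial 0 0 0 R, 0, 0, - f2],
     [0, monomial 0 0 1 0, 0, monomial 0 1 0 0, monomial b 0 0 0, 0],
     [- monomial 0 0 1 0, 0, - monomial c 0 0 0, monomial 0 0 0 1, monomial 0 P 0 0, 0]]"

definition \<phi>3 :: "'k::field pring mat" where
  "\<phi>3 = mat_of_rows_list 2
    [[monomial 0 0 0 1, - monomial 0 P Q 0],
     [- monomial 0 1 0 0, monomial b 0 Q 0],
     [0, f2],
     [monomial 0 0 1 0, - monomial (b + c) 0 0 0],
     [0, - f3],
     [- monomial 1 0 0 0, monomial 0 0 0 R]]"

text \<open>
  The degree of a column is that of any of its nonzero entries plus the degree of the row; Komeda's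
  relations make these choices agree.
\<close>

definition degs :: "nat \<Rightarrow> nat \<Rightarrow> nat" where
  "degs k j = [[0],
    [(b + c + 1) * n1, (P + 1) * n2, (Q + 1) * n3, (R + 1) * n4, n2 + R * n4],
    [n2 + n3 + R * n4, n3 + (R + 1) * n4, (Q + 1) * n3 + R * n4, n2 + (R + 1) * n4,
      (P + 1) * n2 + R * n4, (P + 1) * n2 + (Q + 1) * n3],
    [n2 + n3 + (R + 1) * n4, (P + 1) * n2 + (Q + 1) * n3 + R * n4]] ! k ! j"

definition komeda_resolution :: "'k::field based_complex" where
  "komeda_resolution = \<lparr>rk = (\<lambda>k. if k < 4 then [1, 5, 6, 2] ! k else 0), bdeg = degs,
     diff_mat = (\<lambda>k. if k < 3 then [\<phi>1, \<phi>2, \<phi>3] ! k else 0\<^sub>m (if k = 3 then 2 else 0) 0)\<rparr>"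

lemma \<phi>_carrier: "\<phi>1 \<in> carrier_mat 1 5" "\<phi>2 \<in> carrier_mat 5 6" "\<phi>3 \<in> carrier_mat 6 2"
  unfolding \<phi>1_def \<phi>2_def \<phi>3_def by (rule mat_of_rows_list_carrierI, simp)+

lemma \<phi>1_mult:
  assumes "v \<in> carrier_vec 5"
  shows "(\<phi>1 *\<^sub>v v) $ 0 = f1 * v $ 0 + f2 * v $ 1 + f3 * v $ 2 + f4 * v $ 3 + f5 * v $ 4"
  unfolding \<phi>1_def
  by (subst mat_of_rows_list_mult_index[OF assms]) (simp_all add: sum_less_numerals)

lemma \<phi>2_mult:
  assumes "v \<in> carrier_vec 6"
  shows
    "(\<phi>2 *\<^sub>v v) $ 0 = monomial 0 1 0 0 * v $ 0 + monomial 0 0 0 1 * v $ 1 + monomial 0 0 Q 0 * v $ 2"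
    "(\<phi>2 *\<^sub>v v) $ 1 = monomial (c + 1) 0 0 0 * v $ 1 + monomial 1 0 Q 0 * v $ 3 + monomial 0 0 0 R * v $ 4 + f3 * v $ 5"
    "(\<phi>2 *\<^sub>v v) $ 2 = monomial (b + 1) 0 0 0 * v $ 0 + monomial 1 P 0 0 * v $ 1 + monomial 0 0 0 R * v $ 2 - f2 * v $ 5"
    "(\<phi>2 *\<^sub>v v) $ 3 = monomial 0 0 1 0 * v $ 1 + monomial 0 1 0 0 * v $ 3 + monomial b 0 0 0 * v $ 4"
    "(\<phi>2 *\<^sub>v v) $ 4 = - monomial 0 0 1 0 * v $ 0 - monomial c 0 0 0 * v $ 2 + monomial 0 0 0 1 * v $ 3 + monomial 0 P 0 0 * v $ 4"
  unfolding \<phi>2_def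
  by (subst mat_of_rows_list_mult_index[OF assms]; simp add: sum_less_numerals)+

lemma \<phi>3_mult:
  assumes "v \<in> carrier_vec 2"
  shows
    "(\<phi>3 *\<^sub>v v) $ 0 = monomial 0 0 0 1 * v $ 0 - monomial 0 P Q 0 * v $ 1"
    "(\<phi>3 *\<^sub>v v) $ 1 = - monomial 0 1 0 0 * v $ 0 + monomial b 0 Q 0 * v $ 1"
    "(\<phi>3 *\<^sub>v v) $ 2 = f2 * v $ 1"
    "(\<phi>3 *\<^sub>v v) $ 3 = monomial 0 0 1 0 * v $ 0 - monomial (b + c) 0 0 0 * v $ 1"
    "(\<phi>3 *\<^sub>v v) $ 4 = - f3 * v $ 1"
    "(\<phi>3 *\<^sub>v v) $ 5 = - monomial 1 0 0 0 * v $ 0 + monomial 0 0 0 R * v $ 1"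
  unfolding \<phi>3_def
  by (subst mat_of_rows_list_mult_index[OF assms]; simp add: sum_less_numerals)+

lemma vec_eq_numeralsI:
  "dim_vec v = 1 \<Longrightarrow> dim_vec w = 1 \<Longrightarrow> v $ 0 = w $ 0 \<Longrightarrow> v = w"
  "dim_vec v = 5 \<Longrightarrow> dim_vec w = 5 \<Longrightarrow> v $ 0 = w $ 0 \<Longrightarrow> v $ 1 = w $ 1 \<Longrightarrow> v $ 2 = w $ 2 \<Longrightarrow>
    v $ 3 = w $ 3 \<Longrightarrow> v $ 4 = w $ 4 \<Longrightarrow> v = w"
  using all_less_numerals(2)[of "\<lambda>i. v $ i = w $ i"] by (auto intro!: eq_vecI)

lemma \<phi>1_\<phi>2:
  assumes "u \<in> carrier_vec 6"
  shows "\<phi>1 *\<^sub>v (\<phi>2 *\<^sub>v u) = 0\<^sub>v 1"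
proof (rule vec_eq_numeralsI(1))
  have c: "\<phi>2 *\<^sub>v u \<in> carrier_vec 5" using \<phi>_carrier(2) assms by (rule mult_mat_vec_carrier)
  show "(\<phi>1 *\<^sub>v (\<phi>2 *\<^sub>v u)) $ 0 = 0\<^sub>v 1 $ 0"
    unfolding \<phi>1_mult[OF c] \<phi>2_mult[OF assms] f_defs
    by (simp only: left_diff_distrib right_diff_distrib distrib_left mult_minus_left mult_minus_right monomial_mult_left)
      (simp add: algebra_simps)
qed (use \<phi>_carrier(1) in auto)

lemma \<phi>2_\<phi>3:
  assumes "u \<in> carrier_vec 2"
  shows "\<phi>2 *\<^sub>v (\<phi>3 *\<^sub>v u) = 0\<^sub>v 5"
proof (rule vec_eq_numeralsI(2))
  have c: "\<phi>3 *\<^sub>v u \<in> carrier_vec 6" using \<phi>_carrier(3) assms by (rule mult_mat_vec_carrier)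
  note eqs = \<phi>2_mult[OF c] \<phi>3_mult[OF assms] f_defs
  show "(\<phi>2 *\<^sub>v (\<phi>3 *\<^sub>v u)) $ 0 = 0\<^sub>v 5 $ 0" "(\<phi>2 *\<^sub>v (\<phi>3 *\<^sub>v u)) $ 1 = 0\<^sub>v 5 $ 1"
    "(\<phi>2 *\<^sub>v (\<phi>3 *\<^sub>v u)) $ 2 = 0\<^sub>v 5 $ 2" "(\<phi>2 *\<^sub>v (\<phi>3 *\<^sub>v u)) $ 3 = 0\<^sub>v 5 $ 3"
    "(\<phi>2 *\<^sub>v (\<phi>3 *\<^sub>v u)) $ 4 = 0\<^sub>v 5 $ 4"
    unfolding eqs by (simp_all add: algebra_simps monomial_mult_left monomial_mult)
qed (use \<phi>_carrier(2) in auto)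

text \<open>
  The power \<open>w\<^sup>R\<close> divides \<open>y\<^sup>P\<^sup>+\<^sup>1 v2 + z\<^sup>Q\<^sup>+\<^sup>1 v3\<close>. So, up to a multiple \<open>u6\<close> of the Koszul
  syzygy, it divides \<open>v2\<close> and \<open>v3\<close>, and their quotients \<open>u5\<close> and \<open>u3\<close> can be removed by the two syzygies that
  involve \<open>w\<^sup>R\<close>. What remains after cancelling \<open>w\<^sup>R\<close> is a relation between the variables \<open>y, z, w\<close>.
\<close>

lemma \<phi>1_syzygies_mod_x:
  fixes v1 v2 v3 v4 v5 :: "'k::field pring"
  assumes "- monomial 0 0 1 R * v1 + monomial 0 (P + 1) 0 0 * v2 + monomial 0 0 (Q + 1) 0 * v3
      + monomial 0 0 0 (R + 1) * v4 - monomial 0 1 0 R * v5 = 0"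
  shows "\<exists>u1 u2 u3 u4 u5 u6.
    v1 = monomial 0 1 0 0 * u1 + monomial 0 0 0 1 * u2 + monomial 0 0 Q 0 * u3 \<and>
    v2 = monomial 0 0 0 R * u5 + monomial 0 0 (Q + 1) 0 * u6 \<and>
    v3 = monomial 0 0 0 R * u3 - monomial 0 (P + 1) 0 0 * u6 \<and>
    v4 = monomial 0 0 1 0 * u2 + monomial 0 1 0 0 * u4 \<and>
    v5 = - monomial 0 0 1 0 * u1 + monomial 0 0 0 1 * u4 + monomial 0 P 0 0 * u5"
proof -
  define y z w y' z' w' :: "'k pring" where
    "y = monomial 0 1 0 0" "z = monomial 0 0 1 0" "w = monomial 0 0 0 1"
    "y' = monomial 0 P 0 0" "z' = monomial 0 0 Q 0" "w' = monomial 0 0 0 R"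
  have e: "monomial 0 0 1 R = z * w'" "monomial 0 (P + 1) 0 0 = y * y'" "monomial 0 0 (Q + 1) 0 = z * z'"
    "monomial 0 0 0 (R + 1) = w * w'" "monomial 0 1 0 R = y * w'"
    by (simp_all add: y_z_w_y'_z'_w'_def monomial_mult)
  have ne: "z \<noteq> 0" "w' \<noteq> 0" by (simp_all add: y_z_w_y'_z'_w'_def)
  have "monomial 0 (P + 1) 0 0 * v2 + monomial 0 0 (Q + 1) 0 * v3 = w' * (z * v1 - w * v4 + y * v5)"
    using assms unfolding e by (simp add: algebra_simps)
  then obtain s u5 u3 where v2: "v2 = w' * u5 + z * z' * s" and v3: "v3 = w' * u3 - y * y' * s"
    using w_power_dvd_combination[of "P + 1" v2 "Q + 1" v3 R]
    unfolding y_z_w_y'_z'_w'_def(6)[symmetric] e by blast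
  have "w' * (y * y' * u5 + z * z' * u3) = w' * (z * v1 - w * v4 + y * v5)"
    using assms unfolding e v2 v3 by (simp add: algebra_simps)
  then have eq: "y * y' * u5 + z * z' * u3 = z * v1 - w * v4 + y * v5"
    using ne by simp
  then have "w * v4 + y * (y' * u5 - v5) = z * (v1 - z' * u3)"
    by (simp add: algebra_simps)
  then obtain t u2 u1 where v4: "v4 = z * u2 + y * t" and v5: "y' * u5 - v5 = z * u1 - w * t"
    using z_power_dvd_combination[of 1 v4 1 "y' * u5 - v5" 1 "v1 - z' * u3"]
    unfolding y_z_w_y'_z'_w'_def(1-3)[symmetric] by blast
  have v5': "v5 = - z * u1 + w * t + y' * u5" using v5 by (simp add: algebra_simps)
  have "z * v1 = z * (y * u1 + w * u2 + z' * u3)"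
    using eq unfolding v4 v5' by (simp add: algebra_simps)
  then have "v1 = y * u1 + w * u2 + z' * u3" using ne by simp
  then show ?thesis
    unfolding e y_z_w_y'_z'_w'_def[symmetric] using v2 v3 v4 v5' by blast
qed

lemma \<phi>2_syzygies_mod_x:
  fixes v1 v2 v3 v4 v5 v6 :: "'k::field pring"
  assumes "monomial 0 1 0 0 * v1 + monomial 0 0 0 1 * v2 + monomial 0 0 Q 0 * v3 = 0"
    and 2: "monomial 0 0 0 R * v5 + monomial 0 0 (Q + 1) 0 * v6 = 0"
    and 3: "monomial 0 0 0 R * v3 - monomial 0 (P + 1) 0 0 * v6 = 0"
    and 4: "monomial 0 0 1 0 * v2 + monomial 0 1 0 0 * v4 = 0"
    and 5: "- monomial 0 0 1 0 * v1 + monomial 0 0 0 1 * v4 + monomial 0 P 0 0 * v5 = 0"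
  shows "\<exists>t s. v1 = monomial 0 0 0 1 * t - monomial 0 P Q 0 * s \<and> v2 = - monomial 0 1 0 0 * t \<and>
    v3 = monomial 0 (P + 1) 0 0 * s \<and> v4 = monomial 0 0 1 0 * t \<and>
    v5 = - monomial 0 0 (Q + 1) 0 * s \<and> v6 = monomial 0 0 0 R * s"
proof -
  have "monomial 0 0 1 0 * - v2 = monomial 0 1 0 0 * v4"
    using 4 by (simp add: add_eq_0_iff)
  from monomial_coprime_syzygy[OF this] obtain t where t: "- v2 = monomial 0 1 0 0 * t" "v4 = monomial 0 0 1 0 * t"
    by auto
  have "monomial 0 0 0 R * - v5 = monomial 0 0 (Q + 1) 0 * v6"
    using 2 by (simp add: add_eq_0_iff)
  from monomial_coprime_syzygy[OF this] obtain s where s: "- v5 = monomial 0 0 (Q + 1) 0 * s" "v6 = monomial 0 0 0 R * s"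
    by auto
  have v5: "v5 = - monomial 0 0 (Q + 1) 0 * s" using arg_cong[OF s(1), of uminus] by simp
  have v2: "v2 = - monomial 0 1 0 0 * t" using arg_cong[OF t(1), of uminus] by simp
  have "monomial 0 0 0 R * v3 = monomial 0 0 0 R * (monomial 0 (P + 1) 0 0 * s)"
    using 3 unfolding s(2) by (simp add: algebra_simps)
  then have v3: "v3 = monomial 0 (P + 1) 0 0 * s" by (simp only: mult_cancel_left monomial_nonzero simp_thms)
  have "monomial 0 0 1 0 * v1 = monomial 0 0 1 0 * (monomial 0 0 0 1 * t - monomial 0 P Q 0 * s)"
    using 5 unfolding t(2) v5 by (simp add: algebra_simps monomial_mult_left monomial_mult)
  then have "v1 = monomial 0 0 0 1 * t - monomial 0 P Q 0 * s" by (simp only: mult_cancel_left monomial_nonzero simp_thms)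
  with v2 v3 t(2) v5 s(2) show ?thesis by blast
qed

definition homog :: "nat \<Rightarrow> nat \<Rightarrow> 'k::field pring \<Rightarrow> bool" where
  "homog r e p \<longleftrightarrow> (\<forall>u\<in>supp p. sdeg n u + r = e)"

lemma homog_simps [simp]:
  "homog r e 0" "homog r e (- p) \<longleftrightarrow> homog r e p"
  "homog r e (monomial i j k l) \<longleftrightarrow> i * n1 + j * n2 + k * n3 + l * n4 + r = e"
  by (simp_all add: homog_def sdeg_expo_eq)

lemma homog_diff: "homog r e p \<Longrightarrow> homog r e q \<Longrightarrow> homog r e (p - q)"
  using keys_diff[of p q] unfolding homog_def by blast

lemma homog_f:
  "(b + c + 1) * n1 + r = e \<Longrightarrow> homog r e f1"
  "(P + 1) * n2 + r = e \<Longrightarrow> homog r e f2"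
  "(Q + 1) * n3 + r = e \<Longrightarrow> homog r e f3"
  "(R + 1) * n4 + r = e \<Longrightarrow> homog r e f4"
  "n2 + R * n4 + r = e \<Longrightarrow> homog r e f5"
  unfolding f_defs
  by (rule homog_diff; use rel1 rel2 rel3 rel4 rel5 in simp)+

lemma degree_preserving_rows:
  assumes "length rs = m" "\<forall>i<m. \<forall>j<s. homog (r i) (e j) (rs ! i ! j)"
  shows "degree_preserving n r e (mat_of_rows_list s rs)"
  using assms by (auto simp: degree_preserving_def mat_of_rows_list_def homog_def)

lemma \<phi>_degree_preserving:
  "degree_preserving n (degs 0) (degs 1) \<phi>1"
  "degree_preserving n (degs 1) (degs 2) \<phi>2"
  "degree_preserving n (degs 2) (degs 3) \<phi>3"
proof -
  note rels = rel1[unfolded distrib_right] rel2[unfolded distrib_right] rel3[unfolded distrib_right]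
    rel4[unfolded distrib_right] rel5[unfolded distrib_right]

  show "degree_preserving n (degs 0) (degs 1) \<phi>1"
    unfolding \<phi>1_def
    by (rule degree_preserving_rows[where m = 1]) (simp_all add: all_less_numerals degs_def homog_f)
  show "degree_preserving n (degs 1) (degs 2) \<phi>2"
    unfolding \<phi>2_def
    by (rule degree_preserving_rows[where m = 5], simp, unfold all_less_numerals)
      (use rels in \<open>simp add: degs_def homog_f distrib_right\<close>)
  show "degree_preserving n (degs 2) (degs 3) \<phi>3"
    unfolding \<phi>3_def
    by (rule degree_preserving_rows[where m = 6], simp, unfold all_less_numerals)
      (use rels in \<open>simp add: degs_def homog_f distrib_right\<close>)
qed

lemma xfree_f [simp]:
  "xfree f1 = - monomial 0 0 1 R" "xfree f2 = monomial 0 (P + 1) 0 0" "xfree f3 = monomial 0 0 (Q + 1) 0"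
  "xfree f4 = monomial 0 0 0 (R + 1)" "xfree f5 = - monomial 0 1 0 R"
  using params_pos by (simp_all add: f_defs)

text \<open>Setting \<open>x\<close> to zero in the equation of a cycle gives a syzygy of the monomials above.\<close>

lemma \<phi>1_exact:
  fixes v :: "'k::field pring vec"
  assumes v: "v \<in> carrier_vec 5" and ker: "\<phi>1 *\<^sub>v v = 0\<^sub>v 1"
  shows "\<exists>u\<in>carrier_vec 6. v = \<phi>2 *\<^sub>v u"
proof (rule exact_by_descent[OF _ \<phi>_carrier(1,2) \<phi>_degree_preserving(2) \<phi>1_\<phi>2 _ v ker])
  show "0 < n 1" using n_eq n_pos by simp
  fix v :: "'k pring vec" assume v: "v \<in> carrier_vec 5" and ker: "\<phi>1 *\<^sub>v v = 0\<^sub>v 1"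
  have "f1 * v $ 0 + f2 * v $ 1 + f3 * v $ 2 + f4 * v $ 3 + f5 * v $ 4 = 0"
    using arg_cong[OF ker, of "\<lambda>v. v $ 0"] \<phi>1_mult[OF v] by simp
  from arg_cong[OF this, of xfree]
  have "- monomial 0 0 1 R * xfree (v $ 0) + monomial 0 (P + 1) 0 0 * xfree (v $ 1) + monomial 0 0 (Q + 1) 0 * xfree (v $ 2)
      + monomial 0 0 0 (R + 1) * xfree (v $ 3) - monomial 0 1 0 R * xfree (v $ 4) = 0"
    by simp
  from \<phi>1_syzygies_mod_x[OF this] obtain u1 u2 u3 u4 u5 u6 where
    v_eqs: "xfree (v $ 0) = monomial 0 1 0 0 * u1 + monomial 0 0 0 1 * u2 + monomial 0 0 Q 0 * u3"
    "xfree (v $ 1) = monomial 0 0 0 R * u5 + monomial 0 0 (Q + 1) 0 * u6"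
    "xfree (v $ 2) = monomial 0 0 0 R * u3 - monomial 0 (P + 1) 0 0 * u6"
    "xfree (v $ 3) = monomial 0 0 1 0 * u2 + monomial 0 1 0 0 * u4"
    "xfree (v $ 4) = - monomial 0 0 1 0 * u1 + monomial 0 0 0 1 * u4 + monomial 0 P 0 0 * u5"
    by blast
  define u where "u = vec 6 (\<lambda>i. [u1, u2, u3, u4, u5, u6] ! i)"
  have uc: "u \<in> carrier_vec 6" unfolding u_def by (rule vec_carrier)
  have ui: "u $ 0 = u1" "u $ 1 = u2" "u $ 2 = u3" "u $ 3 = u4" "u $ 4 = u5" "u $ 5 = u6"
    by (simp_all add: u_def)
  have "\<forall>i<5. xfree (v $ i) = xfree ((\<phi>2 *\<^sub>v u) $ i)"
    unfolding all_less_numerals \<phi>2_mult[OF uc] ui v_eqs[THEN xfree_eqD]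
    using params_pos by simp
  then show "\<exists>u\<in>carrier_vec 6. \<exists>w\<in>carrier_vec 5. v = \<phi>2 *\<^sub>v u + monomial 1 0 0 0 \<cdot>\<^sub>v w"
    using multiple_of_x[OF v mult_mat_vec_carrier[OF \<phi>_carrier(2) uc]] uc by blast
qed

lemma \<phi>2_exact:
  fixes v :: "'k::field pring vec"
  assumes v: "v \<in> carrier_vec 6" and ker: "\<phi>2 *\<^sub>v v = 0\<^sub>v 5"
  shows "\<exists>u\<in>carrier_vec 2. v = \<phi>3 *\<^sub>v u"
proof (rule exact_by_descent[OF _ \<phi>_carrier(2,3) \<phi>_degree_preserving(3) \<phi>2_\<phi>3 _ v ker])
  show "0 < n 1" using n_eq n_pos by simp
  fix v :: "'k pring vec" assume v: "v \<in> carrier_vec 6" and ker: "\<phi>2 *\<^sub>v v = 0\<^sub>v 5"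
  have z: "xfree ((\<phi>2 *\<^sub>v v) $ i) = 0" if "i < 5" for i
    using ker that by simp
  have "\<exists>t s. xfree (v $ 0) = monomial 0 0 0 1 * t - monomial 0 P Q 0 * s \<and> xfree (v $ 1) = - monomial 0 1 0 0 * t \<and>
    xfree (v $ 2) = monomial 0 (P + 1) 0 0 * s \<and> xfree (v $ 3) = monomial 0 0 1 0 * t \<and>
    xfree (v $ 4) = - monomial 0 0 (Q + 1) 0 * s \<and> xfree (v $ 5) = monomial 0 0 0 R * s"
    by (rule \<phi>2_syzygies_mod_x)
      (use z[of 0, unfolded \<phi>2_mult[OF v]] z[of 1, unfolded \<phi>2_mult[OF v]] z[of 2, unfolded \<phi>2_mult[OF v]]
        z[of 3, unfolded \<phi>2_mult[OF v]] z[of 4, unfolded \<phi>2_mult[OF v]] params_pos in simp_all)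
  then obtain t s where
    v_eqs: "xfree (v $ 0) = monomial 0 0 0 1 * t - monomial 0 P Q 0 * s" "xfree (v $ 1) = - monomial 0 1 0 0 * t"
    "xfree (v $ 2) = monomial 0 (P + 1) 0 0 * s" "xfree (v $ 3) = monomial 0 0 1 0 * t"
    "xfree (v $ 4) = - monomial 0 0 (Q + 1) 0 * s" "xfree (v $ 5) = monomial 0 0 0 R * s"
    by blast
  define u where "u = vec 2 (\<lambda>i. [t, s] ! i)"
  have uc: "u \<in> carrier_vec 2" unfolding u_def by (rule vec_carrier)
  have ui: "u $ 0 = t" "u $ 1 = s" by (simp_all add: u_def)
  have "\<forall>i<6. xfree (v $ i) = xfree ((\<phi>3 *\<^sub>v u) $ i)"
    unfolding all_less_numerals \<phi>3_mult[OF uc] ui v_eqs[THEN xfree_eqD]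
    using params_pos by simp
  then show "\<exists>u\<in>carrier_vec 2. \<exists>w\<in>carrier_vec 6. v = \<phi>3 *\<^sub>v u + monomial 1 0 0 0 \<cdot>\<^sub>v w"
    using multiple_of_x[OF v mult_mat_vec_carrier[OF \<phi>_carrier(3) uc]] uc by blast
qed

lemma f3_nonzero [simp]: "f3 \<noteq> 0"
proof
  assume "f3 = (0 :: 'a pring)"
  from arg_cong[OF this, of xfree] show False by simp
qed

lemma \<phi>3_injective:
  assumes v: "v \<in> carrier_vec 2" and ker: "\<phi>3 *\<^sub>v v = 0\<^sub>v 6"
  shows "v = 0\<^sub>v 2"
proof -
  have z: "(\<phi>3 *\<^sub>v v) $ i = 0" if "i < 6" for i
    using ker that by simp
  have 1: "v $ 1 = 0"
    using z[of 4, unfolded \<phi>3_mult[OF v]] by simp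
  have 0: "v $ 0 = 0"
    using z[of 3, unfolded \<phi>3_mult[OF v]] 1 by simp
  have "\<forall>i<2. v $ i = 0" unfolding all_less_numerals using 0 1 by simp
  then show ?thesis using v by (intro eq_vecI) auto
qed

lemma komeda_resolution_simps [simp]:
  "rk komeda_resolution 0 = 1" "rk komeda_resolution 1 = 5" "rk komeda_resolution (Suc 0) = 5"
  "rk komeda_resolution 2 = 6" "rk komeda_resolution (Suc (Suc 0)) = 6"
  "rk komeda_resolution 3 = 2" "rk komeda_resolution (Suc (Suc (Suc 0))) = 2"
  "3 < k \<Longrightarrow> rk komeda_resolution k = 0"
  "bdeg komeda_resolution = degs"
  "diff_mat komeda_resolution 0 = \<phi>1" "diff_mat komeda_resolution 1 = \<phi>2"
  "diff_mat komeda_resolution (Suc 0) = \<phi>2" "diff_mat komeda_resolution 2 = \<phi>3"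
  "diff_mat komeda_resolution (Suc (Suc 0)) = \<phi>3"
  "diff_mat komeda_resolution 3 = 0\<^sub>m 2 0" "diff_mat komeda_resolution (Suc (Suc (Suc 0))) = 0\<^sub>m 2 0" "3 < k \<Longrightarrow> diff_mat komeda_resolution k = 0\<^sub>m 0 0"
  by (simp_all add: komeda_resolution_def numeral_2_eq_2 numeral_3_eq_3)

lemma level_cases:
  fixes k :: nat
  obtains "k = 0" | "k = 1" | "k = 2" | "k = 3" | "3 < k"
  by linarith

lemma degs_in_semigroup:
  assumes "k < 4" "j < rk komeda_resolution k"
  shows "\<exists>u. degs k j = sdeg n u"
proof -
  have "\<exists>u. d = sdeg n u" if "d = i * n1 + j * n2 + k * n3 + l * n4" for d i j k l
    using that sdeg_expo_eq by metis
  note I = this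
  have 0: "\<forall>j<1. \<exists>u. degs 0 j = sdeg n u"
    using I[of 0 0 0 0 0] by (simp add: degs_def)
  have 1: "\<forall>j<5. \<exists>u. degs 1 j = sdeg n u"
    unfolding all_less_numerals degs_def
    using I[of _ "b + c + 1" 0 0 0] I[of _ 0 "P + 1" 0 0] I[of _ 0 0 "Q + 1" 0] I[of _ 0 0 0 "R + 1"] I[of _ 0 1 0 R]
    by simp
  have 2: "\<forall>j<6. \<exists>u. degs 2 j = sdeg n u"
    unfolding all_less_numerals degs_def
    using I[of _ 0 1 1 R] I[of _ 0 0 1 "R + 1"] I[of _ 0 0 "Q + 1" R] I[of _ 0 1 0 "R + 1"] I[of _ 0 "P + 1" 0 R]
      I[of _ 0 "P + 1" "Q + 1" 0]
    by simp
  have 3: "\<forall>j<2. \<exists>u. degs 3 j = sdeg n u"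
    unfolding all_less_numerals degs_def
    using I[of _ 0 1 1 "R + 1"] I[of _ 0 "P + 1" "Q + 1" R]
    by simp
  from assms(1) consider "k = 0" | "k = 1" | "k = 2" | "k = 3" by linarith
  then show ?thesis using 0 1 2 3 assms(2) by cases auto
qed

lemma irrelevant_f: "f1 \<in> irrelevant_ideal" "f2 \<in> irrelevant_ideal" "f3 \<in> irrelevant_ideal"
  "f4 \<in> irrelevant_ideal" "f5 \<in> irrelevant_ideal"
  using params_pos by (auto simp: irrelevant_ideal_def f_defs lookup_minus)

lemma irrelevant_simps [simp]:
  "0 \<in> irrelevant_ideal" "- p \<in> irrelevant_ideal \<longleftrightarrow> p \<in> irrelevant_ideal"
  "monomial i j k l \<in> irrelevant_ideal \<longleftrightarrow> 0 < i \<or> 0 < j \<or> 0 < k \<or> 0 < l"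
  by (auto simp: irrelevant_ideal_def when_def)

lemma irrelevant_rows:
  assumes "length rs = m" "\<forall>i<m. \<forall>j<s. rs ! i ! j \<in> irrelevant_ideal"
  shows "\<forall>i<m. \<forall>j<s. mat_of_rows_list s rs $$ (i, j) \<in> irrelevant_ideal"
  using assms by (auto simp: mat_of_rows_list_def)

lemma irrelevant_\<phi>:
  "\<forall>i<1. \<forall>j<5. \<phi>1 $$ (i, j) \<in> irrelevant_ideal"
  "\<forall>i<5. \<forall>j<6. \<phi>2 $$ (i, j) \<in> irrelevant_ideal"
  "\<forall>i<6. \<forall>j<2. \<phi>3 $$ (i, j) \<in> irrelevant_ideal"
proof -
  show "\<forall>i<1. \<forall>j<5. \<phi>1 $$ (i, j) \<in> irrelevant_ideal"
    unfolding \<phi>1_def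
    by (rule irrelevant_rows) (simp_all add: all_less_numerals irrelevant_f)
  show "\<forall>i<5. \<forall>j<6. \<phi>2 $$ (i, j) \<in> irrelevant_ideal"
    unfolding \<phi>2_def
    by (rule irrelevant_rows, simp, unfold all_less_numerals) (use params_pos in \<open>simp add: irrelevant_f\<close>)
  show "\<forall>i<6. \<forall>j<2. \<phi>3 $$ (i, j) \<in> irrelevant_ideal"
    unfolding \<phi>3_def
    by (rule irrelevant_rows, simp, unfold all_less_numerals) (use params_pos in \<open>simp add: irrelevant_f\<close>)
qed

lemma \<phi>1_image:
  "(\<lambda>v. \<phi>1 *\<^sub>v v) ` carrier_vec 5 = {w \<in> carrier_vec 1. w $ 0 \<in> toric_ideal n}"
proof (intro equalityI subsetI)
  fix w :: "'a pring vec" assume "w \<in> (\<lambda>v. \<phi>1 *\<^sub>v v) ` carrier_vec 5"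
  then obtain v where v: "v \<in> carrier_vec 5" "w = \<phi>1 *\<^sub>v v" by blast
  have "w \<in> carrier_vec 1" unfolding v(2) using \<phi>_carrier(1) v(1) by (rule mult_mat_vec_carrier)
  moreover have "w $ 0 \<in> toric_ideal n"
    unfolding v(2) \<phi>1_mult[OF v(1)] toric_ideal_eq by (rule komeda_idealI)
  ultimately show "w \<in> {w \<in> carrier_vec 1. w $ 0 \<in> toric_ideal n}" by blast
next
  fix w :: "'a pring vec" assume "w \<in> {w \<in> carrier_vec 1. w $ 0 \<in> toric_ideal n}"
  then have w: "w \<in> carrier_vec 1" "w $ 0 \<in> komeda_ideal" using toric_ideal_eq by auto
  then obtain u1 u2 u3 u4 u5 where eq: "w $ 0 = f1 * u1 + f2 * u2 + f3 * u3 + f4 * u4 + f5 * u5"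
    unfolding komeda_ideal_def by blast
  define u where "u = vec 5 (\<lambda>i. [u1, u2, u3, u4, u5] ! i)"
  have uc: "u \<in> carrier_vec 5" unfolding u_def by (rule vec_carrier)
  have ui: "u $ 0 = u1" "u $ 1 = u2" "u $ 2 = u3" "u $ 3 = u4" "u $ 4 = u5"
    by (simp_all add: u_def)
  have "w = \<phi>1 *\<^sub>v u"
  proof (rule vec_eq_numeralsI(1))
    show "w $ 0 = (\<phi>1 *\<^sub>v u) $ 0" unfolding \<phi>1_mult[OF uc] ui by (rule eq)
  qed (use w(1) \<phi>_carrier(1) in auto)
  with uc show "w \<in> (\<lambda>v. \<phi>1 *\<^sub>v v) ` carrier_vec 5" by blast
qed

theorem komeda_resolution_minimal:
  "minimal_graded_free_resolution n (komeda_resolution :: 'k::field based_complex)"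
proof -
  let ?F = "komeda_resolution :: 'k based_complex"
  have carr: "diff_mat ?F k \<in> carrier_mat (rk ?F k) (rk ?F (Suc k))" for k
    using \<phi>_carrier by (cases k rule: level_cases) auto
  have dp: "degree_preserving n (bdeg ?F k) (bdeg ?F (Suc k)) (diff_mat ?F k)" for k
  proof -
    have "degree_preserving n r e (0\<^sub>m i 0 :: 'k pring mat)" for r e i
      by (simp add: degree_preserving_def)
    then show ?thesis
      using \<phi>_degree_preserving by (cases k rule: level_cases) (auto simp: numeral_2_eq_2 numeral_3_eq_3)
  qed
  have deg: "bdeg ?F k j \<in> gen_semigroup n UNIV" if "j < rk ?F k" for k j
  proof -
    have "k < 4" using that by (cases k rule: level_cases) auto
    with degs_in_semigroup[OF this that] sdeg_in_gen_semigroup show ?thesis by auto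
  qed
  have zero_dim: "(carrier_vec 0 :: 'k pring vec set) = {0\<^sub>v 0}"
    by (auto intro!: eq_vecI)
  have Z: "(0\<^sub>m i 0 :: 'k pring mat) *\<^sub>v 0\<^sub>v 0 = 0\<^sub>v i" for i
    by (rule mat_vec_zero[OF zero_carrier_mat])
  have Z': "(\<lambda>v. (0\<^sub>m 0 0 :: 'k pring mat) *\<^sub>v v) ` carrier_vec 0
      = {w \<in> carrier_vec 0. (0\<^sub>m i 0 :: 'k pring mat) *\<^sub>v w = 0\<^sub>v i}" for i
    unfolding zero_dim image_insert image_empty Z using Z by blast
  have ex: "(\<lambda>v. diff_mat ?F (Suc k) *\<^sub>v v) ` carrier_vec (rk ?F (Suc (Suc k)))
      = {w \<in> carrier_vec (rk ?F (Suc k)). diff_mat ?F k *\<^sub>v w = 0\<^sub>v (rk ?F k)}" for k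
  proof (cases k rule: level_cases)
    case 1
    have "(\<lambda>v. \<phi>2 *\<^sub>v v) ` carrier_vec 6 = {w \<in> carrier_vec 5. \<phi>1 *\<^sub>v w = 0\<^sub>v 1}"
      using \<phi>1_exact \<phi>1_\<phi>2 mult_mat_vec_carrier[OF \<phi>_carrier(2)] by blast
    with 1 show ?thesis by simp
  next
    case 2
    have "(\<lambda>v. \<phi>3 *\<^sub>v v) ` carrier_vec 2 = {w \<in> carrier_vec 6. \<phi>2 *\<^sub>v w = 0\<^sub>v 5}"
      using \<phi>2_exact \<phi>2_\<phi>3 mult_mat_vec_carrier[OF \<phi>_carrier(3)] by blast
    with 2 show ?thesis by simp
  next
    case 3
    have "{w \<in> carrier_vec 2. \<phi>3 *\<^sub>v w = 0\<^sub>v 6} = {0\<^sub>v 2 :: 'k pring vec}"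
    proof (intro equalityI subsetI)
      fix w :: "'k pring vec" assume "w \<in> {w \<in> carrier_vec 2. \<phi>3 *\<^sub>v w = 0\<^sub>v 6}"
      then show "w \<in> {0\<^sub>v 2}" using \<phi>3_injective[of w] by simp
    next
      fix w :: "'k pring vec" assume "w \<in> {0\<^sub>v 2}"
      then show "w \<in> {w \<in> carrier_vec 2. \<phi>3 *\<^sub>v w = 0\<^sub>v 6}"
        using mat_vec_zero[OF \<phi>_carrier(3)] by simp
    qed
    moreover have "(\<lambda>v. (0\<^sub>m 2 0 :: 'k pring mat) *\<^sub>v v) ` carrier_vec 0 = {0\<^sub>v 2}"
      unfolding zero_dim image_insert image_empty Z ..
    ultimately have "(\<lambda>v. 0\<^sub>m 2 0 *\<^sub>v v) ` carrier_vec 0 = {w \<in> carrier_vec 2. \<phi>3 *\<^sub>v w = (0\<^sub>v 6 :: 'k pring vec)}"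
      by simp
    with 3 show ?thesis by simp
  next
    case 4
    with Z'[of 2] show ?thesis by simp
  next
    case 5
    with Z'[of 0] show ?thesis by simp
  qed
  have ex0: "(\<lambda>v. diff_mat ?F 0 *\<^sub>v v) ` carrier_vec (rk ?F 1)
      = {w \<in> carrier_vec (rk ?F 0). w $ 0 \<in> toric_ideal n}"
    unfolding komeda_resolution_simps by (rule \<phi>1_image)
  have start: "rk ?F 0 = 1" "bdeg ?F 0 0 = 0" by (simp_all add: degs_def)
  have "graded_free_resolution n ?F"
    unfolding graded_free_resolution_def
    by (intro conjI start allI impI deg carr dp ex ex0)
  moreover have "diff_mat ?F k $$ (i, j) \<in> irrelevant_ideal" if "i < rk ?F k" "j < rk ?F (Suc k)" for k i j
    using that irrelevant_\<phi> by (cases k rule: level_cases) auto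
  ultimately show ?thesis
    unfolding minimal_graded_free_resolution_def by blast
qed

end

section \<open>Comparing the degrees\<close>

context komeda
begin

text \<open>
  An equation \<open>d' - d = - t n1 + i n2 + j n3 + l n4\<close> with a standard monomial and \<open>t > 0\<close> is the normal form of
  \<open>d' - d\<close>, and its negative coefficient certifies that \<open>d' - d\<close> lies outside the semigroup.
\<close>

lemma incomparableI:
  assumes "standard i j l" "0 < t" "d' + t * n1 = d + i * n2 + j * n3 + l * n4"
  shows "sdeg n u + d \<noteq> d'"
proof
  assume "sdeg n u + d = d'"
  with assms(3) have "sdeg n u + t * n1 = i * n2 + j * n3 + l * n4" by linarith
  then have "int (sdeg n u) = - int t * int n1 + int i * int n2 + int j * int n3 + int l * int n4"
    by (simp add: algebra_simps flip: of_nat_mult of_nat_add)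
  with not_in_semigroup[OF assms(1), of "- int t" u] assms(2) show False by simp
qed

text \<open>
  The normal forms below are computed in the group of differences, where the relations give
  \<open>z\<^sup>-\<^sup>1 = x\<^sup>-\<^sup>a w\<^sup>R\<close>, \<open>w\<^sup>-\<^sup>1 = x\<^sup>-\<^sup>a z w\<^sup>R\<^sup>-\<^sup>1\<close> and \<open>y\<^sup>-\<^sup>1 = x\<^sup>-\<^sup>a\<^sup>-\<^sup>b y\<^sup>P z w\<^sup>R\<^sup>-\<^sup>1\<close> with
  \<open>a = b + c + 1\<close>. Cases are distinguished where \<open>y\<^sup>2\<close> or \<open>z\<^sup>2\<close> appears, which is reduced further for \<open>P = 1\<close> or
  \<open>Q = 1\<close>. The bound on \<open>c\<close> enters through \<open>f4\<close> and \<open>f3\<close>, whose degrees differ by that of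
  \<open>x\<^sup>1\<^sup>-\<^sup>c y\<^sup>P\<^sup>-\<^sup>1 z\<^sup>Q\<close>.
\<close>

lemma degs_1_incomparable:
  assumes "2 \<le> c" "i < 5" "j < 5" "i \<noteq> j"
  shows "sdeg n u + degs 1 i \<noteq> degs 1 j"
proof -
  obtain P' Q' R' where suc: "P = Suc P'" "Q = Suc Q'" "R = Suc R'"
    using params_pos by (metis gr0_implies_Suc)
  obtain c' where c': "c = Suc (Suc c')" using assms(1) by (metis add_2_eq_Suc le_Suc_ex)
  note facts = params_pos rel1 rel2 rel3 rel4 suc c'
  have "sdeg n u + degs 1 1 \<noteq> degs 1 0"
    by (rule incomparableI[of 0 1 R' "b"], unfold standard_def degs_def) (use facts in \<open>auto simp: algebra_simps\<close>)
  moreover have "sdeg n u + degs 1 0 \<noteq> degs 1 1"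
    by (rule incomparableI[of 0 0 1 "c + 1"], unfold standard_def degs_def) (use facts in \<open>auto simp: algebra_simps\<close>)
  moreover have "sdeg n u + degs 1 2 \<noteq> degs 1 0"
    by (rule incomparableI[of P 1 R' "b + c"], unfold standard_def degs_def) (use facts in \<open>auto simp: algebra_simps\<close>)
  moreover have "sdeg n u + degs 1 0 \<noteq> degs 1 2"
    by (rule incomparableI[of 1 0 0 "b + 1"], unfold standard_def degs_def) (use facts in \<open>auto simp: algebra_simps\<close>)
  moreover have "sdeg n u + degs 1 3 \<noteq> degs 1 0"
  proof -
    consider "Q = 1" | "2 \<le> Q"
      using params_pos by linarith
    then show ?thesis
    proof cases
      case 1
      show ?thesis
        by (rule incomparableI[of 1 0 R' "b + 1"], unfold standard_def degs_def) (use facts 1 in \<open>auto simp: algebra_simps\<close>)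
    next
      case 2
      show ?thesis
        by (rule incomparableI[of 0 2 R' "b + c + 1"], unfold standard_def degs_def) (use facts 2 in \<open>auto simp: algebra_simps\<close>)
    qed
  qed
  moreover have "sdeg n u + degs 1 0 \<noteq> degs 1 3"
    by (rule incomparableI[of P Q 0 "b + c"], unfold standard_def degs_def) (use facts in \<open>auto simp: algebra_simps\<close>)
  moreover have "sdeg n u + degs 1 4 \<noteq> degs 1 0"
  proof -
    consider "Q = 1" | "2 \<le> Q"
      using params_pos by linarith
    then show ?thesis
    proof cases
      case 1
      show ?thesis
        by (rule incomparableI[of 0 0 R "b + 1"], unfold standard_def degs_def) (use facts 1 in \<open>auto simp: algebra_simps\<close>)
    next
      case 2
      show ?thesis
        by (rule incomparableI[of P 2 R' "2 * b + c + 1"], unfold standard_def degs_def) (use facts 2 in \<open>auto simp: algebra_simps\<close>)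
    qed
  qed
  moreover have "sdeg n u + degs 1 0 \<noteq> degs 1 4"
    by (rule incomparableI[of 0 Q 0 "c"], unfold standard_def degs_def) (use facts in \<open>auto simp: algebra_simps\<close>)
  moreover have "sdeg n u + degs 1 2 \<noteq> degs 1 1"
    by (rule incomparableI[of P 0 0 "c"], unfold standard_def degs_def) (use facts in \<open>auto simp: algebra_simps\<close>)
  moreover have "sdeg n u + degs 1 1 \<noteq> degs 1 2"
    by (rule incomparableI[of 1 1 R' "2 * b + 1"], unfold standard_def degs_def) (use facts in \<open>auto simp: algebra_simps\<close>)
  moreover have "sdeg n u + degs 1 3 \<noteq> degs 1 1"
    by (rule incomparableI[of 0 1 0 "c + 1"], unfold standard_def degs_def) (use facts in \<open>auto simp: algebra_simps\<close>)
  moreover have "sdeg n u + degs 1 1 \<noteq> degs 1 3"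
    by (rule incomparableI[of 0 0 R "b"], unfold standard_def degs_def) (use facts in \<open>auto simp: algebra_simps\<close>)
  moreover have "sdeg n u + degs 1 4 \<noteq> degs 1 1"
    by (rule incomparableI[of P 1 0 "b + c + 1"], unfold standard_def degs_def) (use facts in \<open>auto simp: algebra_simps\<close>)
  moreover have "sdeg n u + degs 1 1 \<noteq> degs 1 4"
    by (rule incomparableI[of 1 0 R' "b"], unfold standard_def degs_def) (use facts in \<open>auto simp: algebra_simps\<close>)
  moreover have "sdeg n u + degs 1 3 \<noteq> degs 1 2"
  proof -
    consider "2 \<le> Q" | "2 \<le> P \<and> Q = 1" | "P = 1 \<and> Q = 1"
      using params_pos by linarith
    then show ?thesis
    proof cases
      case 1
      show ?thesis
        by (rule incomparableI[of 1 2 R' "2 * b + c + 2"], unfold standard_def degs_def) (use facts 1 in \<open>auto simp: algebra_simps\<close>)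
    next
      case 2
      show ?thesis
        by (rule incomparableI[of 2 0 R' "2 * b + 2"], unfold standard_def degs_def) (use facts 2 in \<open>auto simp: algebra_simps\<close>)
    next
      case 3
      show ?thesis
        by (rule incomparableI[of 0 0 R "b + 2"], unfold standard_def degs_def) (use facts 3 in \<open>auto simp: algebra_simps\<close>)
    qed
  qed
  moreover have "sdeg n u + degs 1 2 \<noteq> degs 1 3"
    by (rule incomparableI[of P' Q 0 "c - 1"], unfold standard_def degs_def) (use facts in \<open>auto simp: algebra_simps\<close>)
  moreover have "sdeg n u + degs 1 4 \<noteq> degs 1 2"
    by (rule incomparableI[of 0 1 0 "b + 1"], unfold standard_def degs_def) (use facts in \<open>auto simp: algebra_simps\<close>)
  moreover have "sdeg n u + degs 1 2 \<noteq> degs 1 4"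
    by (rule incomparableI[of 0 0 R "c"], unfold standard_def degs_def) (use facts in \<open>auto simp: algebra_simps\<close>)
  moreover have "sdeg n u + degs 1 4 \<noteq> degs 1 3"
    by (rule incomparableI[of P 0 0 "b"], unfold standard_def degs_def) (use facts in \<open>auto simp: algebra_simps\<close>)
  moreover have "sdeg n u + degs 1 3 \<noteq> degs 1 4"
    by (rule incomparableI[of 1 1 R' "b + c + 1"], unfold standard_def degs_def) (use facts in \<open>auto simp: algebra_simps\<close>)
  ultimately have "\<forall>i<5. \<forall>j<5. i \<noteq> j \<longrightarrow> sdeg n u + degs 1 i \<noteq> degs 1 j"
    unfolding all_less_numerals by blast
  with assms(2-4) show ?thesis by blast
qed

text \<open>
  The bound on \<open>R\<close> enters through the last and the third syzygy, whose degrees differ by that of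
  \<open>x\<^sup>-\<^sup>c\<^sup>-\<^sup>1 z w\<close>: this monomial in \<open>z, w\<close> is standard only for \<open>R \<ge> 2\<close>.
\<close>

lemma degs_2_incomparable:
  assumes "2 \<le> R" "i < 6" "j < 6" "i \<noteq> j"
  shows "sdeg n u + degs 2 i \<noteq> degs 2 j"
proof -
  obtain P' Q' R' where suc: "P = Suc P'" "Q = Suc Q'" "R = Suc R'"
    using params_pos by (metis gr0_implies_Suc)
  note facts = params_pos rel1 rel2 rel3 rel4 suc assms(1)
  have "sdeg n u + degs 2 0 \<noteq> degs 2 1"
    by (rule incomparableI[of P 0 0 "b"], unfold standard_def degs_def) (use facts in \<open>auto simp: algebra_simps\<close>)
  moreover have "sdeg n u + degs 2 1 \<noteq> degs 2 0"
    by (rule incomparableI[of 1 1 R' "b + c + 1"], unfold standard_def degs_def) (use facts in \<open>auto simp: algebra_simps\<close>)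
  moreover have "sdeg n u + degs 2 0 \<noteq> degs 2 2"
    by (rule incomparableI[of 0 0 R "b + 1"], unfold standard_def degs_def) (use facts in \<open>auto simp: algebra_simps\<close>)
  moreover have "sdeg n u + degs 2 2 \<noteq> degs 2 0"
    by (rule incomparableI[of 0 1 0 "c"], unfold standard_def degs_def) (use facts in \<open>auto simp: algebra_simps\<close>)
  moreover have "sdeg n u + degs 2 0 \<noteq> degs 2 3"
    by (rule incomparableI[of P Q 0 "b + c"], unfold standard_def degs_def) (use facts in \<open>auto simp: algebra_simps\<close>)
  moreover have "sdeg n u + degs 2 3 \<noteq> degs 2 0"
  proof -
    consider "Q = 1" | "2 \<le> Q"
      using params_pos by linarith
    then show ?thesis
    proof cases
      case 1
      show ?thesis
        by (rule incomparableI[of 1 0 R' "b + 1"], unfold standard_def degs_def) (use facts 1 in \<open>auto simp: algebra_simps\<close>)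
    next
      case 2
      show ?thesis
        by (rule incomparableI[of 0 2 R' "b + c + 1"], unfold standard_def degs_def) (use facts 2 in \<open>auto simp: algebra_simps\<close>)
    qed
  qed
  moreover have "sdeg n u + degs 2 0 \<noteq> degs 2 4"
    by (rule incomparableI[of P' Q 0 "c"], unfold standard_def degs_def) (use facts in \<open>auto simp: algebra_simps\<close>)
  moreover have "sdeg n u + degs 2 4 \<noteq> degs 2 0"
  proof -
    consider "2 \<le> Q" | "2 \<le> P \<and> Q = 1" | "P = 1 \<and> Q = 1"
      using params_pos by linarith
    then show ?thesis
    proof cases
      case 1
      show ?thesis
        by (rule incomparableI[of 1 2 R' "2 * b + c + 1"], unfold standard_def degs_def) (use facts 1 in \<open>auto simp: algebra_simps\<close>)
    next
      case 2
      show ?thesis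
        by (rule incomparableI[of 2 0 R' "2 * b + 1"], unfold standard_def degs_def) (use facts 2 in \<open>auto simp: algebra_simps\<close>)
    next
      case 3
      show ?thesis
        by (rule incomparableI[of 0 0 R "b + 1"], unfold standard_def degs_def) (use facts 3 in \<open>auto simp: algebra_simps\<close>)
    qed
  qed
  moreover have "sdeg n u + degs 2 0 \<noteq> degs 2 5"
    by (rule incomparableI[of 0 0 1 "1"], unfold standard_def degs_def) (use facts in \<open>auto simp: algebra_simps\<close>)
  moreover have "sdeg n u + degs 2 5 \<noteq> degs 2 0"
    by (rule incomparableI[of 0 1 R' "b + c"], unfold standard_def degs_def) (use facts in \<open>auto simp: algebra_simps\<close>)
  moreover have "sdeg n u + degs 2 1 \<noteq> degs 2 2"
    by (rule incomparableI[of 1 0 R' "b + 1"], unfold standard_def degs_def) (use facts in \<open>auto simp: algebra_simps\<close>)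
  moreover have "sdeg n u + degs 2 2 \<noteq> degs 2 1"
    by (rule incomparableI[of P 1 0 "b + c"], unfold standard_def degs_def) (use facts in \<open>auto simp: algebra_simps\<close>)
  moreover have "sdeg n u + degs 2 1 \<noteq> degs 2 3"
    by (rule incomparableI[of 0 Q 0 "c"], unfold standard_def degs_def) (use facts in \<open>auto simp: algebra_simps\<close>)
  moreover have "sdeg n u + degs 2 3 \<noteq> degs 2 1"
  proof -
    consider "Q = 1" | "2 \<le> Q"
      using params_pos by linarith
    then show ?thesis
    proof cases
      case 1
      show ?thesis
        by (rule incomparableI[of 0 0 R "b + 1"], unfold standard_def degs_def) (use facts 1 in \<open>auto simp: algebra_simps\<close>)
    next
      case 2
      show ?thesis
        by (rule incomparableI[of P 2 R' "2 * b + c + 1"], unfold standard_def degs_def) (use facts 2 in \<open>auto simp: algebra_simps\<close>)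
    qed
  qed
  moreover have "sdeg n u + degs 2 1 \<noteq> degs 2 4"
    by (rule incomparableI[of 0 0 R "c + 1"], unfold standard_def degs_def) (use facts in \<open>auto simp: algebra_simps\<close>)
  moreover have "sdeg n u + degs 2 4 \<noteq> degs 2 1"
    by (rule incomparableI[of 0 1 0 "b"], unfold standard_def degs_def) (use facts in \<open>auto simp: algebra_simps\<close>)
  moreover have "sdeg n u + degs 2 1 \<noteq> degs 2 5"
    by (rule incomparableI[of 1 0 0 "1"], unfold standard_def degs_def) (use facts in \<open>auto simp: algebra_simps\<close>)
  moreover have "sdeg n u + degs 2 5 \<noteq> degs 2 1"
    by (rule incomparableI[of P 1 R' "2 * b + c"], unfold standard_def degs_def) (use facts in \<open>auto simp: algebra_simps\<close>)
  moreover have "sdeg n u + degs 2 2 \<noteq> degs 2 3"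
    by (rule incomparableI[of 0 0 1 "c"], unfold standard_def degs_def) (use facts in \<open>auto simp: algebra_simps\<close>)
  moreover have "sdeg n u + degs 2 3 \<noteq> degs 2 2"
    by (rule incomparableI[of 0 1 R' "b + 1"], unfold standard_def degs_def) (use facts in \<open>auto simp: algebra_simps\<close>)
  moreover have "sdeg n u + degs 2 2 \<noteq> degs 2 4"
    by (rule incomparableI[of P 0 0 "c"], unfold standard_def degs_def) (use facts in \<open>auto simp: algebra_simps\<close>)
  moreover have "sdeg n u + degs 2 4 \<noteq> degs 2 2"
    by (rule incomparableI[of 1 1 R' "2 * b + 1"], unfold standard_def degs_def) (use facts in \<open>auto simp: algebra_simps\<close>)
  moreover have "sdeg n u + degs 2 2 \<noteq> degs 2 5"
    by (rule incomparableI[of 0 1 1 "c + 1"], unfold standard_def degs_def) (use facts in \<open>auto simp: algebra_simps\<close>)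
  moreover have "sdeg n u + degs 2 5 \<noteq> degs 2 2"
    by (rule incomparableI[of 0 0 R' "b"], unfold standard_def degs_def) (use facts in \<open>auto simp: algebra_simps\<close>)
  moreover have "sdeg n u + degs 2 3 \<noteq> degs 2 4"
    by (rule incomparableI[of P 1 R' "b + c + 1"], unfold standard_def degs_def) (use facts in \<open>auto simp: algebra_simps\<close>)
  moreover have "sdeg n u + degs 2 4 \<noteq> degs 2 3"
    by (rule incomparableI[of 1 0 0 "b"], unfold standard_def degs_def) (use facts in \<open>auto simp: algebra_simps\<close>)
  moreover have "sdeg n u + degs 2 3 \<noteq> degs 2 5"
    by (rule incomparableI[of 0 1 0 "1"], unfold standard_def degs_def) (use facts in \<open>auto simp: algebra_simps\<close>)
  moreover have "sdeg n u + degs 2 5 \<noteq> degs 2 3"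
    by (rule incomparableI[of 0 0 R "b + c"], unfold standard_def degs_def) (use facts in \<open>auto simp: algebra_simps\<close>)
  moreover have "sdeg n u + degs 2 4 \<noteq> degs 2 5"
    by (rule incomparableI[of 1 1 0 "b + 1"], unfold standard_def degs_def) (use facts in \<open>auto simp: algebra_simps\<close>)
  moreover have "sdeg n u + degs 2 5 \<noteq> degs 2 4"
    by (rule incomparableI[of P 0 R' "b + c"], unfold standard_def degs_def) (use facts in \<open>auto simp: algebra_simps\<close>)
  ultimately have "\<forall>i<6. \<forall>j<6. i \<noteq> j \<longrightarrow> sdeg n u + degs 2 i \<noteq> degs 2 j"
    unfolding all_less_numerals by blast
  with assms(2-4) show ?thesis by blast
qed

lemma degs_3_incomparable:
  assumes "i < 2" "j < 2" "i \<noteq> j"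
  shows "sdeg n u + degs 3 i \<noteq> degs 3 j"
proof -
  note facts = params_pos rel1 rel2 rel3 rel4
  have "sdeg n u + degs 3 0 \<noteq> degs 3 1"
    by (rule incomparableI[of 0 0 R "1"], unfold standard_def degs_def) (use facts in \<open>auto simp: algebra_simps\<close>)
  moreover have "sdeg n u + degs 3 1 \<noteq> degs 3 0"
    by (rule incomparableI[of 0 1 0 "b + c"], unfold standard_def degs_def) (use facts in \<open>auto simp: algebra_simps\<close>)
  ultimately have "\<forall>i<2. \<forall>j<2. i \<noteq> j \<longrightarrow> sdeg n u + degs 3 i \<noteq> degs 3 j"
    unfolding all_less_numerals by blast
  with assms show ?thesis by blast
qed

theorem komeda_resolution_strongly_indispensable:
  assumes "2 \<le> c" "2 \<le> R"
  shows "strongly_indispensable n (komeda_resolution :: 'k::field based_complex)"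
proof (rule incomparable_degrees_strongly_indispensable[OF pos komeda_resolution_minimal])
  fix k i j u
  let ?F = "komeda_resolution :: 'k based_complex"
  assume ij: "i < rk ?F (Suc k)" "j < rk ?F (Suc k)" "i \<noteq> j"
  have "k \<le> 2" using ij(1) by (cases "Suc k" rule: level_cases) auto
  then consider "k = 0" | "k = 1" | "k = 2" by linarith
  then show "sdeg n u + bdeg ?F (Suc k) i \<noteq> bdeg ?F (Suc k) j"
  proof cases
    case 1
    then show ?thesis using degs_1_incomparable[OF assms(1)] ij by simp
  next
    case 2
    then show ?thesis using degs_2_incomparable[OF assms(2)] ij by (simp add: numeral_2_eq_2)
  next
    case 3
    then show ?thesis using degs_3_incomparable ij by simp
  qed
qed

end

section \<open>Failure of strong indispensability\<close>

lemma based_embedding_unit: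
  assumes "based_embedding n F G \<iota>" "j < rk F k"
  shows "\<exists>l<rk G k. \<exists>d. d \<noteq> 0 \<and> \<iota> k *\<^sub>v unit_vec (rk F k) j = const d \<cdot>\<^sub>v unit_vec (rk G k) l"
  using assms by (simp add: based_embedding_def)

lemma scaled_column_index:
  fixes M :: "'k::field pring mat"
  assumes M: "M \<in> carrier_mat m s" and "l < s" "a < m"
  shows "(const d \<cdot>\<^sub>v (M *\<^sub>v unit_vec s l)) $ a = const d * M $$ (a, l)"
  using mat_vec_unit_index[OF assms] M assms(3) by (simp del: index_mult_mat_vec)

lemma based_embedding_column:
  fixes F G :: "'k::field based_complex"
  assumes F: "graded_free_resolution n F" and G: "graded_free_resolution n G"
    and \<iota>: "based_embedding n F G \<iota>" and j: "j < rk F (Suc k)"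
    and eq: "\<iota> (Suc k) *\<^sub>v unit_vec (rk F (Suc k)) j = const d \<cdot>\<^sub>v unit_vec (rk G (Suc k)) l"
  shows "\<iota> k *\<^sub>v (diff_mat F k *\<^sub>v unit_vec (rk F (Suc k)) j)
    = const d \<cdot>\<^sub>v (diff_mat G k *\<^sub>v unit_vec (rk G (Suc k)) l)"
proof -
  have \<iota>c: "\<iota> k \<in> carrier_mat (rk G k) (rk F k)" "\<iota> (Suc k) \<in> carrier_mat (rk G (Suc k)) (rk F (Suc k))"
    and comm: "diff_mat G k * \<iota> (Suc k) = \<iota> k * diff_mat F k"
    using \<iota> unfolding based_embedding_def by blast+
  have "\<iota> k *\<^sub>v (diff_mat F k *\<^sub>v unit_vec (rk F (Suc k)) j)
      = diff_mat G k *\<^sub>v (\<iota> (Suc k) *\<^sub>v unit_vec (rk F (Suc k)) j)"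
    using assoc_mult_mat_vec[OF \<iota>c(1) diff_mat_carrier[OF F] unit_vec_carrier, of j]
      assoc_mult_mat_vec[OF diff_mat_carrier[OF G] \<iota>c(2) unit_vec_carrier, of j]
    by (simp only: comm)
  also have "\<dots> = const d \<cdot>\<^sub>v (diff_mat G k *\<^sub>v unit_vec (rk G (Suc k)) l)"
    unfolding eq by (rule mat_vec_smult[OF diff_mat_carrier[OF G] unit_vec_carrier])
  finally show ?thesis .
qed

context komeda
begin

lemma less_5_cases:
  assumes "l < (5::nat)" obtains "l = 0" | "l = 1" | "l = 2" | "l = 3" | "l = 4"
  using assms by linarith

lemma less_6_cases:
  assumes "l < (6::nat)" obtains "l = 0" | "l = 1" | "l = 2" | "l = 3" | "l = 4" | "l = 5"
  using assms by linarith

lemma \<phi>1_entries: "\<phi>1 $$ (0, 0) = f1" "\<phi>1 $$ (0, 1) = f2" "\<phi>1 $$ (0, 2) = f3"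
  "\<phi>1 $$ (0, 3) = f4" "\<phi>1 $$ (0, 4) = f5"
  by (simp_all add: \<phi>1_def mat_of_rows_list_def)

lemma \<phi>2_entries:
  "\<phi>2 $$ (2, 0) = monomial (b + 1) 0 0 0" "\<phi>2 $$ (2, 1) = monomial 1 P 0 0" "\<phi>2 $$ (2, 2) = monomial 0 0 0 R"
  "\<phi>2 $$ (2, 3) = 0" "\<phi>2 $$ (2, 4) = 0" "\<phi>2 $$ (2, 5) = - f2"
  "\<phi>2 $$ (0, 2) = monomial 0 0 Q 0" "\<phi>2 $$ (0, 5) = 0"
  by (simp_all add: \<phi>2_def mat_of_rows_list_def)

text \<open>
  Each generator contains a monomial with coefficient \<open>\<plusminus>1\<close> that occurs in none of the others, so
  proportional generators are equal.
\<close>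

lemma proportional_generators:
  fixes d d' :: "'k::field"
  assumes l: "l < 5" and l': "l' < 5" and d: "d \<noteq> 0"
    and eq: "const d * \<phi>1 $$ (0, l) = const d' * \<phi>1 $$ (0, l')"
  shows "l = l' \<and> d = d'"
proof -
  define t where "t = [expo (b + c + 1) 0 0 0, expo 0 (P + 1) 0 0, expo 0 0 (Q + 1) 0, expo 0 0 0 (R + 1), expo 0 1 0 R] ! l"
  have "d * coef (\<phi>1 $$ (0, l)) t = d' * coef (\<phi>1 $$ (0, l')) t"
    using arg_cong[OF eq, of "\<lambda>p. coef p t"] by simp
  then show ?thesis
    using l l' d params_pos unfolding t_def
    by (cases rule: less_5_cases[OF l]; cases rule: less_5_cases[OF l'])
      (simp_all add: \<phi>1_entries[unfolded One_nat_def] f_defs lookup_minus when_def)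
qed

lemma komeda_base_change:
  fixes p :: "'k::field pring"
  assumes s: "rk (komeda_resolution :: 'k based_complex) (Suc k) = s" and ij: "i < s" "i \<noteq> j"
    and deg: "\<And>u. u \<in> supp p \<Longrightarrow> sdeg n u + degs (Suc k) i = degs (Suc k) j"
  shows "minimal_graded_free_resolution n
    (base_change komeda_resolution k (elementary s i j p) (elementary s i j (- p)))"
proof (rule base_change_minimal[OF komeda_resolution_minimal]; unfold s komeda_resolution_simps)
  show "elementary s i j p * elementary s i j (- p) = 1\<^sub>m s"
    using ij by (rule elementary_inverse)
  show "elementary s i j (- p) * elementary s i j p = 1\<^sub>m s"
    using elementary_inverse[OF ij, of "- p"] by simp
qed (use deg in \<open>auto intro!: degree_preserving_elementary\<close>)

text \<open>
  For \<open>c = 1\<close> the degree of \<open>f3\<close> lies below that of \<open>f4\<close>, so \<open>f4\<close> may be replaced by its sum with a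
  multiple of \<open>f3\<close>. A strongly indispensable resolution would have a generator that is proportional to
  \<open>f4\<close> as well as to one of the new generators.
\<close>

lemma not_strongly_indispensable_if_c_eq_1:
  fixes F :: "'k::field based_complex"
  assumes c: "c = 1"
  shows "\<not> strongly_indispensable n F"
proof
  assume si: "strongly_indispensable n F"
  let ?K = "komeda_resolution :: 'k based_complex"
  obtain P' where P': "P = Suc P'" using params_pos by (metis gr0_implies_Suc)
  let ?p = "monomial 0 P' Q 0 :: 'k pring"
  define G where "G = base_change ?K 0 (elementary 5 2 3 ?p) (elementary 5 2 3 (- ?p))"
  have G: "minimal_graded_free_resolution n G"
    unfolding G_def
    by (rule komeda_base_change, simp, unfold degs_def)
      (use rel3 rel4 c P' in \<open>auto simp: sdeg_expo_eq algebra_simps\<close>)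
  obtain \<iota> \<kappa> where \<iota>: "based_embedding n F ?K \<iota>" and \<kappa>: "based_embedding n F G \<kappa>"
    using si G komeda_resolution_minimal unfolding strongly_indispensable_def by blast
  have F: "minimal_graded_free_resolution n F" using si by (simp add: strongly_indispensable_def)
  have Fr: "graded_free_resolution n F" and Kr: "graded_free_resolution n ?K" and Gr: "graded_free_resolution n G"
    using F G komeda_resolution_minimal by (auto simp: minimal_graded_free_resolution_def)
  obtain j d where j: "j < rk F (Suc 0)" and d: "d \<noteq> 0"
    and \<iota>j: "\<iota> (Suc 0) *\<^sub>v unit_vec (rk F (Suc 0)) j = const d \<cdot>\<^sub>v unit_vec (rk ?K (Suc 0)) 3"
    using based_embedding_onto[OF F komeda_resolution_minimal \<iota>, of 3 "Suc 0"] by auto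
  obtain l d' where l: "l < rk G (Suc 0)" and d': "d' \<noteq> 0"
    and \<kappa>j: "\<kappa> (Suc 0) *\<^sub>v unit_vec (rk F (Suc 0)) j = const d' \<cdot>\<^sub>v unit_vec (rk G (Suc 0)) l"
    using based_embedding_unit[OF \<kappa> j] by blast
  have l5: "l < 5" using l by (simp add: G_def)
  have "\<iota> 0 = \<kappa> 0" using \<iota> \<kappa> by (simp add: based_embedding_def)
  then have eq: "const d \<cdot>\<^sub>v (\<phi>1 *\<^sub>v unit_vec 5 3) = const d' \<cdot>\<^sub>v (\<phi>1 * elementary 5 2 3 ?p *\<^sub>v unit_vec 5 l)"
    using based_embedding_column[OF Fr Kr \<iota> j \<iota>j] based_embedding_column[OF Fr Gr \<kappa> j \<kappa>j]
    by (simp add: G_def)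
  have \<phi>E: "\<phi>1 * elementary 5 2 3 ?p \<in> carrier_mat 1 5"
    using \<phi>_carrier(1) elementary_carrier by (rule mult_carrier_mat)
  have "(const d \<cdot>\<^sub>v (\<phi>1 *\<^sub>v unit_vec 5 3)) $ 0 = const d * \<phi>1 $$ (0, 3)"
    by (rule scaled_column_index[OF \<phi>_carrier(1)]) simp_all
  moreover have "(const d' \<cdot>\<^sub>v (\<phi>1 * elementary 5 2 3 ?p *\<^sub>v unit_vec 5 l)) $ 0
      = const d' * (\<phi>1 $$ (0, l) + (if l = 3 then \<phi>1 $$ (0, 2) * ?p else 0))"
    by (subst scaled_column_index[OF \<phi>E l5], simp, subst mult_elementary_index[OF \<phi>_carrier(1)])
      (use l5 in simp_all)
  ultimately have eq0: "const d * \<phi>1 $$ (0, 3) = const d' * (\<phi>1 $$ (0, l) + (if l = 3 then \<phi>1 $$ (0, 2) * ?p else 0))"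
    using eq by simp
  show False
  proof (cases "l = 3")
    case False
    with eq0 have "const d * \<phi>1 $$ (0, 3) = const d' * \<phi>1 $$ (0, l)" by simp
    from proportional_generators[OF _ l5 d this] False show False by simp
  next
    case True
    have e: "const d * f4 = const d' * (f4 + f3 * ?p)"
      using eq0 True by (simp add: \<phi>1_entries)
    \<comment> \<open>The leading term of the added multiple of \<open>f3\<close> does not occur in \<open>f4\<close>.\<close>
    have "coef (const d * f4) (expo 0 P' (2 * Q + 1) 0) = 0"
      unfolding coef_const_mult f4_def using params_pos by (simp add: lookup_minus)
    moreover have "coef (const d' * (f4 + f3 * ?p)) (expo 0 P' (2 * Q + 1) 0) = d'"
      unfolding coef_const_mult f4_def f3_def using params_pos
      by (simp add: lookup_minus lookup_add left_diff_distrib monomial_mult when_def)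
    ultimately show False using e d' by simp
  qed
qed

text \<open>
  For \<open>R = 1\<close> the same happens one step later: the third syzygy lies in a degree below that of the last one, the
  Koszul syzygy of \<open>f2\<close> and \<open>f3\<close>. The two embeddings agree on the generators, since these are not
  proportional, and therefore identify the syzygies consistently.
\<close>

lemma not_strongly_indispensable_if_R_eq_1:
  fixes F :: "'k::field based_complex"
  assumes R: "R = 1"
  shows "\<not> strongly_indispensable n F"
proof
  assume si: "strongly_indispensable n F"
  let ?K = "komeda_resolution :: 'k based_complex"
  let ?p = "monomial b 0 0 0 :: 'k pring"
  define G where "G = base_change ?K 1 (elementary 6 2 5 ?p) (elementary 6 2 5 (- ?p))"
  have G: "minimal_graded_free_resolution n G"
    unfolding G_def
    by (rule komeda_base_change, simp, unfold degs_def)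
      (use rel2 R in \<open>auto simp: sdeg_expo_eq algebra_simps\<close>)
  have Gs: "rk G = rk ?K" "diff_mat G 0 = \<phi>1" "diff_mat G 1 = \<phi>2 * elementary 6 2 5 ?p"
    by (simp_all add: G_def)
  obtain \<iota> \<kappa> where \<iota>: "based_embedding n F ?K \<iota>" and \<kappa>: "based_embedding n F G \<kappa>"
    using si G komeda_resolution_minimal unfolding strongly_indispensable_def by blast
  have F: "minimal_graded_free_resolution n F" using si by (simp add: strongly_indispensable_def)
  have Fr: "graded_free_resolution n F" and Kr: "graded_free_resolution n ?K" and Gr: "graded_free_resolution n G"
    using F G komeda_resolution_minimal by (auto simp: minimal_graded_free_resolution_def)
  \<comment> \<open>The change of basis does not affect the generators.\<close>
  have "\<iota> 1 = \<kappa> 1"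
  proof (rule mat_eq_unitI[of _ 5 "rk F 1"])
    show "\<iota> 1 \<in> carrier_mat 5 (rk F 1)" "\<kappa> 1 \<in> carrier_mat 5 (rk F 1)"
      using \<iota> \<kappa> unfolding based_embedding_def by (metis Gs(1) komeda_resolution_simps(2))+
    fix j assume j: "j < rk F 1"
    obtain l d where l: "l < 5" and d: "d \<noteq> 0"
      and \<iota>j: "\<iota> 1 *\<^sub>v unit_vec (rk F 1) j = const d \<cdot>\<^sub>v unit_vec 5 l"
      using \<iota> j unfolding based_embedding_def by (metis komeda_resolution_simps(2))
    obtain l' d' where l': "l' < 5" and d': "d' \<noteq> 0"
      and \<kappa>j: "\<kappa> 1 *\<^sub>v unit_vec (rk F 1) j = const d' \<cdot>\<^sub>v unit_vec 5 l'"
      using \<kappa> j unfolding based_embedding_def by (metis Gs(1) komeda_resolution_simps(2))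
    have "\<iota> 0 = \<kappa> 0" using \<iota> \<kappa> by (simp add: based_embedding_def)
    then have "const d \<cdot>\<^sub>v (\<phi>1 *\<^sub>v unit_vec 5 l) = const d' \<cdot>\<^sub>v (\<phi>1 *\<^sub>v unit_vec 5 l')"
      using based_embedding_column[OF Fr Kr \<iota>, of j 0 d l] based_embedding_column[OF Fr Gr \<kappa>, of j 0 d' l'] j \<iota>j \<kappa>j
      by (simp add: Gs)
    from arg_cong[OF this, of "\<lambda>v. v $ 0"]
    have "const d * \<phi>1 $$ (0, l) = const d' * \<phi>1 $$ (0, l')"
      by (simp only: scaled_column_index[OF \<phi>_carrier(1) l less_numeral_extra(1)[where 'a = nat]]
        scaled_column_index[OF \<phi>_carrier(1) l' less_numeral_extra(1)[where 'a = nat]])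
    from proportional_generators[OF l l' d this] \<iota>j \<kappa>j
    show "\<iota> 1 *\<^sub>v unit_vec (rk F 1) j = \<kappa> 1 *\<^sub>v unit_vec (rk F 1) j" by simp
  qed
  obtain j d where j: "j < rk F (Suc 1)" and d: "d \<noteq> 0"
    and \<iota>j: "\<iota> (Suc 1) *\<^sub>v unit_vec (rk F (Suc 1)) j = const d \<cdot>\<^sub>v unit_vec (rk ?K (Suc 1)) 5"
    using based_embedding_onto[OF F komeda_resolution_minimal \<iota>, of 5 "Suc 1"] by auto
  obtain l d' where l: "l < rk G (Suc 1)" and d': "d' \<noteq> 0"
    and \<kappa>j: "\<kappa> (Suc 1) *\<^sub>v unit_vec (rk F (Suc 1)) j = const d' \<cdot>\<^sub>v unit_vec (rk G (Suc 1)) l"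
    using based_embedding_unit[OF \<kappa> j] by blast
  have l6: "l < 6" using l by (simp add: Gs)
  have eq: "const d \<cdot>\<^sub>v (\<phi>2 *\<^sub>v unit_vec 6 5) = const d' \<cdot>\<^sub>v (\<phi>2 * elementary 6 2 5 ?p *\<^sub>v unit_vec 6 l)"
    using based_embedding_column[OF Fr Kr \<iota> j \<iota>j] based_embedding_column[OF Fr Gr \<kappa> j \<kappa>j] \<open>\<iota> 1 = \<kappa> 1\<close>
    by (simp add: Gs[unfolded One_nat_def])
  have \<phi>E: "\<phi>2 * elementary 6 2 5 ?p \<in> carrier_mat 5 6"
    using \<phi>_carrier(2) elementary_carrier by (rule mult_carrier_mat)
  have entry: "const d * \<phi>2 $$ (a, 5) = const d' * (\<phi>2 $$ (a, l) + (if l = 5 then \<phi>2 $$ (a, 2) * ?p else 0))"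
    if a: "a < 5" for a
  proof -
    have "(const d \<cdot>\<^sub>v (\<phi>2 *\<^sub>v unit_vec 6 5)) $ a = const d * \<phi>2 $$ (a, 5)"
      by (rule scaled_column_index[OF \<phi>_carrier(2) _ a]) simp
    moreover have "(const d' \<cdot>\<^sub>v (\<phi>2 * elementary 6 2 5 ?p *\<^sub>v unit_vec 6 l)) $ a
        = const d' * (\<phi>2 $$ (a, l) + (if l = 5 then \<phi>2 $$ (a, 2) * ?p else 0))"
      by (subst scaled_column_index[OF \<phi>E l6 a], subst mult_elementary_index[OF \<phi>_carrier(2)])
        (use l6 a in simp_all)
    ultimately show ?thesis using eq by simp
  qed
  \<comment> \<open>In the third row, the monomial \<open>y\<^sup>P\<^sup>+\<^sup>1\<close> occurs only in the last column.\<close>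
  have "d * coef (\<phi>2 $$ (2, 5)) (expo 0 (P + 1) 0 0)
      = d' * coef (\<phi>2 $$ (2, l) + (if l = 5 then \<phi>2 $$ (2, 2) * ?p else 0)) (expo 0 (P + 1) 0 0)"
    using arg_cong[OF entry[of 2], of "\<lambda>p. coef p (expo 0 (P + 1) 0 0)"] by simp
  then have l5: "l = 5"
    using d params_pos
    by (cases rule: less_6_cases[OF l6])
      (simp_all add: \<phi>2_entries[unfolded One_nat_def] f2_def lookup_minus lookup_add)
  \<comment> \<open>In the first row, the old last column has the entry zero, but the new one has not.\<close>
  have "const d' * (monomial 0 0 Q 0 * ?p) = 0"
    using entry[of 0] by (simp add: l5 \<phi>2_entries)
  from arg_cong[OF this, of "\<lambda>p. coef p (expo b 0 Q 0)"] show False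
    using d' by (simp add: monomial_mult)
qed

theorem strongly_indispensable_iff:
  "(\<exists>F :: 'k::field based_complex. strongly_indispensable n F) \<longleftrightarrow> 2 \<le> c \<and> 2 \<le> R"
proof
  assume "\<exists>F :: 'k based_complex. strongly_indispensable n F"
  then obtain F :: "'k based_complex" where F: "strongly_indispensable n F" by blast
  have "c \<noteq> 1" using F not_strongly_indispensable_if_c_eq_1 by blast
  moreover have "R \<noteq> 1" using F not_strongly_indispensable_if_R_eq_1 by blast
  ultimately show "2 \<le> c \<and> 2 \<le> R" using params_pos by linarith
next
  assume "2 \<le> c \<and> 2 \<le> R"
  then show "\<exists>F :: 'k based_complex. strongly_indispensable n F"
    using komeda_resolution_strongly_indispensable by blast
qed

end


section \<open>The classification\<close>

lemma minimally_generating_not_multiple: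
  assumes "minimally_generating n"
  shows "n 2 \<noteq> k * n 3"
proof
  assume eq: "n 2 = k * n 3"
  have "gen_semigroup n UNIV \<subseteq> gen_semigroup n (UNIV - {2})"
  proof
    fix s assume "s \<in> gen_semigroup n UNIV"
    then obtain u where s: "s = (\<Sum>i\<in>UNIV. u i * n i)" by (auto simp: gen_semigroup_def)
    \<comment> \<open>The third generator takes over the share of the second.\<close>
    define u' where "u' = u(2 := 0, 3 := u 3 + u 2 * k)"
    have "s = (\<Sum>i\<in>UNIV. u' i * n i)"
      unfolding s sum_UNIV_4 by (simp add: u'_def eq algebra_simps)
    also have "\<dots> = u' 2 * n 2 + (\<Sum>i\<in>UNIV - {2}. u' i * n i)"
      by (rule sum.remove) auto
    finally have "s = (\<Sum>i\<in>UNIV - {2}. u' i * n i)" by (simp add: u'_def)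
    then show "s \<in> gen_semigroup n (UNIV - {2})" unfolding gen_semigroup_def by blast
  qed
  moreover have "gen_semigroup n (UNIV - {2}) \<subseteq> gen_semigroup n UNIV"
  proof
    fix s assume "s \<in> gen_semigroup n (UNIV - {2})"
    then obtain u where s: "s = (\<Sum>i\<in>UNIV - {2}. u i * n i)" by (auto simp: gen_semigroup_def)
    define u' where "u' = u(2 := 0)"
    have "(\<Sum>i\<in>UNIV. u' i * n i) = u' 2 * n 2 + (\<Sum>i\<in>UNIV - {2}. u' i * n i)"
      by (rule sum.remove) auto
    also have "\<dots> = s" unfolding s u'_def by (auto intro!: sum.cong)
    finally show "s \<in> gen_semigroup n UNIV" unfolding gen_semigroup_def by blast
  qed
  ultimately show False
    using assms unfolding minimally_generating_def by (metis Diff_subset UNIV_I DiffD2 insertI1 psubsetI subset_antisym)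
qed

theorem theorem2p6:
  fixes n :: "4 \<Rightarrow> nat" and \<alpha> :: "4 \<Rightarrow> int" and \<alpha>21 :: int
  assumes "\<forall>i. 0 < n i"
    and "Gcd (range n) = 1"
    and "minimally_generating n"
    and "pseudo_symmetric (gen_semigroup n UNIV)"
    and "defining_integers n \<alpha> \<alpha>21"
  shows "(\<exists>F :: 'k::field based_complex. strongly_indispensable n F) \<longleftrightarrow>
    2 < \<alpha> 4 \<and> 2 < \<alpha> 1 - \<alpha>21"
proof -
  have gt: "1 < \<alpha> 2" "1 < \<alpha> 3" "1 < \<alpha> 4" "0 < \<alpha>21" "\<alpha>21 < \<alpha> 1"
    and form: "int (n 1) = \<alpha> 2 * \<alpha> 3 * (\<alpha> 4 - 1) + 1"
      "int (n 2) = \<alpha>21 * \<alpha> 3 * \<alpha> 4 + (\<alpha> 1 - \<alpha>21 - 1) * (\<alpha> 3 - 1) + \<alpha> 3"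
      "int (n 3) = \<alpha> 1 * \<alpha> 4 + (\<alpha> 1 - \<alpha>21 - 1) * (\<alpha> 2 - 1) * (\<alpha> 4 - 1) - \<alpha> 4 + 1"
      "int (n 4) = \<alpha> 1 * \<alpha> 2 * (\<alpha> 3 - 1) + \<alpha>21 * (\<alpha> 2 - 1) + \<alpha> 2"
    using assms(5) unfolding defining_integers_def by blast+
  define b c P Q R where "b = nat \<alpha>21" "c = nat (\<alpha> 1 - \<alpha>21 - 1)"
    "P = nat (\<alpha> 2 - 1)" "Q = nat (\<alpha> 3 - 1)" "R = nat (\<alpha> 4 - 1)"
  note defs = this
  have \<alpha>: "\<alpha>21 = int b" "\<alpha> 1 = int b + int c + 1" "\<alpha> 2 = int P + 1" "\<alpha> 3 = int Q + 1" "\<alpha> 4 = int R + 1"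
    using gt by (simp_all add: defs)
  note form = form[unfolded \<alpha>]
  have rel1: "(b + c + 1) * n 1 = n 3 + R * n 4"
    by (rule of_nat_eq_iff[where 'a = int, THEN iffD1])
      (simp add: form algebra_simps)
  have rel2: "(P + 1) * n 2 = b * n 1 + n 4"
    by (rule of_nat_eq_iff[where 'a = int, THEN iffD1])
      (simp add: form algebra_simps)
  have rel3: "(Q + 1) * n 3 = c * n 1 + n 2"
    by (rule of_nat_eq_iff[where 'a = int, THEN iffD1])
      (simp add: form algebra_simps)
  have rel4: "(R + 1) * n 4 = n 1 + P * n 2 + Q * n 3"
    by (rule of_nat_eq_iff[where 'a = int, THEN iffD1])
      (simp add: form algebra_simps)
  have n1: "n 1 = (P + 1) * (Q + 1) * R + 1"
    by (rule of_nat_eq_iff[where 'a = int, THEN iffD1])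
      (simp add: form algebra_simps)
  have "c \<noteq> 0"
  proof
    assume "c = 0"
    with rel3 have "n 2 = (Q + 1) * n 3" by simp
    with minimally_generating_not_multiple[OF assms(3)] show False by blast
  qed
  then have "0 < b" "0 < c" "0 < P" "0 < Q" "0 < R"
    using gt by (simp_all add: defs)
  then interpret komeda n "n 1" "n 2" "n 3" "n 4" b c P Q R
    using assms(1,2) rel1 rel2 rel3 rel4 n1 by unfold_locales auto
  have "2 \<le> c \<and> 2 \<le> R \<longleftrightarrow> 2 < \<alpha> 4 \<and> 2 < \<alpha> 1 - \<alpha>21"
    unfolding \<alpha> by auto
  with strongly_indispensable_iff show ?thesis by blast
qed

end
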